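(* Let $n$ be a positive integer, let $T_0>0$ and $s>3/2$, and let $u\in C^0([0,T_0];H^s(\mathbb{R}))$ be a solution of $$u_t-u_{txx}+\frac{(n+1)(n+2)}{2}u^nu_x=\frac{n(n-1)}{2}u^{n-2}u_x^3+2n u^{n-1}u_xu_{xx}+u^n u_{xxx}$$ with initial condition $u(0,x)=u_0(x)$. Assume that for some $\theta\in(0,1)$, $$|u_0(x)|\sim O(e^{-\theta x})\quad\text{and}\quad |u_0'(x)|\sim O(e^{-\theta x})\quad\text{as } x\to+\infty.$$ Then $$|u(t,x)|\sim O(e^{-\theta x})\quad\text{and}\quad |u_x(t,x)|\sim O(e^{-\theta x})\quad\text{as } x\to+\infty,$$ uniformly in $t\in[0,T_0]$.
   Context: Notation: $|f(x)|\sim O(e^{ax})$ as $x\to+\infty$ means that there exists some (finite) $L$ (possibly $L=0$) such that $\lim_{x\to\infty}|f(x)|/e^{ax}=L$. Solutions: the equation is understood in the equivalent nonlocal form $$u_t+u^nu_x+\partial_x(1-\partial_x^2)^{-1}\left(\frac n2u^{n-1}u_x^2+\frac{n(n+3)}{2(n+1)}u^{n+1}\right)=0,$$ where $(1-\partial_x^2)^{-1}f=g*f$ with $g(x)=e^{-|x|}/2$. For $u_0\in H^s(\mathbb{R})$, $s>3/2$, the Cauchy problem has a unique solution $u\in C^0([0,T);H^s(\mathbb{R}))\cap C^1([0,T);H^{s-1}(\mathbb{R}))$ for some $T>0$; here $T_0\in(0,T)$ is arbitrary and $u$ is this (real-valued) solution restricted to $[0,T_0]$. *)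

theory Defs
  imports "HOL-Analysis.Analysis"
begin

definition L2_fun :: "(real \<Rightarrow> 'a::{banach,second_countable_topology}) \<Rightarrow> bool" where
  "L2_fun f \<longleftrightarrow>
     f \<in> borel_measurable lborel \<and> integrable lborel (\<lambda>x. (norm (f x))\<^sup>2)"

text \<open>Here \<open>D k\<close> is the \<open>k\<close>-th derivative of \<open>\<phi>\<close>.\<close>

definition schwartz :: "(real \<Rightarrow> complex) \<Rightarrow> bool" where
  "schwartz \<phi> \<longleftrightarrow>
     (\<exists>D :: nat \<Rightarrow> real \<Rightarrow> complex.
        D 0 = \<phi> \<and>
        (\<forall>k x. (D k has_vector_derivative D (Suc k) x) (at x)) \<and>
        (\<forall>k m. bounded (range (\<lambda>x. x ^ m *\<^sub>R D k x))))"

definition fourier_integral :: "(real \<Rightarrow> complex) \<Rightarrow> real \<Rightarrow> complex" where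
  "fourier_integral \<phi> \<xi> = (LINT x|lborel. cis (- (x * \<xi>)) * \<phi> x)"

text \<open>The Fourier transform on \<open>L\<^sup>2\<close>, as usual through duality with Schwartz functions
  (tempered distributions). It is determined up to null sets.\<close>

definition has_fourier_transform :: "(real \<Rightarrow> real) \<Rightarrow> (real \<Rightarrow> complex) \<Rightarrow> bool" where
  "has_fourier_transform f F \<longleftrightarrow>
     L2_fun f \<and> L2_fun F \<and>
     (\<forall>\<phi>. schwartz \<phi> \<longrightarrow>
        (LINT \<xi>|lborel. F \<xi> * \<phi> \<xi>) =
        (LINT x|lborel. complex_of_real (f x) * fourier_integral \<phi> x))"

definition fourier_transform :: "(real \<Rightarrow> real) \<Rightarrow> real \<Rightarrow> complex" where
  "fourier_transform f = (SOME F. has_fourier_transform f F)"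

text \<open>The real-valued elements of \<open>H\<^sup>s(\<real>)\<close>, for \<open>s \<ge> 0\<close> only (so that \<open>H\<^sup>s \<subseteq> L\<^sup>2\<close>), as functions
  rather than as classes modulo null sets.\<close>

definition sobolev :: "real \<Rightarrow> (real \<Rightarrow> real) set" where
  "sobolev s =
     {f. \<exists>F. has_fourier_transform f F \<and>
             integrable lborel (\<lambda>\<xi>. (1 + \<xi>\<^sup>2) powr s * (cmod (F \<xi>))\<^sup>2)}"

definition sobolev_norm :: "real \<Rightarrow> (real \<Rightarrow> real) \<Rightarrow> real" where
  "sobolev_norm s f =
     sqrt (LINT \<xi>|lborel. (1 + \<xi>\<^sup>2) powr s * (cmod (fourier_transform f \<xi>))\<^sup>2)"

text \<open>\<open>u \<in> C\<^sup>0(I; H\<^sup>s)\<close>, where \<open>u t\<close> is the function \<open>u(t, \<cdot>)\<close>.\<close>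

definition sobolev_C0 :: "real \<Rightarrow> real set \<Rightarrow> (real \<Rightarrow> real \<Rightarrow> real) \<Rightarrow> bool" where
  "sobolev_C0 s I u \<longleftrightarrow>
     (\<forall>t\<in>I. u t \<in> sobolev s) \<and>
     (\<forall>t\<in>I. ((\<lambda>r. sobolev_norm s (\<lambda>x. u r x - u t x)) \<longlongrightarrow> 0) (at t within I))"

text \<open>\<open>u \<in> C\<^sup>1(I; H\<^sup>s)\<close> with time derivative \<open>v\<close>; one-sided at endpoints of \<open>I\<close>.\<close>

definition sobolev_C1_deriv ::
    "real \<Rightarrow> real set \<Rightarrow> (real \<Rightarrow> real \<Rightarrow> real) \<Rightarrow> (real \<Rightarrow> real \<Rightarrow> real) \<Rightarrow> bool" where
  "sobolev_C1_deriv s I u v \<longleftrightarrow>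
     sobolev_C0 s I u \<and> sobolev_C0 s I v \<and>
     (\<forall>t\<in>I. ((\<lambda>r. sobolev_norm s (\<lambda>x. (u r x - u t x) / (r - t) - v t x)) \<longlongrightarrow> 0)
             (at t within I))"

text \<open>\<open>(1 - \<partial>\<^sub>x\<^sup>2)\<^sup>-\<^sup>1 f = g * f\<close> with \<open>g(x) = e\<^sup>-\<^sup>|\<^sup>x\<^sup>| / 2\<close>.\<close>

definition inv_helmholtz :: "(real \<Rightarrow> real) \<Rightarrow> real \<Rightarrow> real" where
  "inv_helmholtz f x = (LINT y|lborel. exp (- \<bar>x - y\<bar>) / 2 * f y)"

text \<open>Solutions on the time interval \<open>I\<close>, in the class \<open>C\<^sup>0(I; H\<^sup>s) \<inter> C\<^sup>1(I; H\<^sup>s\<^sup>-\<^sup>1)\<close> with \<open>s > 3/2\<close>,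
  of the equation
  \<open>u\<^sub>t + u\<^sup>n u\<^sub>x + \<partial>\<^sub>x (1 - \<partial>\<^sub>x\<^sup>2)\<^sup>-\<^sup>1 (n/2 u\<^sup>n\<^sup>-\<^sup>1 u\<^sub>x\<^sup>2 + n(n+3)/(2(n+1)) u\<^sup>n\<^sup>+\<^sup>1) = 0\<close>.
  Each \<open>u t\<close> is the continuous representative of its class, which by Sobolev embedding is
  continuously differentiable, so \<open>u\<^sub>x\<close> is the classical derivative. The equation is one between
  elements of \<open>H\<^sup>s\<^sup>-\<^sup>1\<close>, hence holds almost everywhere in \<open>x\<close>.\<close>

definition solution_on ::
    "nat \<Rightarrow> real \<Rightarrow> real set \<Rightarrow> (real \<Rightarrow> real \<Rightarrow> real) \<Rightarrow> bool" where
  "solution_on n s I u \<longleftrightarrow>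
     (\<forall>t\<in>I. continuous_on UNIV (u t)) \<and>
     sobolev_C0 s I u \<and>
     (\<exists>v. sobolev_C1_deriv (s - 1) I u v \<and>
        (\<forall>t\<in>I. AE x in lborel.
           v t x + (u t x) ^ n * deriv (u t) x
           + deriv (inv_helmholtz (\<lambda>y.
               real n / 2 * (u t y) ^ (n - 1) * (deriv (u t) y)\<^sup>2
               + real n * (real n + 3) / (2 * (real n + 1)) * (u t y) ^ (n + 1))) x = 0))"

text \<open>\<open>|f(x)| \<sim> O(e\<^sup>a\<^sup>x)\<close> as \<open>x \<rightarrow> +\<infinity>\<close>: the quotient has a finite limit, possibly \<open>0\<close>.\<close>

definition exp_order :: "real \<Rightarrow> (real \<Rightarrow> real) \<Rightarrow> bool" where
  "exp_order a f \<longleftrightarrow> (\<exists>L. ((\<lambda>x. \<bar>f x\<bar> / exp (a * x)) \<longlongrightarrow> L) at_top)"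

text \<open>The same for every \<open>f t\<close> with \<open>t \<in> I\<close>, where the limit \<open>L t\<close> may depend on \<open>t\<close>
  and is attained uniformly.\<close>

definition exp_order_uniform :: "real \<Rightarrow> real set \<Rightarrow> (real \<Rightarrow> real \<Rightarrow> real) \<Rightarrow> bool" where
  "exp_order_uniform a I f \<longleftrightarrow>
     (\<exists>L. uniform_limit I (\<lambda>x t. \<bar>f t x\<bar> / exp (a * x)) L at_top)"

end

theory Submission
  imports Defs "HOL-Probability.Probability" "HOL-Real_Asymp.Real_Asymp"
begin

text \<open>By Sobolev embedding \<open>u\<close> and \<open>u\<^sub>x\<close> are bounded and jointly continuous, and the equation holds
  pointwise. Along a characteristic \<open>q' = u\<^sup>n(t, q)\<close> the function \<open>u\<close> satisfies
  \<open>d/dt u = - \<partial>\<^sub>x (1 - \<partial>\<^sub>x\<^sup>2)\<^sup>-\<^sup>1 F\<close>, and \<open>u\<^sub>x\<close> satisfies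
  \<open>d/dt u\<^sub>x = - n u\<^sup>n\<^sup>-\<^sup>1 u\<^sub>x\<^sup>2 - \<partial>\<^sub>x\<^sup>2 (1 - \<partial>\<^sub>x\<^sup>2)\<^sup>-\<^sup>1 F\<close>, where \<open>F\<close> is the expression under the nonlocal
  operator and all right-hand sides are of degree \<open>n + 1 \<ge> 2\<close> in \<open>(u, u\<^sub>x)\<close>. The kernel \<open>e\<^sup>-\<^sup>|\<^sup>x\<^sup>|\<close> preserves exponential weights of rate below \<open>1\<close>, so a
  weighted supremum estimate first gives \<open>|u| + |u\<^sub>x| \<le> K e\<^sup>-\<^sup>\<theta>\<^sup>x\<close> uniformly in time. By the higher degree
  the sources are then \<open>O(e\<^sup>-\<^sup>(\<^sup>\<theta>\<^sup>+\<^sup>\<rho>\<^sup>)\<^sup>x)\<close> for some \<open>\<rho> > 0\<close>, while characteristics move points near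
  \<open>+\<infinity>\<close> by \<open>O(e\<^sup>-\<^sup>\<theta>\<^sup>x)\<close> only. Hence both functions keep the limits that they have at time \<open>0\<close>.\<close>

text \<open>Two passes are made because, with sources measured in the weight exp(-\<theta> x), the
  Duhamel integral has the same order as the solution: this bounds the quotient but gives it no
  limit. Only a strictly larger rate makes the change over time negligible against exp(-\<theta> x).
  The degree alone would give a rate of at least 2 \<theta>, the kernel admits only rates below 1;
  \<rho> is half the smaller of the two margins \<theta> and 1 - \<theta>. All that is asked of a
  weight is w(y) \<le> exp(\<eta> |x - y|) w(x) with \<eta> < 1, which permits growth at
  -\<infinity> and tolerates bounded shifts along characteristics. Characteristics are run
  backwards, from (t, x) to a foot (0, y), so that each value is compared with a single value of the
  data, with constants independent of t. The long Fourier part is forced by the Sobolev spaces: the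
  transform is given only by duality with Schwartz functions and selected by choice, so uniqueness
  and inversion must precede any pointwise statement.\<close>

section \<open>Fourier transforms and Sobolev embedding\<close>

lemma power_le_fact_exp:
  fixes x :: real
  assumes "x \<ge> 0"
  shows "x ^ n \<le> fact n * exp x"
proof -
  have "(\<Sum>i\<in>{n}. inverse (fact i) *\<^sub>R x ^ i) \<le> (\<Sum>i. inverse (fact i) *\<^sub>R x ^ i)"
    by (rule sum_le_suminf[OF summable_exp_generic]) (use assms in auto)
  also have "\<dots> = exp x" by (simp add: exp_def)
  finally show ?thesis by (simp add: field_simps)
qed

text \<open>Once the power is traded for \<open>exp \<bar>x\<bar>\<close>, completing the square
  finishes: the exponent on the right is the maximum of (1 + |b|) y - y^2/2, attained at y = 1 +
  |b|.\<close>

lemma power_gauss_bound: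
  fixes x b :: real
  shows "\<bar>x\<bar> ^ j * exp (- x\<^sup>2 / 2 + b * x) \<le> fact j * exp ((1 + \<bar>b\<bar>)\<^sup>2 / 2)"
proof -
  define E where "E = exp (- x\<^sup>2 / 2 + b * x)"
  have "b * x \<le> \<bar>b\<bar> * \<bar>x\<bar>" by (metis abs_ge_self abs_mult)
  moreover have "0 \<le> (\<bar>x\<bar> - (1 + \<bar>b\<bar>))\<^sup>2" by simp
  ultimately have "\<bar>x\<bar> + (- x\<^sup>2 / 2 + b * x) \<le> (1 + \<bar>b\<bar>)\<^sup>2 / 2"
    by (simp add: power2_eq_square algebra_simps)
  then have "exp \<bar>x\<bar> * E \<le> exp ((1 + \<bar>b\<bar>)\<^sup>2 / 2)"
    by (simp add: E_def flip: exp_add)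
  then have "fact j * (exp \<bar>x\<bar> * E) \<le> fact j * exp ((1 + \<bar>b\<bar>)\<^sup>2 / 2)"
    by (intro mult_left_mono) auto
  moreover have "\<bar>x\<bar> ^ j * E \<le> fact j * exp \<bar>x\<bar> * E"
    by (intro mult_right_mono power_le_fact_exp) (auto simp: E_def)
  ultimately have "\<bar>x\<bar> ^ j * E \<le> fact j * exp ((1 + \<bar>b\<bar>)\<^sup>2 / 2)" by (simp only: mult.assoc)
  then show ?thesis unfolding E_def .
qed

lemma bounded_poly_gauss:
  fixes a :: complex and p :: "complex poly"
  shows "bounded (range (\<lambda>x::real. x ^ m *\<^sub>R
    (poly p (of_real x) * exp (- (of_real x)\<^sup>2 / 2 + a * of_real x))))"
proof -
  define B where "B = (\<Sum>i\<le>degree p. cmod (coeff p i) * (fact (m + i) * exp ((1 + \<bar>Re a\<bar>)\<^sup>2 / 2)))"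
  have "cmod (x ^ m *\<^sub>R (poly p (of_real x) * exp (- (of_real x)\<^sup>2 / 2 + a * of_real x))) \<le> B" for x :: real
  proof -
    define G where "G = exp (- x\<^sup>2 / 2 + Re a * x)"
    have *: "cmod (exp (- (of_real x)\<^sup>2 / 2 + a * of_real x)) = G"
      by (simp add: norm_exp_eq_Re G_def power2_eq_square)
    have "cmod (poly p (of_real x)) \<le> (\<Sum>i\<le>degree p. cmod (coeff p i) * \<bar>x\<bar> ^ i)"
      unfolding poly_altdef by (rule sum_norm_le) (simp add: norm_mult norm_power)
    then have "\<bar>x\<bar> ^ m * (cmod (poly p (of_real x)) * G) \<le>
       \<bar>x\<bar> ^ m * ((\<Sum>i\<le>degree p. cmod (coeff p i) * \<bar>x\<bar> ^ i) * G)"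
      by (intro mult_left_mono mult_right_mono) (auto simp: G_def)
    also have "\<dots> = (\<Sum>i\<le>degree p. cmod (coeff p i) * (\<bar>x\<bar> ^ (m + i) * G))"
      by (simp add: sum_distrib_left sum_distrib_right power_add mult_ac)
    also have "\<dots> \<le> B" unfolding B_def G_def
      by (intro sum_mono mult_left_mono power_gauss_bound) auto
    finally show ?thesis by (simp only: norm_mult norm_scaleR * power_abs real_norm_def)
  qed
  then show ?thesis by (auto intro!: boundedI)
qed

text \<open>The parameter is complex because two kinds of test function are needed: an imaginary
  value gives modulated Gaussians for uniqueness, a real value gives multiples of translated
  Gaussians for inversion.\<close>

lemma schwartz_gauss: "schwartz (\<lambda>x. exp (- (of_real x)\<^sup>2 / 2 + a * of_real x))"
proof -
  \<comment> \<open>Since E' = (a - z) E, the product rule sends a prefactor p to p' + (a - z) p;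
    \<open>[:a, - 1:]\<close> is the polynomial a - z.\<close>
  define P where "P = rec_nat (1 :: complex poly) (\<lambda>_ p. pderiv p + [:a, - 1:] * p)"
  define E where "E = (\<lambda>z :: complex. exp (- z\<^sup>2 / 2 + a * z))"
  define D where "D = (\<lambda>k (x::real). poly (P k) (of_real x) * E (of_real x))"
  have P0: "P 0 = 1" and PS: "P (Suc k) = pderiv (P k) + [:a, - 1:] * P k" for k
    by (auto simp: P_def)
  have "((\<lambda>z. poly (P k) z * E z) has_field_derivative poly (P (Suc k)) z * E z) (at z)" for k z
    unfolding E_def PS
    by (rule derivative_eq_intros refl | simp)+ (simp add: algebra_simps)
  then have "(D k has_vector_derivative D (Suc k) x) (at x)" for k x
    unfolding D_def by (rule has_vector_derivative_real_field)
  moreover have "bounded (range (\<lambda>x. x ^ m *\<^sub>R D k x))" for k m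
    unfolding D_def E_def by (rule bounded_poly_gauss)
  moreover have "D 0 = (\<lambda>x. exp (- (of_real x)\<^sup>2 / 2 + a * of_real x))"
    by (auto simp: D_def P0 E_def)
  ultimately show ?thesis unfolding schwartz_def by blast
qed

section \<open>Injectivity of the Fourier transform on L^1\<close>

text \<open>Levy's uniqueness theorem for characteristic functions does the work. The positive and
  negative parts of \<open>r\<close> have the same transform, so at t = 0 the same mass
  \<open>c\<close>; divided by \<open>c\<close> they become densities of probability distributions
  with equal characteristic functions. Mass 0 cannot be normalised, but then both parts
  vanish.\<close>

lemma fourier_injective_real:
  fixes r :: "real \<Rightarrow> real"
  assumes r: "integrable lborel r"
    and 0: "\<And>t. (LINT x|lborel. cis (t * x) * complex_of_real (r x)) = 0"
  shows "AE x in lborel. r x = 0"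
proof -
  define p where "p = (\<lambda>x. max (r x) 0)"
  define q where "q = (\<lambda>x. max (- r x) 0)"
  have [measurable]: "r \<in> borel_measurable lborel" using r by auto
  have mp[measurable]: "p \<in> borel_measurable lborel" and mq[measurable]: "q \<in> borel_measurable lborel"
    by (auto simp: p_def q_def)
  have p: "integrable lborel p" and q: "integrable lborel q"
    using r by (auto simp: p_def q_def)
  have nn: "p x \<ge> 0" "q x \<ge> 0" and rpq: "r x = p x - q x" and pq: "p x = q x \<Longrightarrow> r x = 0" for x
    by (auto simp: p_def q_def max_def split: if_splits)
  have cp: "integrable lborel (\<lambda>x. p x *\<^sub>R cis (t * x))" for t
    by (rule Bochner_Integration.integrable_bound[OF p]) (auto simp: cis_conv_exp)
  have cq: "integrable lborel (\<lambda>x. q x *\<^sub>R cis (t * x))" for t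
    by (rule Bochner_Integration.integrable_bound[OF q]) (auto simp: cis_conv_exp)
  have eq: "(LINT x|lborel. p x *\<^sub>R cis (t * x)) = (LINT x|lborel. q x *\<^sub>R cis (t * x))" for t
  proof -
    have "(LINT x|lborel. p x *\<^sub>R cis (t * x)) - (LINT x|lborel. q x *\<^sub>R cis (t * x))
        = (LINT x|lborel. p x *\<^sub>R cis (t * x) - q x *\<^sub>R cis (t * x))"
      by (rule Bochner_Integration.integral_diff[symmetric, OF cp cq])
    also have "\<dots> = (LINT x|lborel. cis (t * x) * complex_of_real (r x))"
      by (rule Bochner_Integration.integral_cong) (auto simp: rpq scaleR_conv_of_real algebra_simps)
    finally show ?thesis using 0 by simp
  qed
  define c where "c = (LINT x|lborel. p x)"
  have "complex_of_real (LINT x|lborel. p x) = complex_of_real (LINT x|lborel. q x)"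
    using eq[of 0] by (simp add: scaleR_conv_of_real del: of_real_eq_iff)
  then have cq': "c = (LINT x|lborel. q x)" unfolding c_def by (simp only: of_real_eq_iff)
  have c0: "c \<ge> 0" unfolding c_def using nn by simp
  show ?thesis
  proof (cases "c = 0")
    case True
    have "AE x in lborel. p x = 0" "AE x in lborel. q x = 0"
      using True cq' c_def integral_nonneg_eq_0_iff_AE[OF p] integral_nonneg_eq_0_iff_AE[OF q] nn
      by auto
    then show ?thesis by eventually_elim (simp add: rpq)
  next
    case False
    with c0 have c: "c > 0" by simp
    have rd: "real_distribution (density lborel (\<lambda>x. ennreal (f x / c)))"
      if [measurable]: "f \<in> borel_measurable lborel" and f: "integrable lborel f" and nf: "\<And>x. f x \<ge> 0"
        and fc: "c = (LINT x|lborel. f x)" for f :: "real \<Rightarrow> real"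
    proof -
      have "emeasure (density lborel (\<lambda>x. ennreal (f x / c))) (space (density lborel (\<lambda>x. ennreal (f x / c)))) = (\<integral>\<^sup>+x. ennreal (f x / c) \<partial>lborel)"
        by (simp add: emeasure_density)
      also have "\<dots> = ennreal (LINT x|lborel. f x / c)"
        using f nf c by (intro nn_integral_eq_integral) auto
      also have "\<dots> = 1" using c fc by simp
      finally interpret prob_space "density lborel (\<lambda>x. ennreal (f x / c))" by (rule prob_spaceI)
      show ?thesis by unfold_locales auto
    qed
    have ch: "char (density lborel (\<lambda>x. ennreal (f x / c))) t = (LINT x|lborel. f x *\<^sub>R cis (t * x)) / c"
      if [measurable]: "f \<in> borel_measurable lborel" and nf: "\<And>x. f x \<ge> 0" for f :: "real \<Rightarrow> real" and t
    proof -
      have "char (density lborel (\<lambda>x. ennreal (f x / c))) t = (LINT x|lborel. (f x / c) *\<^sub>R cis (t * x))"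
        unfolding char_def cis_conv_exp using nf c by (subst integral_density) auto
      also have "\<dots> = (LINT x|lborel. (f x *\<^sub>R cis (t * x)) / c)"
        by (rule Bochner_Integration.integral_cong) (auto simp: scaleR_conv_of_real)
      finally show ?thesis by simp
    qed
    have "density lborel (\<lambda>x. ennreal (p x / c)) = density lborel (\<lambda>x. ennreal (q x / c))"
    proof (rule Levy_uniqueness[OF rd rd])
      show "char (density lborel (\<lambda>x. ennreal (p x / c))) = char (density lborel (\<lambda>x. ennreal (q x / c)))"
        using ch[OF mp nn(1)] ch[OF mq nn(2)] eq by auto
    qed (use p q nn c_def cq' in auto)
    then have "AE x in lborel. ennreal (p x / c) = ennreal (q x / c)"
      by (subst (asm) sigma_finite_measure.density_unique_iff[OF lborel.sigma_finite_measure_axioms]) auto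
    then show ?thesis
    proof eventually_elim
      case (elim x)
      then have "p x / c = q x / c" using nn c by (subst (asm) ennreal_inj) auto
      with c show ?case by (intro pq) simp
    qed
  qed
qed

text \<open>Conjugating the hypothesis at -t shows that the transform of the conjugate of
  \<open>h\<close> vanishes too; real and imaginary part are combinations of \<open>h\<close> and
  its conjugate, and the real case applies to each.\<close>

lemma fourier_injective:
  fixes h :: "real \<Rightarrow> complex"
  assumes h: "integrable lborel h"
    and 0: "\<And>t. (LINT x|lborel. cis (t * x) * h x) = 0"
  shows "AE x in lborel. h x = 0"
proof -
  have i: "integrable lborel (\<lambda>x. cis (t * x) * h x)" for t
    by (rule Bochner_Integration.integrable_bound[OF h]) (use h in \<open>auto simp: cis_conv_exp norm_mult\<close>)
  have i': "integrable lborel (\<lambda>x. cis (t * x) * cnj (h x))" for t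
    using integrable_cnj[OF i[of "- t"]] by (simp add: cis_cnj)
  have c: "(LINT x|lborel. cis (t * x) * cnj (h x)) = 0" for t
  proof -
    have "(LINT x|lborel. cis (t * x) * cnj (h x)) = (LINT x|lborel. cnj (cis (- t * x) * h x))"
      by (rule Bochner_Integration.integral_cong) (auto simp: cis_cnj)
    also have "\<dots> = 0" using 0[of "- t"] by (simp del: complex_cnj_mult)
    finally show ?thesis .
  qed
  have "AE x in lborel. Re (h x) = 0"
  proof (rule fourier_injective_real)
    fix t
    have "(LINT x|lborel. cis (t * x) * complex_of_real (Re (h x)))
       = (LINT x|lborel. (cis (t * x) * h x + cis (t * x) * cnj (h x)) / 2)"
      by (rule Bochner_Integration.integral_cong) (auto simp: complex_eq_iff algebra_simps)
    then show "(LINT x|lborel. cis (t * x) * complex_of_real (Re (h x))) = 0"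
      using 0 c i i' by simp
  qed (use h in auto)
  moreover have "AE x in lborel. Im (h x) = 0"
  proof (rule fourier_injective_real)
    fix t
    have "(LINT x|lborel. cis (t * x) * complex_of_real (Im (h x)))
       = (LINT x|lborel. (cis (t * x) * h x - cis (t * x) * cnj (h x)) / (2 * \<i>))"
      by (rule Bochner_Integration.integral_cong) (auto simp: complex_eq_iff algebra_simps Re_divide Im_divide)
    then show "(LINT x|lborel. cis (t * x) * complex_of_real (Im (h x))) = 0"
      using 0 c i i' by simp
  qed (use h in auto)
  ultimately show ?thesis by eventually_elim (simp add: complex_eq_iff)
qed

section \<open>Integrable weights, Schwartz functions and their Fourier integrals\<close>

lemma integrable_inverse_1_plus_sq: "integrable lborel (\<lambda>x::real. 1 / (1 + x\<^sup>2))"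
  using integrable_inverse_1_plus_square by (simp add: set_integrable_def inverse_eq_divide)

text \<open>This is where the embedding thresholds come from: with \<sigma> = s it yields s > 1/2
  for continuity, with \<sigma> = s - 1 it yields s > 3/2 for one derivative. Away from [-1, 1] the
  integrand is compared with the power |x|^(-2 \<sigma>).\<close>

lemma integrable_japanese_bracket:
  fixes \<sigma> :: real
  assumes "\<sigma> > 1 / 2"
  shows "integrable lborel (\<lambda>x::real. (1 + x\<^sup>2) powr (- \<sigma>))"
proof -
  define g where "g = (\<lambda>x::real. indicator {1..} x * x powr (- 2 * \<sigma>))"
  have "(\<lambda>x::real. x powr (- 2 * \<sigma>)) absolutely_integrable_on {1..}"
    by (rule nonnegative_absolutely_integrable_1)
       (use has_integral_powr_to_inf[of "- 2 * \<sigma>" 1] assms in \<open>auto simp: integrable_on_def\<close>)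
  then have g: "integrable lborel g"
    unfolding g_def set_integrable_def by (subst (asm) integrable_completion) auto
  have g': "integrable lborel (\<lambda>x. g (- x))"
    using lborel_integrable_real_affine[OF g, of "-1" 0] by simp
  have i: "integrable lborel (\<lambda>x::real. indicat_real {- 1..1} x)" by simp
  have "integrable lborel (\<lambda>x. indicat_real {- 1..1} x + g x + g (- x))" using i g g' by auto
  then show ?thesis
  proof (rule Bochner_Integration.integrable_bound)
    show "AE x in lborel. norm ((1 + x\<^sup>2) powr - \<sigma>) \<le> norm (indicat_real {- 1..1} x + g x + g (- x))"
    proof (intro AE_I2)
      fix x :: real
      have pos: "indicat_real {- 1..1} x + g x + g (- x) \<ge> 0" by (auto simp: g_def)
      have "(1 + x\<^sup>2) powr - \<sigma> \<le> indicat_real {- 1..1} x + g x + g (- x)"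
      proof (cases "\<bar>x\<bar> \<le> 1")
        case True
        have "(1 + x\<^sup>2) powr - \<sigma> \<le> 1 powr - \<sigma>" using assms by (intro powr_mono2') auto
        then have "(1 + x\<^sup>2) powr - \<sigma> \<le> 1" by simp
        moreover have "indicat_real {- 1..1} x = 1" using True by (auto simp: abs_le_iff)
        moreover have "g x \<ge> 0" "g (- x) \<ge> 0" by (auto simp: g_def)
        ultimately show ?thesis by linarith
      next
        case False
        have x2: "\<bar>x\<bar> powr 2 = x\<^sup>2" using False by (subst powr_numeral) auto
        have "(1 + x\<^sup>2) powr - \<sigma> \<le> (\<bar>x\<bar> powr 2) powr - \<sigma>"
          unfolding x2 using assms False by (intro powr_mono2') auto
        also have "\<dots> = \<bar>x\<bar> powr (- 2 * \<sigma>)" by (simp add: powr_powr del: powr_numeral)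
        also have "\<dots> \<le> indicat_real {- 1..1} x + g x + g (- x)"
          using False by (cases "x \<ge> 0") (auto simp: g_def indicator_def)
        finally show ?thesis .
      qed
      then show "norm ((1 + x\<^sup>2) powr - \<sigma>) \<le> norm (indicat_real {- 1..1} x + g x + g (- x))"
        using pos by simp
    qed
  qed auto
qed

lemma measurable_cis[measurable]: "cis \<in> borel_measurable borel"
  by (intro borel_measurable_continuous_onI continuous_intros)

lemma schwartz_bounded:
  assumes "schwartz \<phi>"
  obtains C where "C \<ge> 0" "\<And>x. \<bar>x\<bar> ^ m * cmod (\<phi> x) \<le> C"
proof -
  obtain D where D: "D 0 = \<phi> \<and> (\<forall>k x. (D k has_vector_derivative D (Suc k) x) (at x)) \<and>
      (\<forall>k m. bounded (range (\<lambda>x. x ^ m *\<^sub>R D k x)))"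
    using assms unfolding schwartz_def by (rule exE)
  then have "bounded (range (\<lambda>x. x ^ m *\<^sub>R \<phi> x))" by blast
  then obtain B where B: "\<And>x. cmod (x ^ m *\<^sub>R \<phi> x) \<le> B"
    unfolding bounded_iff by blast
  have "\<bar>x\<bar> ^ m * cmod (\<phi> x) \<le> B" for x
    using B[of x] by (simp add: power_abs)
  moreover have "B \<ge> 0" using B[of 0] norm_ge_zero order_trans by blast
  ultimately show thesis using that by blast
qed

lemma schwartz_deriv:
  assumes "schwartz \<phi>"
  obtains \<psi> where "schwartz \<psi>" "\<And>x. (\<phi> has_vector_derivative \<psi> x) (at x)"
proof -
  obtain D where D: "D 0 = \<phi> \<and> (\<forall>k x. (D k has_vector_derivative D (Suc k) x) (at x)) \<and>
      (\<forall>k m. bounded (range (\<lambda>x. x ^ m *\<^sub>R D k x)))"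
    using assms unfolding schwartz_def by (rule exE)
  have "schwartz (D 1)"
    unfolding schwartz_def by (rule exI[of _ "\<lambda>k. D (Suc k)"]) (use D in simp)
  moreover have "(\<phi> has_vector_derivative D 1 x) (at x)" for x
    using D by (metis One_nat_def)
  ultimately show thesis by (rule that)
qed

lemma schwartz_continuous:
  assumes "schwartz \<phi>"
  shows "continuous_on UNIV \<phi>"
proof -
  obtain \<psi> where "\<And>x. (\<phi> has_vector_derivative \<psi> x) (at x)" using schwartz_deriv[OF assms] by blast
  then show ?thesis by (intro continuous_at_imp_continuous_on ballI has_vector_derivative_continuous)
qed

lemma schwartz_measurable:
  assumes "schwartz \<phi>"
  shows "\<phi> \<in> borel_measurable lborel"
  using borel_measurable_continuous_onI[OF schwartz_continuous[OF assms]] by simp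

lemma schwartz_integrable:
  assumes "schwartz \<phi>"
  shows "integrable lborel \<phi>"
proof -
  obtain A where A: "A \<ge> 0" "\<And>x. \<bar>x\<bar> ^ 0 * cmod (\<phi> x) \<le> A" using schwartz_bounded[OF assms, where m=0] by blast
  obtain B where B: "B \<ge> 0" "\<And>x. \<bar>x\<bar> ^ 2 * cmod (\<phi> x) \<le> B" using schwartz_bounded[OF assms, where m=2] by blast
  have "integrable lborel (\<lambda>x::real. (A + B) * (1 / (1 + x\<^sup>2)))"
    using integrable_inverse_1_plus_sq by (intro Bochner_Integration.integrable_mult_right) auto
  then show ?thesis
  proof (rule Bochner_Integration.integrable_bound)
    show "AE x in lborel. norm (\<phi> x) \<le> norm ((A + B) * (1 / (1 + x\<^sup>2)))"
    proof (intro AE_I2)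
      fix x :: real
      have p: "1 + x\<^sup>2 > 0" by (simp add: add_pos_nonneg)
      have "cmod (\<phi> x) * (1 + x\<^sup>2) \<le> A + B" using A(2)[of x] B(2)[of x] by (simp add: algebra_simps)
      then have "cmod (\<phi> x) \<le> (A + B) / (1 + x\<^sup>2)" using p by (simp add: field_simps)
      then show "norm (\<phi> x) \<le> norm ((A + B) * (1 / (1 + x\<^sup>2)))" using A B p by simp
    qed
  qed (use schwartz_measurable[OF assms] in auto)
qed

lemma schwartz_L2:
  assumes "schwartz \<phi>"
  shows "L2_fun \<phi>"
proof -
  obtain A where A: "A \<ge> 0" "\<And>x. \<bar>x\<bar> ^ 0 * cmod (\<phi> x) \<le> A" using schwartz_bounded[OF assms, where m=0] by blast
  have [measurable]: "\<phi> \<in> borel_measurable lborel" by (rule schwartz_measurable[OF assms])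
  have "integrable lborel (\<lambda>x. A * cmod (\<phi> x))"
    using schwartz_integrable[OF assms] by auto
  then have "integrable lborel (\<lambda>x. (norm (\<phi> x))\<^sup>2)"
    by (rule Bochner_Integration.integrable_bound)
       (use A in \<open>auto simp: power2_eq_square abs_mult intro!: mult_right_mono\<close>)
  then show ?thesis by (simp add: L2_fun_def)
qed

lemma schwartz_tendsto_0:
  assumes "schwartz \<phi>"
  shows "(\<phi> \<longlongrightarrow> 0) at_infinity"
proof -
  obtain B where B: "B \<ge> 0" "\<And>x. \<bar>x\<bar> ^ 1 * cmod (\<phi> x) \<le> B" using schwartz_bounded[OF assms, where m=1] by blast
  have "((\<lambda>x::real. B * inverse (norm x)) \<longlongrightarrow> B * 0) at_infinity"
    by (intro tendsto_intros tendsto_inverse_0_at_top filterlim_norm_at_top)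
  then have l: "((\<lambda>x::real. B * inverse (norm x)) \<longlongrightarrow> 0) at_infinity" by simp
  have "\<forall>\<^sub>F x::real in at_infinity. norm x > 0"
    unfolding eventually_at_infinity by (rule exI[of _ 1]) auto
  then have "\<forall>\<^sub>F x in at_infinity. norm (\<phi> x) \<le> B * inverse (norm x)"
    by eventually_elim (use B(2) in \<open>simp add: field_simps\<close>)
  then show ?thesis using l by (rule Lim_null_comparison)
qed

text \<open>Integration by parts, phrased as the fundamental theorem of calculus on the whole line:
  \<open>f\<close> is the derivative of the product of character and \<phi>, and the boundary values
  vanish because \<phi> decays.\<close>

lemma fourier_integral_deriv:
  assumes "schwartz \<phi>" "schwartz \<psi>" and d: "\<And>x. (\<phi> has_vector_derivative \<psi> x) (at x)"
  shows "fourier_integral \<psi> x = \<i> * of_real x * fourier_integral \<phi> x"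
proof -
  define f where "f = (\<lambda>\<xi>. cis (- (\<xi> * x)) * \<psi> \<xi> - \<i> * of_real x * (cis (- (\<xi> * x)) * \<phi> \<xi>))"
  have [measurable]: "\<phi> \<in> borel_measurable lborel" "\<psi> \<in> borel_measurable lborel"
    using assms schwartz_measurable by auto
  have i1: "integrable lborel (\<lambda>\<xi>. cis (- (\<xi> * x)) * \<psi> \<xi>)"
    by (rule Bochner_Integration.integrable_bound[OF schwartz_integrable[OF assms(2)]]) (auto simp: norm_mult)
  have i2: "integrable lborel (\<lambda>\<xi>. cis (- (\<xi> * x)) * \<phi> \<xi>)"
    by (rule Bochner_Integration.integrable_bound[OF schwartz_integrable[OF assms(1)]]) (auto simp: norm_mult)
  have "(LBINT \<xi>=-\<infinity>..\<infinity>. f \<xi>) = 0 - 0"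
  proof (rule interval_integral_FTC_integrable[where F="\<lambda>\<xi>. cis (- (\<xi> * x)) * \<phi> \<xi>"])
    fix \<xi> :: real
    have "((\<lambda>\<xi>. cis (- (\<xi> * x))) has_vector_derivative (- x) *\<^sub>R (\<i> * cis (- (\<xi> * x)))) (at \<xi>)"
      unfolding cis_conv_exp
      by (rule derivative_eq_intros has_vector_derivative_real_field | simp)+ (auto simp: scaleR_conv_of_real)
    from has_vector_derivative_mult[OF this d]
    show "((\<lambda>\<xi>. cis (- (\<xi> * x)) * \<phi> \<xi>) has_vector_derivative f \<xi>) (at \<xi>)"
      unfolding f_def by (rule has_vector_derivative_eq_rhs) (auto simp: scaleR_conv_of_real)
    have "isCont (\<lambda>\<xi>. cis (- (\<xi> * x))) \<xi>"
      unfolding cis_conv_exp by (intro continuous_intros)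
    then show "isCont f \<xi>" unfolding f_def
      using schwartz_continuous[OF assms(1)] schwartz_continuous[OF assms(2)]
      by (intro continuous_intros) (auto simp: continuous_on_eq_continuous_at)
  next
    show "set_integrable lborel (einterval (- \<infinity>) \<infinity>) f"
      using i1 i2 by (simp add: set_integrable_def f_def)
    have t: "((\<lambda>\<xi>. cis (- (\<xi> * x)) * \<phi> \<xi>) \<longlongrightarrow> 0) at_infinity"
      using schwartz_tendsto_0[OF assms(1)] by (subst tendsto_norm_zero_iff[symmetric]) (simp add: norm_mult tendsto_norm_zero)
    then show "(((\<lambda>\<xi>. cis (- (\<xi> * x)) * \<phi> \<xi>) \<circ> real_of_ereal) \<longlongrightarrow> 0) (at_right (- \<infinity>))"
      "(((\<lambda>\<xi>. cis (- (\<xi> * x)) * \<phi> \<xi>) \<circ> real_of_ereal) \<longlongrightarrow> 0) (at_left \<infinity>)"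
      unfolding ereal_tendsto_simps using tendsto_mono[OF at_bot_le_at_infinity t] tendsto_mono[OF at_top_le_at_infinity t] by auto
  qed auto
  then have "(LINT \<xi>|lborel. f \<xi>) = 0"
    by (simp add: interval_lebesgue_integral_def set_lebesgue_integral_def)
  moreover have "(LINT \<xi>|lborel. f \<xi>) = fourier_integral \<psi> x - \<i> * of_real x * fourier_integral \<phi> x"
    unfolding f_def fourier_integral_def using i1 i2 by simp
  ultimately show ?thesis by simp
qed

lemma fourier_integral_le:
  assumes "schwartz \<phi>"
  shows "cmod (fourier_integral \<phi> x) \<le> (LINT \<xi>|lborel. cmod (\<phi> \<xi>))"
  unfolding fourier_integral_def
  by (rule order_trans[OF integral_norm_bound]) (simp add: norm_mult)

text \<open>Both the transform and x times the transform are bounded, the latter as the transform of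
  a derivative, so the square is dominated by a multiple of 1/(1 + x^2). This makes the right-hand
  integrand in \<open>has_fourier_transform\<close> a product of two L^2 functions, so that the
  duality formula can be added and scaled.\<close>

lemma fourier_integral_L2:
  assumes "schwartz \<phi>"
  shows "L2_fun (fourier_integral \<phi>)"
proof -
  obtain \<psi> where \<psi>: "schwartz \<psi>" "\<And>x. (\<phi> has_vector_derivative \<psi> x) (at x)"
    using schwartz_deriv[OF assms] by blast
  have [measurable]: "\<phi> \<in> borel_measurable borel" using schwartz_measurable[OF assms] by simp
  have m[measurable]: "fourier_integral \<phi> \<in> borel_measurable lborel"
    unfolding fourier_integral_def[abs_def] by measurable
  define A where "A = (LINT \<xi>|lborel. cmod (\<phi> \<xi>))"
  define B where "B = (LINT \<xi>|lborel. cmod (\<psi> \<xi>))"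
  have A: "cmod (fourier_integral \<phi> x) \<le> A" for x unfolding A_def by (rule fourier_integral_le[OF assms])
  have B: "\<bar>x\<bar> * cmod (fourier_integral \<phi> x) \<le> B" for x
    using fourier_integral_le[OF \<psi>(1), of x] fourier_integral_deriv[OF assms \<psi>, of x]
    by (simp add: B_def norm_mult)
  have "integrable lborel (\<lambda>x::real. (A\<^sup>2 + B\<^sup>2) * (1 / (1 + x\<^sup>2)))"
    using integrable_inverse_1_plus_sq by (intro Bochner_Integration.integrable_mult_right) auto
  then have "integrable lborel (\<lambda>x. (norm (fourier_integral \<phi> x))\<^sup>2)"
  proof (rule Bochner_Integration.integrable_bound)
    show "AE x in lborel. norm ((norm (fourier_integral \<phi> x))\<^sup>2) \<le> norm ((A\<^sup>2 + B\<^sup>2) * (1 / (1 + x\<^sup>2)))"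
    proof (intro AE_I2)
      fix x :: real
      have p: "1 + x\<^sup>2 > 0" by (simp add: add_pos_nonneg)
      have "(\<bar>x\<bar> * cmod (fourier_integral \<phi> x))\<^sup>2 \<le> B\<^sup>2" "(cmod (fourier_integral \<phi> x))\<^sup>2 \<le> A\<^sup>2"
        using A B by (intro power_mono; simp)+
      then have "(cmod (fourier_integral \<phi> x))\<^sup>2 * (1 + x\<^sup>2) \<le> A\<^sup>2 + B\<^sup>2"
        by (simp add: algebra_simps power_mult_distrib)
      then have "(cmod (fourier_integral \<phi> x))\<^sup>2 \<le> (A\<^sup>2 + B\<^sup>2) / (1 + x\<^sup>2)" using p by (simp add: field_simps)
      then show "norm ((norm (fourier_integral \<phi> x))\<^sup>2) \<le> norm ((A\<^sup>2 + B\<^sup>2) * (1 / (1 + x\<^sup>2)))"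
        using p by simp
    qed
  qed auto
  then show ?thesis using m by (simp add: L2_fun_def)
qed

section \<open>L^2 pairings, linearity and uniqueness of the transform\<close>

lemma L2_fun_mult_integrable:
  fixes f g :: "real \<Rightarrow> complex"
  assumes "L2_fun f" "L2_fun g"
  shows "integrable lborel (\<lambda>x. f x * g x)"
proof -
  have [measurable]: "f \<in> borel_measurable lborel" "g \<in> borel_measurable lborel"
    using assms by (auto simp: L2_fun_def)
  have "integrable lborel (\<lambda>x. (norm (f x))\<^sup>2 + (norm (g x))\<^sup>2)"
    using assms by (auto simp: L2_fun_def)
  then show ?thesis
  proof (rule Bochner_Integration.integrable_bound)
    have "a * b \<le> a\<^sup>2 + b\<^sup>2" if "a \<ge> 0" "b \<ge> 0" for a b :: real
      using sum_squares_bound[of a b] mult_nonneg_nonneg[OF that] by linarith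
    then show "AE x in lborel. norm (f x * g x) \<le> norm ((norm (f x))\<^sup>2 + (norm (g x))\<^sup>2)"
      by (auto simp: norm_mult)
  qed auto
qed

lemma L2_fun_of_real: "L2_fun f \<Longrightarrow> L2_fun (\<lambda>x. complex_of_real (f x))"
  by (auto simp: L2_fun_def)

lemma norm_linear_combination_sq_le:
  fixes x y :: "'a::real_normed_vector"
  shows "(norm (a *\<^sub>R x + b *\<^sub>R y))\<^sup>2 \<le> 2 * a\<^sup>2 * (norm x)\<^sup>2 + 2 * b\<^sup>2 * (norm y)\<^sup>2"
proof -
  have "(norm (a *\<^sub>R x + b *\<^sub>R y))\<^sup>2 \<le> (\<bar>a\<bar> * norm x + \<bar>b\<bar> * norm y)\<^sup>2"
    by (intro power_mono order_trans[OF norm_triangle_ineq]) auto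
  also have "\<dots> \<le> 2 * (\<bar>a\<bar> * norm x)\<^sup>2 + 2 * (\<bar>b\<bar> * norm y)\<^sup>2"
    using sum_squares_bound[of "\<bar>a\<bar> * norm x" "\<bar>b\<bar> * norm y"] by (simp add: power2_sum)
  finally show ?thesis by (simp add: power_mult_distrib)
qed

lemma L2_fun_linear:
  fixes f g :: "real \<Rightarrow> 'a::{banach,second_countable_topology}"
  assumes "L2_fun f" "L2_fun g"
  shows "L2_fun (\<lambda>x. a *\<^sub>R f x + b *\<^sub>R g x)"
proof -
  have [measurable]: "f \<in> borel_measurable lborel" "g \<in> borel_measurable lborel"
    using assms by (auto simp: L2_fun_def)
  have "integrable lborel (\<lambda>x. 2 * a\<^sup>2 * (norm (f x))\<^sup>2 + 2 * b\<^sup>2 * (norm (g x))\<^sup>2)"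
    using assms by (auto simp: L2_fun_def)
  then have "integrable lborel (\<lambda>x. (norm (a *\<^sub>R f x + b *\<^sub>R g x))\<^sup>2)"
    by (rule Bochner_Integration.integrable_bound) (use norm_linear_combination_sq_le[of a _ b] in auto)
  then show ?thesis by (simp add: L2_fun_def)
qed

lemma has_fourier_transform_linear:
  assumes "has_fourier_transform f F" "has_fourier_transform g G"
  shows "has_fourier_transform (\<lambda>x. a * f x + b * g x) (\<lambda>\<xi>. a *\<^sub>R F \<xi> + b *\<^sub>R G \<xi>)"
  unfolding has_fourier_transform_def
proof (intro conjI allI impI)
  show "L2_fun (\<lambda>x. a * f x + b * g x)"
    using L2_fun_linear[of f g a b] assms by (simp add: has_fourier_transform_def)
  show "L2_fun (\<lambda>\<xi>. a *\<^sub>R F \<xi> + b *\<^sub>R G \<xi>)"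
    using assms by (intro L2_fun_linear) (auto simp: has_fourier_transform_def)
  fix \<phi> assume \<phi>: "schwartz \<phi>"
  have i: "integrable lborel (\<lambda>\<xi>. F \<xi> * \<phi> \<xi>)" "integrable lborel (\<lambda>\<xi>. G \<xi> * \<phi> \<xi>)"
    "integrable lborel (\<lambda>\<xi>. of_real (f \<xi>) * fourier_integral \<phi> \<xi>)"
    "integrable lborel (\<lambda>\<xi>. of_real (g \<xi>) * fourier_integral \<phi> \<xi>)"
    using assms \<phi> by (auto intro!: L2_fun_mult_integrable schwartz_L2 fourier_integral_L2 L2_fun_of_real
        simp: has_fourier_transform_def)
  have "(LINT \<xi>|lborel. (a *\<^sub>R F \<xi> + b *\<^sub>R G \<xi>) * \<phi> \<xi>)
     = (LINT \<xi>|lborel. a *\<^sub>R (F \<xi> * \<phi> \<xi>) + b *\<^sub>R (G \<xi> * \<phi> \<xi>))"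
    by (rule Bochner_Integration.integral_cong) (auto simp: algebra_simps)
  also have "\<dots> = a *\<^sub>R (LINT x|lborel. of_real (f x) * fourier_integral \<phi> x)
      + b *\<^sub>R (LINT x|lborel. of_real (g x) * fourier_integral \<phi> x)"
    using i assms \<phi> by (simp add: has_fourier_transform_def)
  also have "\<dots> = (LINT x|lborel. a *\<^sub>R (of_real (f x) * fourier_integral \<phi> x) + b *\<^sub>R (of_real (g x) * fourier_integral \<phi> x))"
    using i by simp
  also have "\<dots> = (LINT x|lborel. complex_of_real (a * f x + b * g x) * fourier_integral \<phi> x)"
    by (rule Bochner_Integration.integral_cong) (auto simp: algebra_simps scaleR_conv_of_real)
  finally show "(LINT \<xi>|lborel. (a *\<^sub>R F \<xi> + b *\<^sub>R G \<xi>) * \<phi> \<xi>)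
      = (LINT x|lborel. complex_of_real (a * f x + b * g x) * fourier_integral \<phi> x)" .
qed

text \<open>Testing against \<open>e\<^sup>i\<^sup>t\<^sup>\<xi> e\<^sup>-\<^sup>\<xi>\<^sup>\<xi>\<^sup>/\<^sup>2\<close> makes the Fourier transform of \<open>(F - G) e\<^sup>-\<^sup>\<xi>\<^sup>\<xi>\<^sup>/\<^sup>2 \<in> L\<^sup>1\<close>
  vanish.\<close>

lemma has_fourier_transform_unique:
  assumes "has_fourier_transform f F" "has_fourier_transform f G"
  shows "AE \<xi> in lborel. F \<xi> = G \<xi>"
proof -
  define E where "E = (\<lambda>x::real. exp (- (complex_of_real x)\<^sup>2 / 2))"
  have E: "schwartz (\<lambda>x. cis (t * x) * E x)" for t
  proof -
    have "(\<lambda>x. cis (t * x) * E x) = (\<lambda>x. exp (- (of_real x)\<^sup>2 / 2 + (\<i> * of_real t) * of_real x))"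
      unfolding E_def cis_conv_exp exp_add by (simp add: fun_eq_iff mult_ac)
    then show ?thesis using schwartz_gauss by simp
  qed
  have L: "L2_fun F" "L2_fun G" using assms by (auto simp: has_fourier_transform_def)
  have L2: "L2_fun (\<lambda>\<xi>. F \<xi> - G \<xi>)" using L2_fun_linear[OF L, of 1 "- 1"] by simp
  have LE: "L2_fun E" using schwartz_L2[OF E[of 0]] by simp
  have "AE \<xi> in lborel. (F \<xi> - G \<xi>) * E \<xi> = 0"
  proof (rule fourier_injective)
    show "integrable lborel (\<lambda>\<xi>. (F \<xi> - G \<xi>) * E \<xi>)" by (rule L2_fun_mult_integrable[OF L2 LE])
    fix t
    have "(LINT x|lborel. cis (t * x) * ((F x - G x) * E x))
        = (LINT x|lborel. F x * (cis (t * x) * E x) - G x * (cis (t * x) * E x))"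
      by (rule Bochner_Integration.integral_cong) (auto simp: algebra_simps)
    also have "\<dots> = (LINT x|lborel. F x * (cis (t * x) * E x)) - (LINT x|lborel. G x * (cis (t * x) * E x))"
      by (rule Bochner_Integration.integral_diff) (intro L2_fun_mult_integrable L schwartz_L2 E)+
    also have "\<dots> = 0" using assms E[of t] by (simp add: has_fourier_transform_def)
    finally show "(LINT x|lborel. cis (t * x) * ((F x - G x) * E x)) = 0" .
  qed
  then show ?thesis by eventually_elim (simp add: E_def)
qed

section \<open>Fourier inversion for integrable transforms\<close>

lemma gauss_fourier: "(LINT x|lborel. cis (t * x) * of_real (exp (- x\<^sup>2 / 2))) = of_real (sqrt (2 * pi) * exp (- t\<^sup>2 / 2))"
proof -
  define I where "I = (LINT x|lborel. cis (t * x) * complex_of_real (exp (- x\<^sup>2 / 2)))"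
  have "of_real (exp (- t\<^sup>2 / 2)) = char std_normal_distribution t"
    by (simp add: char_std_normal_distribution)
  also have "\<dots> = (LINT x|lborel. std_normal_density x *\<^sub>R cis (t * x))"
    unfolding char_def cis_conv_exp by (subst integral_density) auto
  also have "\<dots> = (LINT x|lborel. of_real (1 / sqrt (2 * pi)) * (cis (t * x) * of_real (exp (- x\<^sup>2 / 2))))"
    by (rule Bochner_Integration.integral_cong)
       (auto simp: std_normal_density_def scaleR_conv_of_real)
  also have "\<dots> = of_real (1 / sqrt (2 * pi)) * I"
    unfolding I_def by (rule integral_mult_right_zero)
  finally have "I = of_real (sqrt (2 * pi)) * of_real (exp (- t\<^sup>2 / 2))"
    by simp
  then show ?thesis unfolding I_def by simp
qed

text \<open>The substitution \<xi> = \<eta> + z completes the square and turns the real shift \<eta>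
  into the phase \<open>cis (- (\<eta> * x))\<close>. Thus testing with shifted Gaussians on the
  frequency side computes an ordinary Fourier integral on the other side.\<close>

lemma fourier_integral_gauss:
  "fourier_integral (\<lambda>x. exp (- (of_real x)\<^sup>2 / 2 + of_real \<eta> * of_real x)) x
   = of_real (sqrt (2 * pi) * exp (\<eta>\<^sup>2 / 2)) * (cis (- (\<eta> * x)) * of_real (exp (- x\<^sup>2 / 2)))"
proof -
  have "fourier_integral (\<lambda>x. exp (- (of_real x)\<^sup>2 / 2 + of_real \<eta> * of_real x)) x
     = (LINT z|lborel. cis (- (x * (\<eta> + 1 * z))) * exp (- (of_real (\<eta> + 1 * z))\<^sup>2 / 2 + of_real \<eta> * of_real (\<eta> + 1 * z)))"
    unfolding fourier_integral_def
    using lborel_integral_real_affine[where c=1 and t=\<eta> and f="\<lambda>\<xi>. cis (- (x * \<xi>)) * exp (- (of_real \<xi>)\<^sup>2 / 2 + of_real \<eta> * of_real \<xi>)"]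
    by (simp add: mult.commute[of _ x])
  also have "\<dots> = (LINT z|lborel. (of_real (exp (\<eta>\<^sup>2 / 2)) * cis (- (\<eta> * x))) * (cis ((- x) * z) * of_real (exp (- z\<^sup>2 / 2))))"
  proof (rule Bochner_Integration.integral_cong)
    fix z :: real
    have "- (\<eta> + 1 * z)\<^sup>2 / 2 + \<eta> * (\<eta> + 1 * z) = \<eta>\<^sup>2 / 2 + - z\<^sup>2 / 2"
      by (simp add: power2_eq_square field_simps)
    then have "complex_of_real (- (\<eta> + 1 * z)\<^sup>2 / 2 + \<eta> * (\<eta> + 1 * z)) = of_real (\<eta>\<^sup>2 / 2 + - z\<^sup>2 / 2)"
      by (simp only:)
    then have "- (of_real (\<eta> + 1 * z))\<^sup>2 / 2 + of_real \<eta> * of_real (\<eta> + 1 * z) = complex_of_real (\<eta>\<^sup>2 / 2 + - z\<^sup>2 / 2)"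
      by simp
    then have "exp (- (of_real (\<eta> + 1 * z))\<^sup>2 / 2 + of_real \<eta> * of_real (\<eta> + 1 * z)) = complex_of_real (exp (\<eta>\<^sup>2 / 2) * exp (- z\<^sup>2 / 2))"
      by (simp only: exp_of_real exp_add)
    moreover have "cis (- (x * (\<eta> + 1 * z))) = cis (- (\<eta> * x)) * cis ((- x) * z)"
      by (simp add: cis_mult algebra_simps)
    ultimately show "cis (- (x * (\<eta> + 1 * z))) * exp (- (of_real (\<eta> + 1 * z))\<^sup>2 / 2 + of_real \<eta> * of_real (\<eta> + 1 * z)) =
       (of_real (exp (\<eta>\<^sup>2 / 2)) * cis (- (\<eta> * x))) * (cis ((- x) * z) * of_real (exp (- z\<^sup>2 / 2)))"
      by simp
  qed simp
  also have "\<dots> = (of_real (exp (\<eta>\<^sup>2 / 2)) * cis (- (\<eta> * x))) * of_real (sqrt (2 * pi) * exp (- (- x)\<^sup>2 / 2))"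
    using gauss_fourier[of "- x"] by simp
  finally show ?thesis by simp
qed

text \<open>The set where the functions differ is open and null, hence empty.\<close>

lemma AE_eq_continuous:
  fixes f g :: "real \<Rightarrow> 'a::t2_space"
  assumes "AE x in lborel. f x = g x" "continuous_on UNIV f" "continuous_on UNIV g"
  shows "f = g"
proof (rule ccontr)
  assume ne: "f \<noteq> g"
  define S where "S = {x. f x \<noteq> g x}"
  have o: "open S" unfolding S_def by (intro open_Collect_neq assms)
  have "S \<in> null_sets lborel"
    using assms(1) o by (subst (asm) AE_iff_null) (auto simp: S_def)
  then have "negligible S" unfolding negligible_iff_null_sets by (rule null_sets_completionI)
  then show False using open_not_negligible[OF o] ne by (auto simp: S_def)
qed

text \<open>No approximate identity is used. The functions f E and G E / (2 pi), with a Gaussian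
  factor \<open>E\<close> that makes them integrable, turn out to have the same Fourier integral at
  every frequency \<eta>, so they agree almost everywhere by injectivity on L^1; and
  \<open>E\<close> has no zero.\<close>

lemma fourier_inversion_AE:
  assumes ft: "has_fourier_transform f F" and F: "integrable lborel F"
  shows "AE x in lborel. complex_of_real (f x) = (LINT \<xi>|lborel. cis (x * \<xi>) * F \<xi>) / of_real (2 * pi)"
proof -
  define E where "E = (\<lambda>x::real. complex_of_real (exp (- x\<^sup>2 / 2)))"
  define G where "G = (\<lambda>x. (LINT \<xi>|lborel. cis (x * \<xi>) * F \<xi>))"
  have E: "schwartz E"
    using schwartz_gauss[of 0] by (simp add: E_def flip: exp_of_real)
  have [measurable]: "E \<in> borel_measurable borel" "F \<in> borel_measurable borel"
    using schwartz_measurable[OF E] F by auto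
  have mG[measurable]: "G \<in> borel_measurable lborel"
    unfolding G_def by measurable
  have G_le: "cmod (G x) \<le> (LINT \<xi>|lborel. cmod (F \<xi>))" for x
    unfolding G_def by (rule order_trans[OF integral_norm_bound]) (simp add: norm_mult)
  have L: "L2_fun f" using ft by (simp add: has_fourier_transform_def)
  have [measurable]: "f \<in> borel_measurable borel" using L by (simp add: L2_fun_def)
  have i1: "integrable lborel (\<lambda>x. of_real (f x) * E x)"
    by (rule L2_fun_mult_integrable[OF L2_fun_of_real[OF L] schwartz_L2[OF E]])
  have i1': "integrable lborel (\<lambda>x. of_real (f x) * (cis (- (\<eta> * x)) * E x))" for \<eta>
    by (rule Bochner_Integration.integrable_bound[OF i1]) (auto simp: norm_mult)
  have "integrable lborel (\<lambda>x. (LINT \<xi>|lborel. cmod (F \<xi>)) * norm (E x))"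
    using schwartz_integrable[OF E] by auto
  then have i2: "integrable lborel (\<lambda>x. G x * E x)"
    by (rule Bochner_Integration.integrable_bound)
       (use G_le in \<open>auto simp: norm_mult intro!: mult_right_mono order_trans[OF G_le abs_ge_self]\<close>)
  have i2': "integrable lborel (\<lambda>x. G x * (cis (- (\<eta> * x)) * E x))" for \<eta>
    by (rule Bochner_Integration.integrable_bound[OF i2]) (auto simp: norm_mult)
  \<comment> \<open>Fubini puts the x-integral inside, where it is the transform of a Gaussian at
    \<xi> - \<eta>.\<close>
  have Gint: "(LINT x|lborel. G x * (cis (- (\<eta> * x)) * E x)) =
      (LINT \<xi>|lborel. F \<xi> * of_real (sqrt (2 * pi) * exp (- (\<xi> - \<eta>)\<^sup>2 / 2)))" for \<eta>
  proof -
    define K where "K = (\<lambda>x \<xi>. F \<xi> * (cis (x * \<xi>) * (cis (- (\<eta> * x)) * E x)))"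
    have "integrable (lborel \<Otimes>\<^sub>M lborel) (\<lambda>(x, \<xi>). E x * F \<xi>)"
    proof (rule lborel_pair.Fubini_integrable)
      show "integrable lborel (\<lambda>x. LINT \<xi>|lborel. norm (case (x, \<xi>) of (x, \<xi>) \<Rightarrow> E x * F \<xi>))"
        using schwartz_integrable[OF E] by (simp add: norm_mult)
    qed (use F in auto)
    then have iK: "integrable (lborel \<Otimes>\<^sub>M lborel) (\<lambda>(x, \<xi>). K x \<xi>)"
      by (rule Bochner_Integration.integrable_bound) (auto simp: K_def norm_mult)
    have "(LINT x|lborel. G x * (cis (- (\<eta> * x)) * E x)) = (LINT x|lborel. (LINT \<xi>|lborel. K x \<xi>))"
    proof (rule Bochner_Integration.integral_cong)
      fix x
      have "(LINT \<xi>|lborel. K x \<xi>) = (LINT \<xi>|lborel. (cis (x * \<xi>) * F \<xi>) * (cis (- (\<eta> * x)) * E x))"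
        by (rule Bochner_Integration.integral_cong) (auto simp: K_def)
      also have "\<dots> = G x * (cis (- (\<eta> * x)) * E x)"
        unfolding G_def by (rule integral_mult_left_zero)
      finally show "G x * (cis (- (\<eta> * x)) * E x) = (LINT \<xi>|lborel. K x \<xi>)" by simp
    qed simp
    also have "\<dots> = (LINT \<xi>|lborel. (LINT x|lborel. K x \<xi>))"
      by (rule lborel_pair.Fubini_integral[OF iK, symmetric])
    also have "\<dots> = (LINT \<xi>|lborel. F \<xi> * of_real (sqrt (2 * pi) * exp (- (\<xi> - \<eta>)\<^sup>2 / 2)))"
    proof (rule Bochner_Integration.integral_cong)
      fix \<xi> :: real
      have "(LINT x|lborel. K x \<xi>) = F \<xi> * (LINT x|lborel. cis (x * \<xi>) * (cis (- (\<eta> * x)) * E x))"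
        unfolding K_def by (rule integral_mult_right_zero)
      also have "(LINT x|lborel. cis (x * \<xi>) * (cis (- (\<eta> * x)) * E x)) = (LINT x|lborel. cis ((\<xi> - \<eta>) * x) * of_real (exp (- x\<^sup>2 / 2)))"
        by (rule Bochner_Integration.integral_cong) (auto simp: E_def cis_mult mult.assoc[symmetric] algebra_simps)
      also note gauss_fourier
      finally show "(LINT x|lborel. K x \<xi>) = F \<xi> * of_real (sqrt (2 * pi) * exp (- (\<xi> - \<eta>)\<^sup>2 / 2))" .
    qed simp
    finally show ?thesis .
  qed
  \<comment> \<open>The duality is tested with exp(-\<xi>^2/2 + \<eta> \<xi>), which is
    exp(\<eta>^2/2) times the Gaussian centred at \<eta>. One factor \<open>sqrt (2 * pi)\<close>
    sits in \<open>c\<close>, the other on the right-hand side; their product is the 2 pi of the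
    inversion formula.\<close>
  have fint: "(LINT x|lborel. of_real (f x) * (cis (- (\<eta> * x)) * E x)) * of_real (2 * pi) =
      (LINT \<xi>|lborel. F \<xi> * of_real (sqrt (2 * pi) * exp (- (\<xi> - \<eta>)\<^sup>2 / 2)))" for \<eta>
  proof -
    define c where "c = sqrt (2 * pi) * exp (\<eta>\<^sup>2 / 2)"
    define I where "I = (LINT x|lborel. of_real (f x) * (cis (- (\<eta> * x)) * E x))"
    have c: "c \<noteq> 0" by (simp add: c_def)
    have "(LINT \<xi>|lborel. F \<xi> * exp (- (of_real \<xi>)\<^sup>2 / 2 + of_real \<eta> * of_real \<xi>)) =
       (LINT x|lborel. of_real (f x) * (of_real c * (cis (- (\<eta> * x)) * E x)))"
      using ft schwartz_gauss[of "of_real \<eta>"]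
      unfolding has_fourier_transform_def fourier_integral_gauss[symmetric] c_def E_def by blast
    also have "\<dots> = of_real c * I" unfolding I_def
      by (subst integral_mult_right_zero[symmetric]) (rule Bochner_Integration.integral_cong, auto)
    finally have 1: "(LINT \<xi>|lborel. F \<xi> * exp (- (of_real \<xi>)\<^sup>2 / 2 + of_real \<eta> * of_real \<xi>)) = of_real c * I" .
    have "(LINT \<xi>|lborel. F \<xi> * of_real (sqrt (2 * pi) * exp (- (\<xi> - \<eta>)\<^sup>2 / 2)))
       = (LINT \<xi>|lborel. of_real (sqrt (2 * pi) * exp (- \<eta>\<^sup>2 / 2)) * (F \<xi> * exp (- (of_real \<xi>)\<^sup>2 / 2 + of_real \<eta> * of_real \<xi>)))"
    proof (rule Bochner_Integration.integral_cong)
      fix \<xi> :: real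
      have "- (\<xi> - \<eta>)\<^sup>2 / 2 = - \<eta>\<^sup>2 / 2 + (- \<xi>\<^sup>2 / 2 + \<eta> * \<xi>)" by (simp add: power2_eq_square field_simps)
      then have "exp (- (\<xi> - \<eta>)\<^sup>2 / 2) = exp (- \<eta>\<^sup>2 / 2) * exp (- \<xi>\<^sup>2 / 2 + \<eta> * \<xi>)" by (simp only: exp_add)
      moreover have "exp (- (of_real \<xi>)\<^sup>2 / 2 + of_real \<eta> * of_real \<xi>) = complex_of_real (exp (- \<xi>\<^sup>2 / 2 + \<eta> * \<xi>))"
        unfolding exp_of_real[symmetric] by simp
      ultimately show "F \<xi> * of_real (sqrt (2 * pi) * exp (- (\<xi> - \<eta>)\<^sup>2 / 2)) =
          of_real (sqrt (2 * pi) * exp (- \<eta>\<^sup>2 / 2)) * (F \<xi> * exp (- (of_real \<xi>)\<^sup>2 / 2 + of_real \<eta> * of_real \<xi>))"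
        by (simp only: of_real_mult mult_ac)
    qed simp
    also have "\<dots> = of_real (sqrt (2 * pi) * exp (- \<eta>\<^sup>2 / 2)) * (of_real c * I)"
      by (subst integral_mult_right_zero) (simp only: 1)
    also have "\<dots> = of_real (sqrt (2 * pi) * exp (- \<eta>\<^sup>2 / 2) * c) * I"
      by (simp only: of_real_mult mult_ac)
    also have "sqrt (2 * pi) * exp (- \<eta>\<^sup>2 / 2) * c = 2 * pi"
      unfolding c_def by (simp add: exp_minus field_simps)
    finally show ?thesis unfolding I_def by (simp only: mult_ac)
  qed
  have "AE x in lborel. (of_real (f x) - G x / of_real (2 * pi)) * E x = 0"
  proof (rule fourier_injective)
    have "integrable lborel (\<lambda>x. of_real (f x) * E x - (G x * E x) / of_real (2 * pi))"
      by (intro Bochner_Integration.integrable_diff i1 integrable_divide_zero) (use i2 in auto)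
    then show "integrable lborel (\<lambda>x. (of_real (f x) - G x / of_real (2 * pi)) * E x)"
      by (simp add: algebra_simps)
    fix t
    have "(LINT x|lborel. cis (t * x) * ((of_real (f x) - G x / of_real (2 * pi)) * E x))
        = (LINT x|lborel. of_real (f x) * (cis (- (- t * x)) * E x) - (G x * (cis (- (- t * x)) * E x)) / of_real (2 * pi))"
      by (rule Bochner_Integration.integral_cong) (auto simp: algebra_simps)
    also have "\<dots> = (LINT x|lborel. of_real (f x) * (cis (- (- t * x)) * E x)) - (LINT x|lborel. (G x * (cis (- (- t * x)) * E x)) / of_real (2 * pi))"
      by (intro Bochner_Integration.integral_diff i1' integrable_divide_zero) (use i2'[of "- t"] in auto)
    also have "\<dots> = (LINT x|lborel. of_real (f x) * (cis (- (- t * x)) * E x)) - (LINT x|lborel. (G x * (cis (- (- t * x)) * E x))) / of_real (2 * pi)"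
      by (simp only: integral_divide_zero)
    also have "\<dots> = 0"
      unfolding Gint fint[symmetric] by simp
    finally show "(LINT x|lborel. cis (t * x) * ((of_real (f x) - G x / of_real (2 * pi)) * E x)) = 0" .
  qed
  then show ?thesis by eventually_elim (simp add: E_def G_def)
qed

section \<open>Sobolev embedding\<close>

text \<open>The real part of \<open>\<integral> e\<^sup>i\<^sup>x\<^sup>\<xi> (a(\<xi>) + i b(\<xi>)) d\<xi>\<close>; up to the factor \<open>2\<pi>\<close>, this recovers a
  real function with Fourier transform \<open>a + i b\<close>.\<close>

definition osc :: "(real \<Rightarrow> real) \<Rightarrow> (real \<Rightarrow> real) \<Rightarrow> real \<Rightarrow> real" where
  "osc a b x = (LINT \<xi>|lborel. cos (x * \<xi>) * a \<xi> - sin (x * \<xi>) * b \<xi>)"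

lemma osc_integrand_bound:
  "\<bar>cos y * a - sin y * b\<bar> \<le> \<bar>a\<bar> + \<bar>b :: real\<bar>"
proof -
  have "\<bar>cos y * a\<bar> \<le> \<bar>a\<bar>" "\<bar>sin y * b\<bar> \<le> \<bar>b\<bar>"
    unfolding abs_mult by (intro mult_left_le_one_le; simp)+
  then show ?thesis by linarith
qed

lemma osc_integrable:
  fixes a b :: "real \<Rightarrow> real"
  assumes "integrable lborel a" "integrable lborel b"
  shows "integrable lborel (\<lambda>\<xi>. cos (x * \<xi>) * a \<xi> - sin (x * \<xi>) * b \<xi>)"
proof -
  have "integrable lborel (\<lambda>\<xi>. \<bar>a \<xi>\<bar> + \<bar>b \<xi>\<bar>)" using assms by auto
  then show ?thesis
    by (rule Bochner_Integration.integrable_bound) (use osc_integrand_bound assms in auto)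
qed

lemma osc_bound:
  assumes "integrable lborel a" "integrable lborel b"
  shows "\<bar>osc a b x\<bar> \<le> (LINT \<xi>|lborel. \<bar>a \<xi>\<bar> + \<bar>b \<xi>\<bar>)"
  unfolding osc_def using assms osc_integrable[OF assms]
  by (intro order_trans[OF integral_abs_bound] integral_mono) (auto simp: osc_integrand_bound)

lemma osc_continuous:
  assumes "integrable lborel a" "integrable lborel b"
  shows "continuous_on UNIV (osc a b)"
  unfolding continuous_on_sequentially osc_def o_def
proof (intro allI ballI impI, elim conjE)
  fix X :: "nat \<Rightarrow> real" and x assume X: "X \<longlonglongrightarrow> x"
  show "(\<lambda>n. LINT \<xi>|lborel. cos (X n * \<xi>) * a \<xi> - sin (X n * \<xi>) * b \<xi>)
      \<longlonglongrightarrow> (LINT \<xi>|lborel. cos (x * \<xi>) * a \<xi> - sin (x * \<xi>) * b \<xi>)"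
  proof (rule integral_dominated_convergence[where w="\<lambda>\<xi>. \<bar>a \<xi>\<bar> + \<bar>b \<xi>\<bar>"])
    show "AE \<xi> in lborel. (\<lambda>n. cos (X n * \<xi>) * a \<xi> - sin (X n * \<xi>) * b \<xi>) \<longlonglongrightarrow> cos (x * \<xi>) * a \<xi> - sin (x * \<xi>) * b \<xi>"
      by (intro AE_I2 tendsto_intros X)
  qed (use assms osc_integrable[OF assms] osc_integrand_bound in auto)
qed

text \<open>The new pair consists of the real and imaginary part of i \<xi> (a + i b).
  Differentiation under the integral is justified by the mean value inequality, which dominates the
  difference quotients by |\<xi> a| + |\<xi> b|.\<close>

lemma osc_deriv:
  assumes "integrable lborel a" "integrable lborel b"
    and "integrable lborel (\<lambda>\<xi>. \<xi> * a \<xi>)" "integrable lborel (\<lambda>\<xi>. \<xi> * b \<xi>)"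
  shows "(osc a b has_real_derivative osc (\<lambda>\<xi>. - \<xi> * b \<xi>) (\<lambda>\<xi>. \<xi> * a \<xi>) x) (at x)"
proof -
  define p where "p = (\<lambda>x \<xi>. cos (x * \<xi>) * a \<xi> - sin (x * \<xi>) * b \<xi>)"
  define p' where "p' = (\<lambda>x \<xi>. cos (x * \<xi>) * (- \<xi> * b \<xi>) - sin (x * \<xi>) * (\<xi> * a \<xi>))"
  have d: "((\<lambda>x. p x \<xi>) has_real_derivative p' x \<xi>) (at x)" for x \<xi>
    unfolding p_def p'_def by (rule derivative_eq_intros refl | simp)+
  have b: "\<bar>p' x \<xi>\<bar> \<le> \<bar>\<xi> * a \<xi>\<bar> + \<bar>\<xi> * b \<xi>\<bar>" for x \<xi>
    using osc_integrand_bound[of "x * \<xi>" "- \<xi> * b \<xi>" "\<xi> * a \<xi>"] by (simp add: p'_def)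
  have [measurable]: "a \<in> borel_measurable borel" "b \<in> borel_measurable borel" using assms by auto
  have ip: "integrable lborel (p x)" for x unfolding p_def by (rule osc_integrable[OF assms(1,2)])
  have osc: "osc a b y = (LINT \<xi>|lborel. p y \<xi>)" for y by (simp add: osc_def p_def)
  have mp: "p' x \<in> borel_measurable lborel" for x unfolding p'_def by measurable
  have lip: "\<bar>p y \<xi> - p x \<xi>\<bar> \<le> (\<bar>\<xi> * a \<xi>\<bar> + \<bar>\<xi> * b \<xi>\<bar>) * \<bar>y - x\<bar>" for x y \<xi>
    using field_differentiable_bound[of UNIV "\<lambda>x. p x \<xi>" "\<lambda>x. p' x \<xi>" "\<bar>\<xi> * a \<xi>\<bar> + \<bar>\<xi> * b \<xi>\<bar>" y x] d b by auto
  show ?thesis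
    unfolding has_field_derivative_iff tendsto_at_iff_sequentially
  proof (intro allI impI)
    fix X :: "nat \<Rightarrow> real" assume X: "\<forall>i. X i \<in> UNIV - {x}" "X \<longlonglongrightarrow> x"
    have "(\<lambda>n. LINT \<xi>|lborel. (p (X n) \<xi> - p x \<xi>) / (X n - x)) \<longlonglongrightarrow> (LINT \<xi>|lborel. p' x \<xi>)"
    proof (rule integral_dominated_convergence[where w="\<lambda>\<xi>. \<bar>\<xi> * a \<xi>\<bar> + \<bar>\<xi> * b \<xi>\<bar>"])
      show "AE \<xi> in lborel. (\<lambda>n. (p (X n) \<xi> - p x \<xi>) / (X n - x)) \<longlonglongrightarrow> p' x \<xi>"
        using d[unfolded has_field_derivative_iff tendsto_at_iff_sequentially] X by (auto simp: o_def)
      show "AE \<xi> in lborel. norm ((p (X n) \<xi> - p x \<xi>) / (X n - x)) \<le> \<bar>\<xi> * a \<xi>\<bar> + \<bar>\<xi> * b \<xi>\<bar>" for n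
        using lip X by (auto simp: divide_simps)
    qed (use assms mp ip in auto)
    moreover have "(LINT \<xi>|lborel. (p (X n) \<xi> - p x \<xi>) / (X n - x)) = (osc a b (X n) - osc a b x) / (X n - x)" for n
      using ip by (simp add: osc)
    moreover have "osc (\<lambda>\<xi>. - \<xi> * b \<xi>) (\<lambda>\<xi>. \<xi> * a \<xi>) x = (LINT \<xi>|lborel. p' x \<xi>)"
      by (simp add: osc_def p'_def)
    ultimately show "((\<lambda>y. (osc a b y - osc a b x) / (y - x)) \<circ> X) \<longlonglongrightarrow> osc (\<lambda>\<xi>. - \<xi> * b \<xi>) (\<lambda>\<xi>. \<xi> * a \<xi>) x"
      by (simp only: o_def)
  qed
qed

text \<open>Membership in \<open>sobolev\<close> speaks of some transform,
  \<open>sobolev_norm\<close> of the selected one; uniqueness up to null sets makes them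
  interchangeable under the integral.\<close>

lemma sobolev_fourier_transform:
  assumes "f \<in> sobolev s"
  shows "has_fourier_transform f (fourier_transform f)"
    and "integrable lborel (\<lambda>\<xi>. (1 + \<xi>\<^sup>2) powr s * (cmod (fourier_transform f \<xi>))\<^sup>2)"
proof -
  obtain F where F: "has_fourier_transform f F"
    and i: "integrable lborel (\<lambda>\<xi>. (1 + \<xi>\<^sup>2) powr s * (cmod (F \<xi>))\<^sup>2)"
    using assms by (auto simp: sobolev_def)
  show ft: "has_fourier_transform f (fourier_transform f)"
    unfolding fourier_transform_def by (rule someI[of _ F]) (rule F)
  have [measurable]: "F \<in> borel_measurable lborel" "fourier_transform f \<in> borel_measurable lborel"
    using F ft by (auto simp: has_fourier_transform_def L2_fun_def)
  show "integrable lborel (\<lambda>\<xi>. (1 + \<xi>\<^sup>2) powr s * (cmod (fourier_transform f \<xi>))\<^sup>2)"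
  proof (rule integrable_cong_AE_imp[OF i])
    show "AE \<xi> in lborel. (1 + \<xi>\<^sup>2) powr s * (cmod (F \<xi>))\<^sup>2 = (1 + \<xi>\<^sup>2) powr s * (cmod (fourier_transform f \<xi>))\<^sup>2"
      using has_fourier_transform_unique[OF F ft] by eventually_elim simp
  qed measurable
qed

lemma sobolev_linear:
  assumes "f \<in> sobolev s" "g \<in> sobolev s"
  shows "(\<lambda>x. a * f x + b * g x) \<in> sobolev s"
proof -
  note f = sobolev_fourier_transform[OF assms(1)] and g = sobolev_fourier_transform[OF assms(2)]
  define F where "F = fourier_transform f"
  define G where "G = fourier_transform g"
  have [measurable]: "F \<in> borel_measurable lborel" "G \<in> borel_measurable lborel"
    using f(1) g(1) by (auto simp: has_fourier_transform_def L2_fun_def F_def G_def)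
  have "integrable lborel (\<lambda>\<xi>. 2 * a\<^sup>2 * ((1 + \<xi>\<^sup>2) powr s * (cmod (F \<xi>))\<^sup>2) + 2 * b\<^sup>2 * ((1 + \<xi>\<^sup>2) powr s * (cmod (G \<xi>))\<^sup>2))"
    using f(2) g(2) by (auto simp: F_def G_def)
  then have "integrable lborel (\<lambda>\<xi>. (1 + \<xi>\<^sup>2) powr s * (cmod (a *\<^sub>R F \<xi> + b *\<^sub>R G \<xi>))\<^sup>2)"
  proof (rule Bochner_Integration.integrable_bound)
    show "AE \<xi> in lborel. norm ((1 + \<xi>\<^sup>2) powr s * (cmod (a *\<^sub>R F \<xi> + b *\<^sub>R G \<xi>))\<^sup>2)
       \<le> norm (2 * a\<^sup>2 * ((1 + \<xi>\<^sup>2) powr s * (cmod (F \<xi>))\<^sup>2) + 2 * b\<^sup>2 * ((1 + \<xi>\<^sup>2) powr s * (cmod (G \<xi>))\<^sup>2))"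
    proof (intro AE_I2)
      fix \<xi> :: real
      have "(1 + \<xi>\<^sup>2) powr s * (cmod (a *\<^sub>R F \<xi> + b *\<^sub>R G \<xi>))\<^sup>2
         \<le> (1 + \<xi>\<^sup>2) powr s * (2 * a\<^sup>2 * (cmod (F \<xi>))\<^sup>2 + 2 * b\<^sup>2 * (cmod (G \<xi>))\<^sup>2)"
        by (intro mult_left_mono norm_linear_combination_sq_le) auto
      then show "norm ((1 + \<xi>\<^sup>2) powr s * (cmod (a *\<^sub>R F \<xi> + b *\<^sub>R G \<xi>))\<^sup>2)
       \<le> norm (2 * a\<^sup>2 * ((1 + \<xi>\<^sup>2) powr s * (cmod (F \<xi>))\<^sup>2) + 2 * b\<^sup>2 * ((1 + \<xi>\<^sup>2) powr s * (cmod (G \<xi>))\<^sup>2))"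
        by (simp add: algebra_simps)
    qed
  qed measurable
  then show ?thesis
    using has_fourier_transform_linear[OF f(1) g(1), of a b] by (auto simp: sobolev_def F_def G_def)
qed

text \<open>Cauchy-Schwarz, as \<open>2 A B \<le> l A\<^sup>2 + B\<^sup>2 / l\<close> with \<open>l\<close> optimised at the end. The optimal \<open>l\<close> is
  the norm on the right, so the case of norm \<open>0\<close> is separate.\<close>

lemma weighted_L2_imp_L1:
  fixes F :: "real \<Rightarrow> complex"
  assumes [measurable]: "F \<in> borel_measurable lborel"
    and i: "integrable lborel (\<lambda>\<xi>. (1 + \<xi>\<^sup>2) powr s * (cmod (F \<xi>))\<^sup>2)"
    and sk: "s - k > 1 / 2"
  shows "integrable lborel (\<lambda>\<xi>. (1 + \<xi>\<^sup>2) powr (k / 2) * cmod (F \<xi>))"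
    and "(LINT \<xi>|lborel. (1 + \<xi>\<^sup>2) powr (k / 2) * cmod (F \<xi>)) \<le>
      ((LINT \<xi>|lborel. (1 + \<xi>\<^sup>2) powr (- (s - k))) + 1) / 2
      * sqrt (LINT \<xi>|lborel. (1 + \<xi>\<^sup>2) powr s * (cmod (F \<xi>))\<^sup>2)"
proof -
  define w where "w = (\<lambda>\<xi>. (1 + \<xi>\<^sup>2) powr (k / 2) * cmod (F \<xi>))"
  define J where "J = (LINT \<xi>::real|lborel. (1 + \<xi>\<^sup>2) powr (- (s - k)))"
  define N where "N = (LINT \<xi>|lborel. (1 + \<xi>\<^sup>2) powr s * (cmod (F \<xi>))\<^sup>2)"
  have iJ: "integrable lborel (\<lambda>\<xi>::real. (1 + \<xi>\<^sup>2) powr (- (s - k)))"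
    by (rule integrable_japanese_bracket[OF sk])
  have J: "J \<ge> 0" and N: "N \<ge> 0" unfolding J_def N_def by auto
  have w: "w \<xi> \<le> (l * (1 + \<xi>\<^sup>2) powr (- (s - k)) + (1 + \<xi>\<^sup>2) powr s * (cmod (F \<xi>))\<^sup>2 / l) / 2" if l: "l > 0" for l \<xi>
  proof -
    define A where "A = (1 + \<xi>\<^sup>2) powr (- (s - k) / 2)"
    define B where "B = (1 + \<xi>\<^sup>2) powr (s / 2) * cmod (F \<xi>)"
    have p: "1 + \<xi>\<^sup>2 > 0" by (simp add: add_pos_nonneg)
    have "A * B = (1 + \<xi>\<^sup>2) powr (- (s - k) / 2 + s / 2) * cmod (F \<xi>)"
      unfolding A_def B_def powr_add by simp
    also have "- (s - k) / 2 + s / 2 = k / 2" by (simp add: field_simps)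
    finally have 1: "A * B = w \<xi>" by (simp add: w_def)
    have 2: "A\<^sup>2 = (1 + \<xi>\<^sup>2) powr (- (s - k))"
      unfolding A_def power2_eq_square powr_add[symmetric] by simp
    have 3: "B\<^sup>2 = (1 + \<xi>\<^sup>2) powr s * (cmod (F \<xi>))\<^sup>2"
      unfolding B_def power_mult_distrib unfolding power2_eq_square[of "_ powr _"] powr_add[symmetric] by simp
    have "2 * (l * A) * B \<le> (l * A)\<^sup>2 + B\<^sup>2" by (rule sum_squares_bound)
    then have "A * B \<le> (l * A\<^sup>2 + B\<^sup>2 / l) / 2" using l by (simp add: field_simps power2_eq_square)
    then show ?thesis unfolding 1 2 3 .
  qed
  have ib: "integrable lborel (\<lambda>\<xi>. (l * (1 + \<xi>\<^sup>2) powr (- (s - k)) + (1 + \<xi>\<^sup>2) powr s * (cmod (F \<xi>))\<^sup>2 / l) / 2)" for l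
    using i iJ by auto
  have w0: "w \<xi> \<ge> 0" for \<xi> by (simp add: w_def)
  have iw: "integrable lborel w"
  proof (rule Bochner_Integration.integrable_bound[OF ib[of 1]])
    show "w \<in> borel_measurable lborel" unfolding w_def by measurable
    show "AE \<xi> in lborel. norm (w \<xi>) \<le> norm ((1 * (1 + \<xi>\<^sup>2) powr (- (s - k)) + (1 + \<xi>\<^sup>2) powr s * (cmod (F \<xi>))\<^sup>2 / 1) / 2)"
      using w[of 1] w0 by (auto intro!: AE_I2 order_trans[OF _ abs_ge_self])
  qed
  have le: "(LINT \<xi>|lborel. w \<xi>) \<le> (l * J + N / l) / 2" if l: "l > 0" for l
  proof -
    have "(LINT \<xi>|lborel. w \<xi>) \<le> (LINT \<xi>|lborel. (l * (1 + \<xi>\<^sup>2) powr (- (s - k)) + (1 + \<xi>\<^sup>2) powr s * (cmod (F \<xi>))\<^sup>2 / l) / 2)"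
      by (rule integral_mono[OF iw ib w[OF l]])
    also have "\<dots> = (l * J + N / l) / 2"
      using i iJ by (simp add: J_def N_def)
    finally show ?thesis .
  qed
  have "(LINT \<xi>|lborel. w \<xi>) \<le> (J + 1) / 2 * sqrt N"
  proof (cases "N = 0")
    case True
    have "(LINT \<xi>|lborel. w \<xi>) \<le> 0"
    proof (rule field_le_epsilon)
      fix e :: real assume e: "e > 0"
      \<comment> \<open>With N = 0 the bound is l J / 2 for every l > 0, and this l makes it at most
        e; the 1 in the denominator guards against division by zero.\<close>
      have "(LINT \<xi>|lborel. w \<xi>) \<le> e / (J + 1) * J / 2" using le[of "e / (J + 1)"] True e J by simp
      also have "\<dots> \<le> e" using e J by (simp add: field_simps)
      finally show "(LINT \<xi>|lborel. w \<xi>) \<le> 0 + e" by simp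
    qed
    then show ?thesis using True by simp
  next
    case False
    have "N / sqrt N = sqrt N" using N by (simp add: real_div_sqrt)
    then have "(LINT \<xi>|lborel. w \<xi>) \<le> (sqrt N * J + sqrt N) / 2" using le[of "sqrt N"] False N by simp
    then show ?thesis by (simp add: algebra_simps)
  qed
  then show "integrable lborel (\<lambda>\<xi>. (1 + \<xi>\<^sup>2) powr (k / 2) * cmod (F \<xi>))"
    "(LINT \<xi>|lborel. (1 + \<xi>\<^sup>2) powr (k / 2) * cmod (F \<xi>)) \<le>
      ((LINT \<xi>|lborel. (1 + \<xi>\<^sup>2) powr (- (s - k))) + 1) / 2
      * sqrt (LINT \<xi>|lborel. (1 + \<xi>\<^sup>2) powr s * (cmod (F \<xi>))\<^sup>2)"
    using iw by (simp_all add: w_def J_def N_def)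
qed

definition cont_rep :: "(real \<Rightarrow> real) \<Rightarrow> real \<Rightarrow> real" where
  "cont_rep f x = osc (\<lambda>\<xi>. Re (fourier_transform f \<xi>)) (\<lambda>\<xi>. Im (fourier_transform f \<xi>)) x / (2 * pi)"

lemma osc_bound_Re_Im:
  assumes "integrable lborel F" and ab: "\<And>\<xi>. \<bar>a \<xi>\<bar> \<le> cmod (F \<xi>)" "\<And>\<xi>. \<bar>b \<xi>\<bar> \<le> cmod (F \<xi>)"
    and "a \<in> borel_measurable lborel" "b \<in> borel_measurable lborel"
  shows "\<bar>osc a b x / (2 * pi)\<bar> \<le> (LINT \<xi>|lborel. cmod (F \<xi>))"
proof -
  have iF: "integrable lborel (\<lambda>\<xi>. cmod (F \<xi>))" using assms by auto
  have ia: "integrable lborel a" "integrable lborel b"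
    by (rule Bochner_Integration.integrable_bound[OF iF]; use assms in auto)+
  have "\<bar>osc a b x\<bar> \<le> (LINT \<xi>|lborel. \<bar>a \<xi>\<bar> + \<bar>b \<xi>\<bar>)" by (rule osc_bound[OF ia])
  also have "\<dots> \<le> (LINT \<xi>|lborel. 2 * cmod (F \<xi>))"
  proof (rule integral_mono)
    fix \<xi> show "\<bar>a \<xi>\<bar> + \<bar>b \<xi>\<bar> \<le> 2 * cmod (F \<xi>)" using ab[of \<xi>] by linarith
  qed (use ia iF in auto)
  finally have 1: "\<bar>osc a b x\<bar> \<le> 2 * (LINT \<xi>|lborel. cmod (F \<xi>))" by simp
  have "2 * (LINT \<xi>|lborel. cmod (F \<xi>)) \<le> (LINT \<xi>|lborel. cmod (F \<xi>)) * (2 * pi)"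
    using mult_left_mono[of 1 pi "LINT \<xi>|lborel. cmod (F \<xi>)"] pi_gt3 by simp
  with 1 show "\<bar>osc a b x / (2 * pi)\<bar> \<le> (LINT \<xi>|lborel. cmod (F \<xi>))"
    by (simp add: field_simps abs_mult)
qed

lemma sobolev_cont_rep:
  assumes s: "s > 1 / 2" and f: "f \<in> sobolev s"
  shows "continuous_on UNIV (cont_rep f)"
    and "AE x in lborel. f x = cont_rep f x"
    and "\<bar>cont_rep f x\<bar> \<le> ((LINT \<xi>|lborel. (1 + \<xi>\<^sup>2) powr (- s)) + 1) / 2 * sobolev_norm s f"
proof -
  define F where "F = fourier_transform f"
  note ft = sobolev_fourier_transform[OF f, folded F_def]
  have mF[measurable]: "F \<in> borel_measurable lborel"
    using ft by (simp add: has_fourier_transform_def L2_fun_def)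
  have one: "1 + \<xi>\<^sup>2 \<noteq> 0" for \<xi> :: real using sum_power2_gt_zero_iff[of 1 \<xi>] by auto
  \<comment> \<open>For k = 0 the weight is 1 and the estimate controls the plain L^1 norm of
    F.\<close>
  note w = weighted_L2_imp_L1[OF mF ft(2), of 0]
  have F: "integrable lborel F"
    using w(1) s by (subst integrable_norm_iff[symmetric]) (auto simp: one)
  have le: "(LINT \<xi>|lborel. cmod (F \<xi>)) \<le> ((LINT \<xi>|lborel. (1 + \<xi>\<^sup>2) powr (- s)) + 1) / 2 * sobolev_norm s f"
    using w(2) s by (simp add: one sobolev_norm_def F_def)
  have b: "integrable lborel (\<lambda>\<xi>. Re (F \<xi>))" "integrable lborel (\<lambda>\<xi>. Im (F \<xi>))"
    using F by auto
  have b3: "\<bar>osc (\<lambda>\<xi>. Re (F \<xi>)) (\<lambda>\<xi>. Im (F \<xi>)) x / (2 * pi)\<bar> \<le> (LINT \<xi>|lborel. cmod (F \<xi>))"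
    by (rule osc_bound_Re_Im[OF F]) (auto simp: abs_Re_le_cmod abs_Im_le_cmod)
  show "continuous_on UNIV (cont_rep f)"
    unfolding cont_rep_def[abs_def] F_def[symmetric]
    by (intro continuous_intros osc_continuous b) auto
  show "\<bar>cont_rep f x\<bar> \<le> ((LINT \<xi>|lborel. (1 + \<xi>\<^sup>2) powr (- s)) + 1) / 2 * sobolev_norm s f"
    unfolding cont_rep_def F_def[symmetric] using b3 le by linarith
  have i: "integrable lborel (\<lambda>\<xi>. cis (x * \<xi>) * F \<xi>)" for x
    by (rule Bochner_Integration.integrable_bound[OF F]) (auto simp: norm_mult)
  show "AE x in lborel. f x = cont_rep f x"
    using fourier_inversion_AE[OF ft(1) F]
  proof eventually_elim
    case (elim x)
    have "f x = Re (complex_of_real (f x))" by simp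
    also have "\<dots> = Re (LINT \<xi>|lborel. cis (x * \<xi>) * F \<xi>) / (2 * pi)"
      unfolding elim by (rule Re_divide_of_real)
    also have "Re (LINT \<xi>|lborel. cis (x * \<xi>) * F \<xi>) = osc (\<lambda>\<xi>. Re (F \<xi>)) (\<lambda>\<xi>. Im (F \<xi>)) x"
      unfolding osc_def integral_Re[OF i, symmetric] by simp
    finally show ?case by (simp add: cont_rep_def F_def)
  qed
qed

text \<open>A derivative in x costs a factor |\<xi>| \<le> (1 + \<xi>^2)^(1/2), which is the weight
  of \<open>weighted_L2_imp_L1\<close> with k = 1. Hence the condition s - 1 > 1/2.\<close>

lemma sobolev_cont_rep_deriv:
  assumes s: "s > 3 / 2" and f: "f \<in> sobolev s"
  shows "\<exists>f'. continuous_on UNIV f' \<and> (\<forall>x. (cont_rep f has_real_derivative f' x) (at x)) \<and>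
    (\<forall>x. \<bar>f' x\<bar> \<le> ((LINT \<xi>|lborel. (1 + \<xi>\<^sup>2) powr (- (s - 1))) + 1) / 2 * sobolev_norm s f)"
proof -
  define F where "F = fourier_transform f"
  note ft = sobolev_fourier_transform[OF f, folded F_def]
  have mF[measurable]: "F \<in> borel_measurable lborel"
    using ft by (simp add: has_fourier_transform_def L2_fun_def)
  have ge1: "\<bar>\<xi>\<bar> \<le> (1 + \<xi>\<^sup>2) powr (1 / 2)" "1 \<le> (1 + \<xi>\<^sup>2) powr (1 / 2)" for \<xi> :: real
    by (auto simp: powr_half_sqrt real_le_rsqrt)
  note w = weighted_L2_imp_L1[OF mF ft(2), of 1]
  define E where "E = (\<lambda>\<xi>. complex_of_real \<xi> * F \<xi>)"
  have iw: "integrable lborel (\<lambda>\<xi>. (1 + \<xi>\<^sup>2) powr (1 / 2) * cmod (F \<xi>))"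
    using w(1) s by auto
  have F: "integrable lborel F"
    by (rule Bochner_Integration.integrable_bound[OF iw])
       (use mult_right_mono[OF ge1(2) norm_ge_zero] in auto)
  have E: "integrable lborel E"
    by (rule Bochner_Integration.integrable_bound[OF iw])
       (auto simp: E_def norm_mult intro!: AE_I2 mult_right_mono ge1)
  have "(LINT \<xi>|lborel. cmod (E \<xi>)) \<le> (LINT \<xi>|lborel. (1 + \<xi>\<^sup>2) powr (1 / 2) * cmod (F \<xi>))"
    using integrable_norm[OF E] iw by (intro integral_mono) (auto simp: E_def norm_mult intro!: mult_right_mono ge1)
  also have "\<dots> \<le> ((LINT \<xi>|lborel. (1 + \<xi>\<^sup>2) powr (- (s - 1))) + 1) / 2 * sobolev_norm s f"
    using w(2) s by (simp add: sobolev_norm_def F_def)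
  finally have le: "(LINT \<xi>|lborel. cmod (E \<xi>)) \<le> ((LINT \<xi>|lborel. (1 + \<xi>\<^sup>2) powr (- (s - 1))) + 1) / 2 * sobolev_norm s f" .
  have b: "integrable lborel (\<lambda>\<xi>. Re (F \<xi>))" "integrable lborel (\<lambda>\<xi>. Im (F \<xi>))"
    using F by auto
  have c: "integrable lborel (\<lambda>\<xi>. - \<xi> * Im (F \<xi>))" "integrable lborel (\<lambda>\<xi>. \<xi> * Re (F \<xi>))"
    using integrable_Im[OF E] integrable_Re[OF E] by (simp_all add: E_def)
  have c3: "\<bar>osc (\<lambda>\<xi>. - \<xi> * Im (F \<xi>)) (\<lambda>\<xi>. \<xi> * Re (F \<xi>)) x / (2 * pi)\<bar> \<le> (LINT \<xi>|lborel. cmod (E \<xi>))" for x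
    by (rule osc_bound_Re_Im[OF E]) (auto simp: E_def norm_mult abs_mult abs_Re_le_cmod abs_Im_le_cmod intro!: mult_left_mono)
  have c': "integrable lborel (\<lambda>\<xi>. \<xi> * Im (F \<xi>))" using c(1) by simp
  define f' where "f' = (\<lambda>x. osc (\<lambda>\<xi>. - \<xi> * Im (F \<xi>)) (\<lambda>\<xi>. \<xi> * Re (F \<xi>)) x / (2 * pi))"
  have "continuous_on UNIV f'"
    unfolding f'_def by (intro continuous_intros osc_continuous c) auto
  moreover have "(cont_rep f has_real_derivative f' x) (at x)" for x
    unfolding cont_rep_def[abs_def] F_def[symmetric] f'_def
    by (intro DERIV_cdivide osc_deriv b c(2) c')
  moreover have "\<bar>f' x\<bar> \<le> ((LINT \<xi>|lborel. (1 + \<xi>\<^sup>2) powr (- (s - 1))) + 1) / 2 * sobolev_norm s f" for x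
    unfolding f'_def using c3[of x] le by linarith
  ultimately show ?thesis by blast
qed

lemma sobolev_continuous_eq:
  assumes "s > 1 / 2" "f \<in> sobolev s" "continuous_on UNIV f"
  shows "f = cont_rep f"
  by (rule AE_eq_continuous[OF sobolev_cont_rep(2)[OF assms(1,2)] assms(3) sobolev_cont_rep(1)[OF assms(1,2)]])

text \<open>The factor (J + 1) / 2, with J the integral of the dual weight, is what the choice l =
  norm leaves in \<open>weighted_L2_imp_L1\<close>.\<close>

definition embedding_const :: "real \<Rightarrow> real" where
  "embedding_const s = ((LINT \<xi>|lborel. (1 + \<xi>\<^sup>2) powr (- s)) + 1) / 2"

lemma embedding_const_nonneg: "embedding_const s \<ge> 0"
  by (simp add: embedding_const_def add_nonneg_nonneg)

text \<open>The bound is placed on a continuous \<open>h\<close> that agrees with \<open>f\<close>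
  almost everywhere, because the time derivative of a solution is known only up to null sets and
  must be replaced by its continuous representative.\<close>

lemma sobolev_sup_bound:
  assumes s: "s > 1 / 2" and f: "f \<in> sobolev s" and h: "AE x in lborel. f x = h x" "continuous_on UNIV h"
  shows "\<bar>h x\<bar> \<le> embedding_const s * sobolev_norm s f"
proof -
  have "AE x in lborel. h x = cont_rep f x"
    using h(1) sobolev_cont_rep(2)[OF s f] by eventually_elim simp
  then have "h = cont_rep f" using h(2) sobolev_cont_rep(1)[OF s f] by (rule AE_eq_continuous)
  then show ?thesis using sobolev_cont_rep(3)[OF s f] by (simp add: embedding_const_def)
qed

lemma sobolev_deriv:
  assumes s: "s > 3 / 2" and f: "f \<in> sobolev s" "continuous_on UNIV f"
  shows "(f has_real_derivative deriv f x) (at x)" "continuous_on UNIV (deriv f)"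
    and "\<bar>deriv f x\<bar> \<le> embedding_const (s - 1) * sobolev_norm s f"
proof -
  have eq: "f = cont_rep f" using s by (intro sobolev_continuous_eq[of s] f) auto
  obtain f' where f': "continuous_on UNIV f'" "\<And>x. (f has_real_derivative f' x) (at x)"
    "\<And>x. \<bar>f' x\<bar> \<le> embedding_const (s - 1) * sobolev_norm s f"
    using sobolev_cont_rep_deriv[OF s f(1), folded embedding_const_def] unfolding eq[symmetric] by blast
  have "deriv f = f'" using f'(2) by (auto intro!: DERIV_imp_deriv)
  then show "(f has_real_derivative deriv f x) (at x)" "continuous_on UNIV (deriv f)"
    "\<bar>deriv f x\<bar> \<le> embedding_const (s - 1) * sobolev_norm s f"
    using f' by auto
qed

section \<open>From continuity in time with Sobolev values to uniform statements in x\<close>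

lemma eventually_uniform_of_norm:
  assumes b: "\<And>r x. r \<in> I \<Longrightarrow> r \<noteq> t \<Longrightarrow> \<bar>f r x\<bar> \<le> C * N r" and C: "C \<ge> 0"
    and N: "(N \<longlongrightarrow> 0) (at t within I)" and e: "e > (0::real)"
  shows "\<forall>\<^sub>F r in at t within I. \<forall>x. \<bar>f r x\<bar> < e"
proof -
  have "((\<lambda>r. C * N r) \<longlongrightarrow> C * 0) (at t within I)" by (intro tendsto_intros N)
  then have "\<forall>\<^sub>F r in at t within I. C * N r < e" using e by (intro order_tendstoD) auto
  moreover have "\<forall>\<^sub>F r in at t within I. r \<in> I \<and> r \<noteq> t" by (simp add: eventually_at_filter)
  ultimately show ?thesis
    by eventually_elim (use b in \<open>auto intro: order_le_less_trans\<close>)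
qed

lemma sobolev_C0_uniform:
  assumes s: "s > 1 / 2" and u: "sobolev_C0 s I u" and t: "t \<in> I" and e: "e > 0"
    and w: "\<And>t. t \<in> I \<Longrightarrow> continuous_on UNIV (w t)" "\<And>t. t \<in> I \<Longrightarrow> AE x in lborel. u t x = w t x"
  shows "\<forall>\<^sub>F r in at t within I. \<forall>x. \<bar>w r x - w t x\<bar> < e"
proof -
  have N: "((\<lambda>r. sobolev_norm s (\<lambda>x. u r x - u t x)) \<longlongrightarrow> 0) (at t within I)"
    using u t by (simp add: sobolev_C0_def)
  have b: "\<bar>w r x - w t x\<bar> \<le> embedding_const s * sobolev_norm s (\<lambda>x. u r x - u t x)" if r: "r \<in> I" for r x
  proof -
    have "(\<lambda>x. 1 * u r x + (- 1) * u t x) \<in> sobolev s"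
      using u r t by (intro sobolev_linear) (auto simp: sobolev_C0_def)
    then have S: "(\<lambda>x. u r x - u t x) \<in> sobolev s" by simp
    show ?thesis
    proof (rule sobolev_sup_bound[OF s S, where h="\<lambda>x. w r x - w t x"])
      show "AE x in lborel. u r x - u t x = w r x - w t x"
        using w(2)[OF r] w(2)[OF t] by eventually_elim simp
      show "continuous_on UNIV (\<lambda>x. w r x - w t x)" by (intro continuous_intros w r t)
    qed
  qed
  show ?thesis by (rule eventually_uniform_of_norm[OF b embedding_const_nonneg N e])
qed

lemma sobolev_C0_deriv_uniform:
  assumes s: "s > 3 / 2" and u: "sobolev_C0 s I u" and t: "t \<in> I" and e: "e > 0"
    and c: "\<And>t. t \<in> I \<Longrightarrow> continuous_on UNIV (u t)"
  shows "\<forall>\<^sub>F r in at t within I. \<forall>x. \<bar>deriv (u r) x - deriv (u t) x\<bar> < e"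
proof -
  have N: "((\<lambda>r. sobolev_norm s (\<lambda>x. u r x - u t x)) \<longlongrightarrow> 0) (at t within I)"
    using u t by (simp add: sobolev_C0_def)
  have b: "\<bar>deriv (u r) x - deriv (u t) x\<bar> \<le> embedding_const (s - 1) * sobolev_norm s (\<lambda>x. u r x - u t x)" if r: "r \<in> I" for r x
  proof -
    have S: "u r \<in> sobolev s" "u t \<in> sobolev s" using u r t by (auto simp: sobolev_C0_def)
    then have "(\<lambda>x. 1 * u r x + (- 1) * u t x) \<in> sobolev s" by (rule sobolev_linear)
    then have S': "(\<lambda>x. u r x - u t x) \<in> sobolev s" by simp
    have "deriv (\<lambda>x. u r x - u t x) x = deriv (u r) x - deriv (u t) x"
      by (intro DERIV_imp_deriv DERIV_diff sobolev_deriv(1)[OF s] S c r t)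
    moreover have "\<bar>deriv (\<lambda>x. u r x - u t x) x\<bar> \<le> embedding_const (s - 1) * sobolev_norm s (\<lambda>x. u r x - u t x)"
      by (intro sobolev_deriv(3)[OF s S'] continuous_intros c r t)
    ultimately show ?thesis
      by simp
  qed
  show ?thesis by (rule eventually_uniform_of_norm[OF b embedding_const_nonneg N e])
qed

text \<open>By embedding, convergence of the difference quotients in the Sobolev norm is uniform in
  x, in particular pointwise, so the abstract time derivative is a classical one. It is applied with
  s - 1 in place of s.\<close>

lemma sobolev_C1_has_derivative:
  assumes s: "s > 1 / 2" and uv: "sobolev_C1_deriv s I u v" and t: "t \<in> I"
    and c: "\<And>t. t \<in> I \<Longrightarrow> continuous_on UNIV (u t)"
    and w: "continuous_on UNIV w" "AE x in lborel. v t x = w x"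
  shows "((\<lambda>r. u r x) has_real_derivative w x) (at t within I)"
  unfolding has_field_derivative_iff
proof (rule tendstoI)
  fix e :: real assume e: "e > 0"
  have "\<forall>\<^sub>F r in at t within I. \<forall>x. \<bar>(u r x - u t x) / (r - t) - w x\<bar> < e"
  proof (rule eventually_uniform_of_norm[OF _ embedding_const_nonneg _ e])
    show "((\<lambda>r. sobolev_norm s (\<lambda>x. (u r x - u t x) / (r - t) - v t x)) \<longlongrightarrow> 0) (at t within I)"
      using uv t by (simp add: sobolev_C1_deriv_def)
    fix r x assume r: "r \<in> I" "r \<noteq> t"
    have S: "u r \<in> sobolev s" "u t \<in> sobolev s" "v t \<in> sobolev s"
      using uv r t by (auto simp: sobolev_C1_deriv_def sobolev_C0_def)
    have "(\<lambda>x. 1 * (1 / (r - t) * u r x + (- (1 / (r - t))) * u t x) + (- 1) * v t x) \<in> sobolev s"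
      by (intro sobolev_linear S)
    also have "(\<lambda>x. 1 * (1 / (r - t) * u r x + (- (1 / (r - t))) * u t x) + (- 1) * v t x) =
      (\<lambda>x. (u r x - u t x) / (r - t) - v t x)"
      using r by (simp add: fun_eq_iff diff_divide_distrib)
    finally have S': "(\<lambda>x. (u r x - u t x) / (r - t) - v t x) \<in> sobolev s" .
    show "\<bar>(u r x - u t x) / (r - t) - w x\<bar> \<le> embedding_const s * sobolev_norm s (\<lambda>x. (u r x - u t x) / (r - t) - v t x)"
    proof (rule sobolev_sup_bound[OF s S', where h="\<lambda>x. (u r x - u t x) / (r - t) - w x"])
      show "AE x in lborel. (u r x - u t x) / (r - t) - v t x = (u r x - u t x) / (r - t) - w x"
        using w(2) by eventually_elim simp
      show "continuous_on UNIV (\<lambda>x. (u r x - u t x) / (r - t) - w x)"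
        using r by (intro continuous_intros c w t) auto
    qed
  qed
  then show "\<forall>\<^sub>F r in at t within I. dist ((u r x - u t x) / (r - t)) (w x) < e"
    by eventually_elim (simp add: dist_real_def)
qed

text \<open>Half of e pays for the change of time, uniformly in x, and half for the change of x at
  the fixed time.\<close>

lemma uniform_joint_continuous:
  fixes f :: "real \<Rightarrow> real \<Rightarrow> real"
  assumes u: "\<And>t e. t \<in> I \<Longrightarrow> e > 0 \<Longrightarrow> \<forall>\<^sub>F r in at t within I. \<forall>x. \<bar>f r x - f t x\<bar> < e"
    and c: "\<And>t. t \<in> I \<Longrightarrow> continuous_on UNIV (f t)"
  shows "continuous_on (I \<times> UNIV) (\<lambda>(t, x). f t x)"
  unfolding continuous_on_iff
proof (safe, clarsimp)
  fix t x e :: real assume t: "t \<in> I" and e: "e > 0"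
  have "\<forall>\<^sub>F r in at t within I. \<forall>x. \<bar>f r x - f t x\<bar> < e / 2" by (rule u[OF t half_gt_zero[OF e]])
  then obtain d1 where d1: "d1 > 0" "\<And>r x. r \<in> I \<Longrightarrow> r \<noteq> t \<Longrightarrow> dist r t < d1 \<Longrightarrow> \<bar>f r x - f t x\<bar> < e / 2"
    unfolding eventually_at by blast
  obtain d2 where d2: "d2 > 0" "\<And>y. dist y x < d2 \<Longrightarrow> dist (f t y) (f t x) < e / 2"
    using c[OF t] e unfolding continuous_on_iff by (metis UNIV_I half_gt_zero)
  show "\<exists>d>0. \<forall>r\<in>I. \<forall>y. dist (r, y) (t, x) < d \<longrightarrow> dist (f r y) (f t x) < e"
  proof (intro exI[of _ "min d1 d2"] conjI ballI allI impI)
    fix r y assume r: "r \<in> I" and d: "dist (r, y) (t, x) < min d1 d2"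
    have "dist r t < d1" "dist y x < d2"
      using d dist_fst_le[of "(r, y)" "(t, x)"] dist_snd_le[of "(r, y)" "(t, x)"] by auto
    then have "\<bar>f r y - f t y\<bar> < e / 2" "dist (f t y) (f t x) < e / 2"
      using d1(2)[OF r] d2(2) e by (cases "r = t"; auto)+
    then show "dist (f r y) (f t x) < e" unfolding dist_real_def by linarith
  qed (use d1 d2 in auto)
qed

lemma uniform_bounded:
  fixes f :: "real \<Rightarrow> real \<Rightarrow> real"
  assumes u: "\<And>t e. t \<in> I \<Longrightarrow> e > 0 \<Longrightarrow> \<forall>\<^sub>F r in at t within I. \<forall>x. \<bar>f r x - f t x\<bar> < e"
    and b: "\<And>t. t \<in> I \<Longrightarrow> \<exists>B. \<forall>x. \<bar>f t x\<bar> \<le> B" and I: "compact I"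
  obtains M where "\<And>t x. t \<in> I \<Longrightarrow> \<bar>f t x\<bar> \<le> M"
proof -
  have "\<exists>d>0. \<exists>B. \<forall>r\<in>I. dist r t < d \<longrightarrow> (\<forall>x. \<bar>f r x\<bar> \<le> B)" if t: "t \<in> I" for t
  proof -
    obtain B where B: "\<And>x. \<bar>f t x\<bar> \<le> B" using b[OF t] by blast
    obtain d where d: "d > 0" "\<And>r x. r \<in> I \<Longrightarrow> r \<noteq> t \<Longrightarrow> dist r t < d \<Longrightarrow> \<bar>f r x - f t x\<bar> < 1"
      using u[OF t, of 1] unfolding eventually_at by auto
    have "\<bar>f r x\<bar> \<le> B + 1" if "r \<in> I" "dist r t < d" for r x
      using d(2)[OF that(1) _ that(2), of x] B[of x] by (cases "r = t") auto
    with d(1) show ?thesis by blast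
  qed
  then obtain d B where dB: "\<And>t. t \<in> I \<Longrightarrow> d t > 0" "\<And>t r x. t \<in> I \<Longrightarrow> r \<in> I \<Longrightarrow> dist r t < d t \<Longrightarrow> \<bar>f r x\<bar> \<le> B t"
    by metis
  have "I \<subseteq> (\<Union>t\<in>I. ball t (d t))" using dB(1) by force
  then obtain J where J: "J \<subseteq> I" "finite J" "I \<subseteq> (\<Union>t\<in>J. ball t (d t))"
    by (rule compactE_image[OF I open_ball])
  show thesis
  \<comment> \<open>A sum instead of a maximum over the finite cover, so that an empty cover needs
    no separate case.\<close>
  proof (rule that[of "\<Sum>t\<in>J. \<bar>B t\<bar>"])
    fix r x assume r: "r \<in> I"
    then obtain t where t: "t \<in> J" "r \<in> ball t (d t)" using J by blast
    then have "\<bar>f r x\<bar> \<le> B t" using dB(2)[of t r x] J r by (auto simp: dist_commute)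
    also have "\<dots> \<le> \<bar>B t\<bar>" by simp
    also have "\<dots> \<le> (\<Sum>t\<in>J. \<bar>B t\<bar>)" by (rule member_le_sum) (use t J in auto)
    finally show "\<bar>f r x\<bar> \<le> (\<Sum>t\<in>J. \<bar>B t\<bar>)" .
  qed
qed

section \<open>The kernel of the inverse Helmholtz operator\<close>

lemma integrable_exp_half_line:
  fixes c :: real
  assumes c: "c > 0"
  shows "has_bochner_integral lborel (\<lambda>y. indicator {0..} y * exp (- c * y)) (1 / c)"
proof -
  have h: "((\<lambda>y. exp (- c * y)) has_integral 1 / c) {0..}"
    using has_integral_exp_minus_to_infinity[OF c, of 0] by simp
  have "(\<lambda>y. exp (- c * y)) absolutely_integrable_on {0..}"
    by (rule nonnegative_absolutely_integrable_1) (use h in \<open>auto simp: integrable_on_def\<close>)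
  then have i: "set_integrable lborel {0..} (\<lambda>y. exp (- c * y))"
    unfolding set_integrable_def by (subst (asm) integrable_completion) auto
  have "(LINT y:{0..}|lborel. exp (- c * y)) = 1 / c"
    using set_borel_integral_eq_integral(2)[OF i] h by (simp add: integral_unique)
  then show ?thesis
    using i by (simp add: has_bochner_integral_iff set_integrable_def set_lebesgue_integral_def)
qed

lemma has_bochner_integral_exp_abs:
  fixes c x :: real
  assumes c: "c > 0"
  shows "has_bochner_integral lborel (\<lambda>y. exp (- c * \<bar>x - y\<bar>)) (2 / c)"
proof -
  define g where "g = (\<lambda>y. indicator {0..} y * exp (- c * y))"
  note g = integrable_exp_half_line[OF c, folded g_def]
  then have g1: "integrable lborel g" "(LINT y|lborel. g y) = 1 / c"
    by (auto simp: has_bochner_integral_iff)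
  have g2: "integrable lborel (\<lambda>y. g (- x + 1 * y))" "(LINT y|lborel. g (- x + 1 * y)) = 1 / c"
    using lborel_integrable_real_affine[OF g1(1), of 1 "- x"] lborel_integral_real_affine[of 1 g "- x"] g1 by auto
  have g3: "integrable lborel (\<lambda>y. g (x + (- 1) * y))" "(LINT y|lborel. g (x + (- 1) * y)) = 1 / c"
    using lborel_integrable_real_affine[OF g1(1), of "- 1" x] lborel_integral_real_affine[of "- 1" g x] g1 by auto
  have ae: "AE y in lborel. g (- x + 1 * y) + g (x + (- 1) * y) = exp (- c * \<bar>x - y\<bar>)"
    using AE_lborel_singleton[of x]
    by eventually_elim (auto simp: g_def indicator_def abs_if algebra_simps)
  have "has_bochner_integral lborel (\<lambda>y. g (- x + 1 * y) + g (x + (- 1) * y)) (1 / c + 1 / c)"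
    using g2 g3 by (intro has_bochner_integral_add) (auto simp: has_bochner_integral_iff)
  then have "has_bochner_integral lborel (\<lambda>y. g (- x + 1 * y) + g (x + (- 1) * y)) (2 / c)" by simp
  then show ?thesis
    by (rule has_bochner_integralI_AE) (use ae in \<open>auto elim: eventually_mono\<close>)
qed

section \<open>Weighted bounds for the nonlocal operators\<close>

text \<open>Convolution with g'; the jump of g' at 0 is what later produces the term - f in the
  second derivative.\<close>

definition helmholtz_deriv :: "(real \<Rightarrow> real) \<Rightarrow> real \<Rightarrow> real" where
  "helmholtz_deriv f x = (LINT y|lborel. - sgn (x - y) * exp (- \<bar>x - y\<bar>) / 2 * f y)"

text \<open>Moving the weight from y to x costs \<open>exp (\<eta> * \<bar>x - y\<bar>)\<close>,
  which the kernel absorbs exactly when \<eta> < 1: the remaining exponential has integral 2/(1 -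
  \<eta>), and the kernel carries a factor 1/2. Since g and g' have the same bound exp(-|x|)/2, one
  computation serves both operators.\<close>

lemma helmholtz_weight_bound:
  fixes f w :: "real \<Rightarrow> real"
  assumes eta: "\<eta> < 1" and fw: "\<And>y. \<bar>f y\<bar> \<le> K * w y" and w: "\<And>y. w y \<le> exp (\<eta> * \<bar>x - y\<bar>) * w x"
    and K: "K \<ge> 0"
  shows "\<bar>inv_helmholtz f x\<bar> \<le> K * w x / (1 - \<eta>)"
    and "\<bar>helmholtz_deriv f x\<bar> \<le> K * w x / (1 - \<eta>)"
proof -
  have c: "1 - \<eta> > 0" using eta by simp
  note h = has_bochner_integral_exp_abs[OF c, of x]
  have b: "exp (- \<bar>x - y\<bar>) / 2 * \<bar>f y\<bar> \<le> K * w x / 2 * exp (- (1 - \<eta>) * \<bar>x - y\<bar>)" for y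
  proof -
    have "\<bar>f y\<bar> \<le> K * (exp (\<eta> * \<bar>x - y\<bar>) * w x)"
      using fw[of y] mult_left_mono[OF w K, of y] by linarith
    then have "exp (- \<bar>x - y\<bar>) / 2 * \<bar>f y\<bar> \<le> exp (- \<bar>x - y\<bar>) / 2 * (K * (exp (\<eta> * \<bar>x - y\<bar>) * w x))"
      by (intro mult_left_mono) auto
    also have "\<dots> = K * w x / 2 * (exp (- \<bar>x - y\<bar>) * exp (\<eta> * \<bar>x - y\<bar>))" by simp
    also have "exp (- \<bar>x - y\<bar>) * exp (\<eta> * \<bar>x - y\<bar>) = exp (- (1 - \<eta>) * \<bar>x - y\<bar>)"
      by (simp add: algebra_simps flip: exp_add)
    finally show ?thesis .
  qed
  have main: "\<bar>LINT y|lborel. k y\<bar> \<le> K * w x / (1 - \<eta>)"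
    if k: "\<And>y. \<bar>k y\<bar> \<le> exp (- \<bar>x - y\<bar>) / 2 * \<bar>f y\<bar>" for k :: "real \<Rightarrow> real"
  proof -
    have "\<bar>LINT y|lborel. k y\<bar> \<le> (LINT y|lborel. \<bar>k y\<bar>)" by (rule integral_abs_bound)
    also have "\<dots> \<le> (LINT y|lborel. K * w x / 2 * exp (- (1 - \<eta>) * \<bar>x - y\<bar>))"
    proof (rule integral_mono')
      show "integrable lborel (\<lambda>y. K * w x / 2 * exp (- (1 - \<eta>) * \<bar>x - y\<bar>))"
        using h by (intro Bochner_Integration.integrable_mult_right) (auto simp: has_bochner_integral_iff)
      show "\<bar>k y\<bar> \<le> K * w x / 2 * exp (- (1 - \<eta>) * \<bar>x - y\<bar>)" for y
        using k[of y] b[of y] by linarith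
      then show "0 \<le> K * w x / 2 * exp (- (1 - \<eta>) * \<bar>x - y\<bar>)" for y
        using abs_ge_zero order_trans by blast
    qed
    also have "\<dots> = K * w x / 2 * (2 / (1 - \<eta>))"
      using h by (simp only: integral_mult_right_zero has_bochner_integral_integral_eq)
    finally show ?thesis by simp
  qed
  show "\<bar>inv_helmholtz f x\<bar> \<le> K * w x / (1 - \<eta>)"
    unfolding inv_helmholtz_def by (rule main) (simp add: abs_mult)
  show "\<bar>helmholtz_deriv f x\<bar> \<le> K * w x / (1 - \<eta>)"
    unfolding helmholtz_deriv_def by (rule main) (auto simp: abs_mult sgn_if)
qed

section \<open>Derivatives of the nonlocal operators\<close>

text \<open>On either side of y = x the kernel factors into a function of x and a function of y. The
  convolution thus splits into this integral and its mirror image, in which x occurs only as a limit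
  of integration, so the corner of the kernel never has to be differentiated.\<close>

definition left_exp_integral :: "(real \<Rightarrow> real) \<Rightarrow> real \<Rightarrow> real" where
  "left_exp_integral f x = (LINT y|lborel. indicator {..x} y * (exp y * f y))"

lemma left_exp_integrable:
  assumes f: "continuous_on UNIV f" and b: "\<And>y. \<bar>f y\<bar> \<le> B"
  shows "integrable lborel (\<lambda>y. indicator {..x} y * (exp y * f y :: real))"
proof (rule Bochner_Integration.integrable_bound)
  show "integrable lborel (\<lambda>y. exp x * B * exp (- 1 * \<bar>x - y\<bar>))"
    using has_bochner_integral_exp_abs[of 1 x]
    by (intro Bochner_Integration.integrable_mult_right) (auto simp: has_bochner_integral_iff)
  have B: "B \<ge> 0" using b[of 0] by linarith
  have [measurable]: "f \<in> borel_measurable borel" using f by (rule borel_measurable_continuous_onI)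
  show "(\<lambda>y. indicator {..x} y * (exp y * f y)) \<in> borel_measurable lborel" by measurable
  show "AE y in lborel. norm (indicator {..x} y * (exp y * f y)) \<le> norm (exp x * B * exp (- 1 * \<bar>x - y\<bar>))"
  proof (intro AE_I2)
    fix y
    show "norm (indicator {..x} y * (exp y * f y)) \<le> norm (exp x * B * exp (- 1 * \<bar>x - y\<bar>))"
    proof (cases "y \<le> x")
      case True
      have "exp x * exp (- 1 * \<bar>x - y\<bar>) = exp y" using True by (simp flip: exp_add)
      then have *: "exp x * B * exp (- 1 * \<bar>x - y\<bar>) = exp y * B" by (simp only: mult_ac)
      show ?thesis unfolding * using True b[of y] B by (simp add: abs_mult)
    qed (use B in auto)
  qed
qed

lemma left_exp_integral_deriv:
  assumes f: "continuous_on UNIV f" and b: "\<And>y. \<bar>f y\<bar> \<le> B"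
  shows "(left_exp_integral f has_real_derivative exp x * f x) (at x)"
proof -
  \<comment> \<open>Some base point to the left of x: the improper integral up to \<open>a\<close>
    is a constant, and what remains is an integral over a compact interval.\<close>
  define a where "a = x - 1"
  define g where "g = (\<lambda>y. exp y * f y)"
  have gc: "continuous_on S g" for S
    unfolding g_def using f by (intro continuous_intros) (auto intro: continuous_on_subset)
  have eq: "left_exp_integral f z = left_exp_integral f a + integral {a..z} g" if z: "z > a" for z
  proof -
    have "left_exp_integral f z - left_exp_integral f a =
        (LINT y|lborel. indicator {..z} y * (exp y * f y) - indicator {..a} y * (exp y * f y))"
      unfolding left_exp_integral_def
      by (intro Bochner_Integration.integral_diff[symmetric] left_exp_integrable[OF f b])
    also have "\<dots> = (LINT y:{a<..z}|lborel. g y)"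
      unfolding set_lebesgue_integral_def
      by (rule Bochner_Integration.integral_cong) (use z in \<open>auto simp: g_def indicator_def\<close>)
    also have "\<dots> = (LINT y:{a..z}|lborel. g y)"
      unfolding set_lebesgue_integral_def
    proof (rule integral_cong_AE)
      have [measurable]: "g \<in> borel_measurable borel" using gc by (rule borel_measurable_continuous_onI)
      show "(\<lambda>y. indicator {a<..z} y *\<^sub>R g y) \<in> borel_measurable lborel"
        "(\<lambda>y. indicator {a..z} y *\<^sub>R g y) \<in> borel_measurable lborel" by measurable
      show "AE y in lborel. indicator {a<..z} y *\<^sub>R g y = indicator {a..z} y *\<^sub>R g y"
        using AE_lborel_singleton[of a] by eventually_elim (auto simp: indicator_def)
    qed
    also have "\<dots> = integral {a..z} g"
      by (intro set_borel_integral_eq_integral borel_integrable_atLeastAtMost')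
         (rule gc)
    finally show ?thesis by simp
  qed
  have "((\<lambda>z. integral {a..z} g) has_real_derivative g x) (at x within {a..x + 1})"
    by (rule integral_has_real_derivative[OF gc]) (simp add: a_def)
  then have "((\<lambda>z. integral {a..z} g) has_real_derivative g x) (at x)"
    by (subst (asm) at_within_interior) (auto simp: a_def)
  then have "((\<lambda>z. left_exp_integral f a + integral {a..z} g) has_real_derivative g x) (at x)"
    by (auto intro!: derivative_eq_intros)
  then have "(left_exp_integral f has_real_derivative g x) (at x)"
    by (rule has_field_derivative_transform_within_open[where S="{a<..}"]) (auto simp: a_def eq)
  then show ?thesis by (simp add: g_def)
qed

lemma helmholtz_decomp:
  assumes f: "continuous_on UNIV f" and b: "\<And>y. \<bar>f y\<bar> \<le> B"
  defines "R \<equiv> \<lambda>x. left_exp_integral (\<lambda>y. f (- y)) (- x)"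
  shows "inv_helmholtz f x = (exp (- x) * left_exp_integral f x + exp x * R x) / 2"
    and "helmholtz_deriv f x = (- exp (- x) * left_exp_integral f x + exp x * R x) / 2"
proof -
  have f': "continuous_on UNIV (\<lambda>y. f (- y))"
    by (rule continuous_on_compose2[OF f]) (auto intro: continuous_intros)
  have i1: "integrable lborel (\<lambda>y. indicator {..x} y * (exp y * f y))"
    by (rule left_exp_integrable[OF f b])
  have i2: "integrable lborel (\<lambda>y. indicator {x..} y * (exp (- y) * f y))"
    and r: "R x = (LINT y|lborel. indicator {x..} y * (exp (- y) * f y))"
  proof -
    define h where "h = (\<lambda>y. indicator {..- x} y * (exp y * f (- y)))"
    have h: "integrable lborel h" unfolding h_def by (rule left_exp_integrable[OF f']) (rule b)
    have eq: "(\<lambda>y. h (0 + (- 1) * y)) = (\<lambda>y. indicator {x..} y * (exp (- y) * f y))"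
      by (auto simp: h_def indicator_def fun_eq_iff)
    show "integrable lborel (\<lambda>y. indicator {x..} y * (exp (- y) * f y))"
      using lborel_integrable_real_affine[OF h, of "- 1" 0] unfolding eq by simp
    show "R x = (LINT y|lborel. indicator {x..} y * (exp (- y) * f y))"
      using lborel_integral_real_affine[of "- 1" h 0] unfolding eq by (simp add: R_def left_exp_integral_def h_def)
  qed
  have [measurable]: "f \<in> borel_measurable borel" using f by (rule borel_measurable_continuous_onI)
  have ex: "exp (- (x - y)) = exp (- x) * exp y" "exp (x - y) = exp x * exp (- y)" "exp (y - x) = exp (- x) * exp y" for y :: real
    by (simp_all flip: exp_add)
  \<comment> \<open>Here s is 1 for g and - 1 for g'. Nothing is asked of \<open>k\<close> at y = x,
    where the two kernels differ in kind, since a point is a null set.\<close>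
  have main: "(LINT y|lborel. k y * f y) = (s * exp (- x) * left_exp_integral f x + exp x * R x) / 2"
    if k: "\<And>y. y < x \<Longrightarrow> k y = s * exp (- (x - y)) / 2" "\<And>y. y > x \<Longrightarrow> k y = exp (x - y) / 2"
      and [measurable]: "k \<in> borel_measurable borel" for k s
  proof -
    have "(LINT y|lborel. k y * f y) = (LINT y|lborel. s * exp (- x) / 2 * (indicator {..x} y * (exp y * f y))
        + exp x / 2 * (indicator {x..} y * (exp (- y) * f y)))"
    proof (rule integral_cong_AE)
      show "AE y in lborel. k y * f y = s * exp (- x) / 2 * (indicator {..x} y * (exp y * f y))
        + exp x / 2 * (indicator {x..} y * (exp (- y) * f y))"
        using AE_lborel_singleton[of x]
      proof eventually_elim
        case (elim y)
        then show ?case by (cases "y < x") (auto simp: k ex)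
      qed
    qed measurable
    also have "\<dots> = s * exp (- x) / 2 * left_exp_integral f x + exp x / 2 * R x"
      using i1 i2 by (simp add: r left_exp_integral_def)
    finally show ?thesis by (simp add: field_simps)
  qed
  have "inv_helmholtz f x = (1 * exp (- x) * left_exp_integral f x + exp x * R x) / 2"
    unfolding inv_helmholtz_def by (rule main) auto
  then show "inv_helmholtz f x = (exp (- x) * left_exp_integral f x + exp x * R x) / 2" by simp
  have "helmholtz_deriv f x = ((- 1) * exp (- x) * left_exp_integral f x + exp x * R x) / 2"
    unfolding helmholtz_deriv_def by (rule main) auto
  then show "helmholtz_deriv f x = (- exp (- x) * left_exp_integral f x + exp x * R x) / 2" by simp
qed

text \<open>Differentiating the limits of the two one-sided integrals contributes f and - f. These
  cancel in the first derivative, where the left integral then changes sign, so they add up to - f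
  in the second.\<close>

lemma inv_helmholtz_deriv:
  assumes f: "continuous_on UNIV f" and b: "\<And>y. \<bar>f y\<bar> \<le> B"
  shows "(inv_helmholtz f has_real_derivative helmholtz_deriv f x) (at x)"
    and "(helmholtz_deriv f has_real_derivative inv_helmholtz f x - f x) (at x)"
proof -
  define R where "R = (\<lambda>x. left_exp_integral (\<lambda>y. f (- y)) (- x))"
  have f': "continuous_on UNIV (\<lambda>y. f (- y))"
    by (rule continuous_on_compose2[OF f]) (auto intro: continuous_intros)
  have L: "(left_exp_integral f has_real_derivative exp x * f x) (at x)"
    by (rule left_exp_integral_deriv[OF f b])
  have "((\<lambda>x. left_exp_integral (\<lambda>y. f (- y)) (- x)) has_real_derivative (exp (- x) * f (- (- x))) * (- 1)) (at x)"
    by (rule DERIV_chain2[OF left_exp_integral_deriv[OF f' b]]) (auto intro!: derivative_eq_intros)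
  then have R: "(R has_real_derivative - (exp (- x) * f x)) (at x)" by (simp add: R_def)
  have k: "exp x * f x * exp (- x) = f x" "exp (- x) * f x * exp x = f x"
    by (simp_all add: exp_minus field_simps)
  have d: "inv_helmholtz f = (\<lambda>x. (exp (- x) * left_exp_integral f x + exp x * R x) / 2)"
    "helmholtz_deriv f = (\<lambda>x. (- exp (- x) * left_exp_integral f x + exp x * R x) / 2)"
    unfolding R_def by (rule ext, rule helmholtz_decomp[OF f b])+
  have 1: "((\<lambda>x. exp (- x) * left_exp_integral f x) has_real_derivative f x - exp (- x) * left_exp_integral f x) (at x)"
    by (rule derivative_eq_intros L refl)+ (simp add: k)
  have 2: "((\<lambda>x. exp x * R x) has_real_derivative exp x * R x - f x) (at x)"
    by (rule derivative_eq_intros R refl)+ (simp add: k)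
  have "((\<lambda>x. (exp (- x) * left_exp_integral f x + exp x * R x) / 2) has_real_derivative helmholtz_deriv f x) (at x)"
    unfolding d(2) by (rule DERIV_cong[OF DERIV_cdivide[OF DERIV_add[OF 1 2]]]) simp
  then show "(inv_helmholtz f has_real_derivative helmholtz_deriv f x) (at x)"
    unfolding d(1) .
  have "((\<lambda>x. (- (exp (- x) * left_exp_integral f x) + exp x * R x) / 2) has_real_derivative inv_helmholtz f x - f x) (at x)"
    unfolding d(1) by (rule DERIV_cong[OF DERIV_cdivide[OF DERIV_add[OF DERIV_minus[OF 1] 2]]]) (simp add: field_simps)
  then show "(helmholtz_deriv f has_real_derivative inv_helmholtz f x - f x) (at x)"
    unfolding d(2) by simp
qed

section \<open>Transport along characteristics\<close>

text \<open>The value is prescribed at the final time because points are traced back to time 0.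
  Measuring differences in the weight exp(2 l (t0 - \<tau>)) makes every Picard step gain a factor
  1/2 on the whole interval, so no short-time solutions have to be glued together.\<close>

lemma picard_backward:
  fixes G :: "real \<Rightarrow> real \<Rightarrow> real"
  assumes t0: "0 \<le> t0" and G: "continuous_on ({0..t0} \<times> UNIV) (\<lambda>(t, x). G t x)"
    and K: "\<And>t x. t \<in> {0..t0} \<Longrightarrow> \<bar>G t x\<bar> \<le> K"
    and L: "\<And>t x y. t \<in> {0..t0} \<Longrightarrow> \<bar>G t x - G t y\<bar> \<le> L * \<bar>x - y\<bar>"
  obtains q where "q t0 = x0" "\<And>t. t \<in> {0..t0} \<Longrightarrow> (q has_real_derivative G t (q t)) (at t within {0..t0})"
proof -
  \<comment> \<open>The maximum keeps the Lipschitz constant positive.\<close>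
  define l where "l = max L 1"
  define \<Phi> where "\<Phi> = (\<lambda>p \<tau>. x0 - integral {\<tau>..t0} (\<lambda>\<sigma>. G \<sigma> (p \<sigma>)))"
  define q where "q = rec_nat (\<lambda>_. x0) (\<lambda>_. \<Phi>)"
  have q0: "q 0 = (\<lambda>_. x0)" and qS: "q (Suc k) = \<Phi> (q k)" for k by (auto simp: q_def)
  have l: "l \<ge> 1" "\<And>t x y. t \<in> {0..t0} \<Longrightarrow> \<bar>G t x - G t y\<bar> \<le> l * \<bar>x - y\<bar>"
  proof -
    show "l \<ge> 1" by (simp add: l_def)
    fix t x y :: real assume t: "t \<in> {0..t0}"
    have "L * \<bar>x - y\<bar> \<le> l * \<bar>x - y\<bar>" unfolding l_def by (intro mult_right_mono) auto
    with L[OF t] show "\<bar>G t x - G t y\<bar> \<le> l * \<bar>x - y\<bar>" by (rule order_trans)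
  qed
  have K0: "K \<ge> 0" using K[of 0 0] t0 by auto
  have Gc: "continuous_on {0..t0} (\<lambda>\<sigma>. G \<sigma> (p \<sigma>))" if "continuous_on {0..t0} p" for p
  proof -
    have "continuous_on {0..t0} (\<lambda>\<sigma>. (\<sigma>, p \<sigma>))" using that by (intro continuous_intros)
    from continuous_on_compose2[OF G this] show ?thesis by auto
  qed
  have Gi: "(\<lambda>\<sigma>. G \<sigma> (p \<sigma>)) integrable_on {a..b}"
    if "continuous_on {0..t0} p" "0 \<le> a" "b \<le> t0" for p a b
    by (rule integrable_continuous_interval, rule continuous_on_subset[OF Gc[OF that(1)]]) (use that in auto)
  have \<Phi>d: "(\<Phi> p has_real_derivative G \<tau> (p \<tau>)) (at \<tau> within {0..t0})"
    if p: "continuous_on {0..t0} p" and \<tau>: "\<tau> \<in> {0..t0}" for p \<tau>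
  proof -
    define g where "g = (\<lambda>\<sigma>. G \<sigma> (p \<sigma>))"
    have "((\<lambda>\<tau>. (x0 - integral {0..t0} g) + integral {0..\<tau>} g) has_real_derivative g \<tau>) (at \<tau> within {0..t0})"
      using integral_has_real_derivative[OF Gc[OF p] \<tau>, folded g_def] by (auto intro!: derivative_eq_intros simp: g_def)
    then have "(\<Phi> p has_real_derivative g \<tau>) (at \<tau> within {0..t0})"
    proof (rule has_field_derivative_transform_within[OF _ zero_less_one \<tau>])
      fix \<sigma> assume \<sigma>: "\<sigma> \<in> {0..t0}"
      have "integral {0..\<sigma>} g + integral {\<sigma>..t0} g = integral {0..t0} g"
        by (rule Henstock_Kurzweil_Integration.integral_combine) (use \<sigma> Gi[OF p, of 0 t0] in \<open>auto simp: g_def\<close>)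
      then show "(x0 - integral {0..t0} g) + integral {0..\<sigma>} g = \<Phi> p \<sigma>"
        by (simp add: \<Phi>_def g_def)
    qed
    then show ?thesis by (simp add: g_def)
  qed
  have qc: "continuous_on {0..t0} (q k)" for k
  proof (induction k)
    case 0
    then show ?case by (simp add: q0)
  next
    case (Suc k)
    show ?case unfolding qS by (rule DERIV_continuous_on[OF \<Phi>d[OF Suc]])
  qed
  define C where "C = t0 * K"
  have C: "C \<ge> 0" using t0 K0 by (simp add: C_def)
  \<comment> \<open>The gain 1/2 is the quotient of the Lipschitz constant l by the rate 2 l, which
    appears when the exponential is integrated; \<open>A\<close> below is the antiderivative. The
    first difference is at most t0 K, whence C.\<close>
  have est: "\<bar>q (Suc k) \<tau> - q k \<tau>\<bar> \<le> C * (1 / 2) ^ k * exp (2 * l * (t0 - \<tau>))" if "\<tau> \<in> {0..t0}" for k \<tau>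
    using that
  proof (induction k arbitrary: \<tau>)
    case 0
    have "norm (integral {\<tau>..t0} (\<lambda>\<sigma>. G \<sigma> (q 0 \<sigma>))) \<le> K * (t0 - \<tau>)"
      by (rule integral_bound, use 0 in simp, rule continuous_on_subset[OF Gc[OF qc]]) (use 0 K in auto)
    also have "\<dots> \<le> C" unfolding C_def using 0 K0 by (simp add: mult.commute mult_left_mono)
    also have "\<dots> \<le> C * exp (2 * l * (t0 - \<tau>))" using C 0 l by (simp add: mult_le_cancel_left1)
    finally show ?case by (simp add: qS \<Phi>_def q0)
  next
    case (Suc k)
    have "q (Suc (Suc k)) \<tau> - q (Suc k) \<tau> = integral {\<tau>..t0} (\<lambda>\<sigma>. G \<sigma> (q k \<sigma>)) - integral {\<tau>..t0} (\<lambda>\<sigma>. G \<sigma> (q (Suc k) \<sigma>))"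
      by (simp add: qS[of "Suc k"] \<Phi>_def) (simp add: qS \<Phi>_def)
    also have "\<dots> = integral {\<tau>..t0} (\<lambda>\<sigma>. G \<sigma> (q k \<sigma>) - G \<sigma> (q (Suc k) \<sigma>))"
      using Suc.prems by (intro Henstock_Kurzweil_Integration.integral_diff[symmetric] Gi qc) auto
    finally have 1: "q (Suc (Suc k)) \<tau> - q (Suc k) \<tau> = \<dots>" .
    define A where "A = (\<lambda>\<sigma>. - (C * (1 / 2) ^ Suc k) * exp (2 * l * (t0 - \<sigma>)))"
    have hi: "((\<lambda>\<sigma>. l * (C * (1 / 2) ^ k * exp (2 * l * (t0 - \<sigma>)))) has_integral (A t0 - A \<tau>)) {\<tau>..t0}"
    proof (rule fundamental_theorem_of_calculus)
      fix \<sigma> assume "\<sigma> \<in> {\<tau>..t0}"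
      have "(A has_real_derivative l * (C * (1 / 2) ^ k * exp (2 * l * (t0 - \<sigma>)))) (at \<sigma> within {\<tau>..t0})"
        unfolding A_def by (rule derivative_eq_intros refl | simp)+
      then show "(A has_vector_derivative l * (C * (1 / 2) ^ k * exp (2 * l * (t0 - \<sigma>)))) (at \<sigma> within {\<tau>..t0})"
        by (simp add: has_real_derivative_iff_has_vector_derivative)
    qed (use Suc.prems in auto)
    have "norm (integral {\<tau>..t0} (\<lambda>\<sigma>. G \<sigma> (q k \<sigma>) - G \<sigma> (q (Suc k) \<sigma>)))
       \<le> integral {\<tau>..t0} (\<lambda>\<sigma>. l * (C * (1 / 2) ^ k * exp (2 * l * (t0 - \<sigma>))))"
    proof (rule integral_norm_bound_integral)
      show "(\<lambda>\<sigma>. G \<sigma> (q k \<sigma>) - G \<sigma> (q (Suc k) \<sigma>)) integrable_on {\<tau>..t0}"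
        using Suc.prems by (intro integrable_diff Gi qc) auto
      show "(\<lambda>\<sigma>. l * (C * (1 / 2) ^ k * exp (2 * l * (t0 - \<sigma>)))) integrable_on {\<tau>..t0}"
        using hi by (rule has_integral_integrable)
      fix \<sigma> assume "\<sigma> \<in> {\<tau>..t0}"
      then have \<sigma>: "\<sigma> \<in> {0..t0}" using Suc.prems by auto
      have "norm (G \<sigma> (q k \<sigma>) - G \<sigma> (q (Suc k) \<sigma>)) \<le> l * \<bar>q k \<sigma> - q (Suc k) \<sigma>\<bar>"
        using l(2)[OF \<sigma>] by simp
      also have "\<dots> \<le> l * (C * (1 / 2) ^ k * exp (2 * l * (t0 - \<sigma>)))"
        using Suc.IH[OF \<sigma>] l(1) by (intro mult_left_mono) (auto simp: abs_minus_commute)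
      finally show "norm (G \<sigma> (q k \<sigma>) - G \<sigma> (q (Suc k) \<sigma>)) \<le> l * (C * (1 / 2) ^ k * exp (2 * l * (t0 - \<sigma>)))" .
    qed
    also have "\<dots> = A t0 - A \<tau>" using hi by (rule integral_unique)
    also have "\<dots> \<le> C * (1 / 2) ^ Suc k * exp (2 * l * (t0 - \<tau>))"
      using C by (simp add: A_def)
    finally show ?case unfolding 1 by simp
  qed
  have ul: "uniform_limit {0..t0} (\<lambda>n x. \<Sum>i<n. q (Suc i) x - q i x) (\<lambda>x. suminf (\<lambda>i. q (Suc i) x - q i x)) sequentially"
  proof (rule Weierstrass_m_test)
    show "summable (\<lambda>k. C * exp (2 * l * t0) * (1 / 2) ^ k)" by (intro summable_mult summable_geometric) simp
    fix k \<tau> assume \<tau>: "\<tau> \<in> {0..t0}"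
    have "norm (q (Suc k) \<tau> - q k \<tau>) \<le> C * (1 / 2) ^ k * exp (2 * l * (t0 - \<tau>))" using est[OF \<tau>] by simp
    also have "\<dots> \<le> C * (1 / 2) ^ k * exp (2 * l * t0)"
      using C l \<tau> by (intro mult_left_mono) auto
    finally show "norm (q (Suc k) \<tau> - q k \<tau>) \<le> C * exp (2 * l * t0) * (1 / 2) ^ k" by (simp add: mult_ac)
  qed
  define Q where "Q = (\<lambda>x. x0 + suminf (\<lambda>i. q (Suc i) x - q i x))"
  have "uniform_limit {0..t0} (\<lambda>n x. x0 + (\<Sum>i<n. q (Suc i) x - q i x)) Q sequentially"
    unfolding Q_def by (intro uniform_limit_intros ul)
  moreover have "x0 + (\<Sum>i<n. q (Suc i) x - q i x) = q n x" for n x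
    using sum_lessThan_telescope[of "\<lambda>i. q i x" n] by (simp add: q0)
  ultimately have uq: "uniform_limit {0..t0} q Q sequentially" by simp
  have Qc: "continuous_on {0..t0} Q"
    by (rule uniform_limit_theorem[OF _ uq]) (auto simp: qc)
  have ql: "(\<lambda>n. q n \<tau>) \<longlonglongrightarrow> Q \<tau>" if "\<tau> \<in> {0..t0}" for \<tau>
    by (rule tendsto_uniform_limitI[OF uq that])
  have fixpoint: "Q \<tau> = \<Phi> Q \<tau>" if \<tau>: "\<tau> \<in> {0..t0}" for \<tau>
  proof (rule LIMSEQ_unique)
    show "(\<lambda>n. q (Suc n) \<tau>) \<longlonglongrightarrow> Q \<tau>" using ql[OF \<tau>] by (rule LIMSEQ_Suc)
    have "(\<lambda>n. integral {\<tau>..t0} (\<lambda>\<sigma>. G \<sigma> (q n \<sigma>))) \<longlonglongrightarrow> integral {\<tau>..t0} (\<lambda>\<sigma>. G \<sigma> (Q \<sigma>))"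
    proof (rule dominated_convergence(2)[where h="\<lambda>_. K"])
      show "(\<lambda>\<sigma>. G \<sigma> (q n \<sigma>)) integrable_on {\<tau>..t0}" for n by (rule Gi) (use qc \<tau> in auto)
      show "norm (G \<sigma> (q n \<sigma>)) \<le> K" if "\<sigma> \<in> {\<tau>..t0}" for n \<sigma> using K that \<tau> by auto
      fix \<sigma> assume "\<sigma> \<in> {\<tau>..t0}"
      then have \<sigma>: "\<sigma> \<in> {0..t0}" using \<tau> by auto
      have p: "continuous_on UNIV (\<lambda>x. (\<sigma>, x))" by (intro continuous_intros)
      have "range (\<lambda>x. (\<sigma>, x)) \<subseteq> {0..t0} \<times> UNIV" using \<sigma> by auto
      from continuous_on_compose2[OF G p this] have "continuous_on UNIV (G \<sigma>)" by simp
      then show "(\<lambda>n. G \<sigma> (q n \<sigma>)) \<longlonglongrightarrow> G \<sigma> (Q \<sigma>)"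
        by (rule continuous_on_tendsto_compose[OF _ ql[OF \<sigma>]]) auto
    qed auto
    then show "(\<lambda>n. q (Suc n) \<tau>) \<longlonglongrightarrow> \<Phi> Q \<tau>"
      unfolding qS \<Phi>_def by (intro tendsto_intros)
  qed
  show thesis
  proof (rule that)
    show "Q t0 = x0" using fixpoint[of t0] t0 by (simp add: \<Phi>_def)
    fix t assume t: "t \<in> {0..t0}"
    show "(Q has_real_derivative G t (Q t)) (at t within {0..t0})"
      by (rule has_field_derivative_transform_within[OF \<Phi>d[OF Qc t] zero_less_one t]) (simp add: fixpoint)
  qed
qed

text \<open>Total differentiability follows from the two partial derivatives if one of them is
  jointly continuous. That role falls to the derivative in x, so the derivative in t enters only
  pointwise. The set \<open>J\<close> will be {0..t0}, on which a characteristic is defined.\<close>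

lemma has_real_derivative_along_path:
  fixes f :: "real \<Rightarrow> real \<Rightarrow> real"
  assumes fx: "\<And>t x. t \<in> I \<Longrightarrow> (f t has_real_derivative fx t x) (at x)"
    and ft: "\<And>t x. t \<in> I \<Longrightarrow> ((\<lambda>r. f r x) has_real_derivative ft t x) (at t within I)"
    and c: "continuous_on (I \<times> UNIV) (\<lambda>(t, x). fx t x)"
    and J: "J \<subseteq> I" "t \<in> J" and q: "(q has_real_derivative q') (at t within J)"
  shows "((\<lambda>r. f r (q r)) has_real_derivative ft t (q t) + fx t (q t) * q') (at t within J)"
proof -
  have t: "t \<in> I" using J by auto
  have "((\<lambda>(r, x). f r x) has_derivative (\<lambda>(h, k). ft t (q t) * h + blinfun_mult_right (fx t (q t)) k))
      (at (t, q t) within I \<times> UNIV)"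
  proof (rule has_derivative_partialsI)
    show "((\<lambda>r. f r (q t)) has_derivative (*) (ft t (q t))) (at t within I)"
      using ft[OF t] by (simp add: has_field_derivative_def)
    show "((\<lambda>x. f r x) has_derivative blinfun_apply (blinfun_mult_right (fx r x))) (at x within UNIV)" if "r \<in> I" for r x
      using fx[OF that] by (simp add: has_field_derivative_def blinfun_mult_right.rep_eq)
    have "continuous_on (I \<times> UNIV) (\<lambda>z. blinfun_mult_right ((\<lambda>(r, x). fx r x) z))"
      by (intro bounded_linear.continuous_on[OF bounded_linear_blinfun_mult_right] c)
    then show "continuous (at (t, q t) within I \<times> UNIV) (\<lambda>(r, x). blinfun_mult_right (fx r x))"
      using t unfolding continuous_on_eq_continuous_within case_prod_unfold by auto
  qed auto
  then have "((\<lambda>(r, x). f r x) has_derivative (\<lambda>(h, k). ft t (q t) * h + fx t (q t) * k))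
      (at (t, q t) within I \<times> UNIV)"
    by (simp add: blinfun_mult_right.rep_eq)
  then have 1: "((\<lambda>(r, x). f r x) has_derivative (\<lambda>(h, k). ft t (q t) * h + fx t (q t) * k))
      (at (t, q t) within (\<lambda>r. (r, q r)) ` J)"
    by (rule has_derivative_subset) (use J in auto)
  have 2: "((\<lambda>r. (r, q r)) has_derivative (\<lambda>h. (h, q' * h))) (at t within J)"
    using q by (intro has_derivative_Pair) (auto simp: has_field_derivative_def)
  have "((\<lambda>r. case (r, q r) of (r, x) \<Rightarrow> f r x) has_derivative
      (\<lambda>h. case (h, q' * h) of (h, k) \<Rightarrow> ft t (q t) * h + fx t (q t) * k)) (at t within J)"
    by (rule has_derivative_in_compose[OF 2 1])
  then show ?thesis
    by (simp add: has_field_derivative_def algebra_simps)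
       (erule has_derivative_eq_rhs, simp add: fun_eq_iff algebra_simps)
qed

section \<open>The nonlinear source and the pointwise form of a solution\<close>

definition source :: "nat \<Rightarrow> (real \<Rightarrow> real) \<Rightarrow> (real \<Rightarrow> real) \<Rightarrow> real \<Rightarrow> real" where
  "source n f g y = real n / 2 * f y ^ (n - 1) * (g y)\<^sup>2
     + real n * (real n + 3) / (2 * (real n + 1)) * f y ^ (n + 1)"

definition source_const :: "nat \<Rightarrow> real" where
  "source_const n = real n / 2 + real n * (real n + 3) / (2 * (real n + 1))"

lemma source_const_nonneg: "source_const n \<ge> 0"
  by (simp add: source_const_def)

lemma power_product_le:
  fixes a b :: real
  assumes "n \<ge> 1"
  shows "\<bar>a ^ (n - 1) * b\<^sup>2\<bar> \<le> (\<bar>a\<bar> + \<bar>b\<bar>) ^ (n + 1)"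
proof -
  have "\<bar>a ^ (n - 1) * b\<^sup>2\<bar> = \<bar>a\<bar> ^ (n - 1) * \<bar>b\<bar> ^ 2" by (simp add: abs_mult power_abs)
  also have "\<dots> \<le> (\<bar>a\<bar> + \<bar>b\<bar>) ^ (n - 1) * (\<bar>a\<bar> + \<bar>b\<bar>) ^ 2"
    by (intro mult_mono power_mono) auto
  also have "\<dots> = (\<bar>a\<bar> + \<bar>b\<bar>) ^ (n - 1 + 2)" by (rule power_add[symmetric])
  also have "n - 1 + 2 = n + 1" using assms by simp
  finally show ?thesis .
qed

lemma source_bound:
  assumes n: "n \<ge> 1"
  shows "\<bar>source n f g y\<bar> \<le> source_const n * (\<bar>f y\<bar> + \<bar>g y\<bar>) ^ (n + 1)"
proof -
  define S where "S = (\<bar>f y\<bar> + \<bar>g y\<bar>) ^ (n + 1)"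
  define c where "c = real n * (real n + 3) / (2 * (real n + 1))"
  have c: "c \<ge> 0" by (simp add: c_def)
  have 1: "\<bar>f y ^ (n - 1) * (g y)\<^sup>2\<bar> \<le> S" unfolding S_def by (rule power_product_le[OF n])
  have 2: "\<bar>f y ^ (n + 1)\<bar> \<le> S" unfolding S_def power_abs by (intro power_mono) auto
  have "\<bar>source n f g y\<bar> \<le> \<bar>real n / 2 * (f y ^ (n - 1) * (g y)\<^sup>2)\<bar> + \<bar>c * f y ^ (n + 1)\<bar>"
    unfolding source_def c_def[symmetric] mult.assoc by (rule abs_triangle_ineq)
  also have "\<dots> = real n / 2 * \<bar>f y ^ (n - 1) * (g y)\<^sup>2\<bar> + c * \<bar>f y ^ (n + 1)\<bar>"
    using c by (simp add: abs_mult)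
  also have "\<dots> \<le> real n / 2 * S + c * S"
    using 1 2 c by (intro add_mono mult_left_mono) auto
  finally show ?thesis by (simp add: S_def c_def source_const_def algebra_simps)
qed

text \<open>Everything that the dynamics uses of a Sobolev solution, in classical form.
  Characteristics exist by \<open>cont_u\<close> and the Lipschitz bound that \<open>bound\<close>
  gives; the chain rule along them rests on \<open>cont_ux\<close>.\<close>

locale transport_solution =
  fixes n :: nat and T M :: real and u ux ut :: "real \<Rightarrow> real \<Rightarrow> real"
  assumes n: "n \<ge> 1" and T: "T > 0"
    and deriv_x: "\<And>t x. t \<in> {0..T} \<Longrightarrow> (u t has_real_derivative ux t x) (at x)"
    and deriv_t: "\<And>t x. t \<in> {0..T} \<Longrightarrow> ((\<lambda>r. u r x) has_real_derivative ut t x) (at t within {0..T})"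
    and cont_u: "continuous_on ({0..T} \<times> UNIV) (\<lambda>(t, x). u t x)"
    and cont_ux: "continuous_on ({0..T} \<times> UNIV) (\<lambda>(t, x). ux t x)"
    and bound: "\<And>t x. t \<in> {0..T} \<Longrightarrow> \<bar>u t x\<bar> + \<bar>ux t x\<bar> \<le> M"
    and eqn: "\<And>t x. t \<in> {0..T} \<Longrightarrow>
      ut t x + u t x ^ n * ux t x + helmholtz_deriv (source n (u t) (ux t)) x = 0"
begin

abbreviation "F t \<equiv> source n (u t) (ux t)"
abbreviation "s t x \<equiv> \<bar>u t x\<bar> + \<bar>ux t x\<bar>"

text \<open>Minus the source in the equation for \<open>u\<^sub>x\<close> along characteristics; it equals
  \<open>n u\<^sup>n\<^sup>-\<^sup>1 u\<^sub>x\<^sup>2 + \<partial>\<^sub>x\<^sup>2 (1 - \<partial>\<^sub>x\<^sup>2)\<^sup>-\<^sup>1 F\<close>.\<close>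

definition R :: "real \<Rightarrow> real \<Rightarrow> real" where
  "R t x = real n * u t x ^ (n - 1) * (ux t x)\<^sup>2 + (inv_helmholtz (F t) x - F t x)"

lemma M_nonneg: "M \<ge> 0"
proof -
  have "s 0 0 \<le> M" using T by (intro bound) auto
  then show ?thesis by linarith
qed

lemma cont_x:
  assumes "t \<in> {0..T}"
  shows "continuous_on UNIV (u t)" "continuous_on UNIV (ux t)" "continuous_on UNIV (F t)"
proof -
  have p: "continuous_on UNIV (\<lambda>x. (t, x))" by (intro continuous_intros)
  have im: "range (\<lambda>x. (t, x)) \<subseteq> {0..T} \<times> UNIV" using assms by auto
  show c: "continuous_on UNIV (u t)" "continuous_on UNIV (ux t)"
    using continuous_on_compose2[OF cont_u p im] continuous_on_compose2[OF cont_ux p im] by simp_all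
  show "continuous_on UNIV (F t)"
    unfolding source_def[abs_def] by (intro continuous_intros c)
qed

lemma F_bound:
  assumes t: "t \<in> {0..T}"
  shows "\<bar>F t x\<bar> \<le> source_const n * M ^ (n + 1)"
proof -
  have "s t x ^ (n + 1) \<le> M ^ (n + 1)" by (intro power_mono bound[OF t]) auto
  then have "source_const n * s t x ^ (n + 1) \<le> source_const n * M ^ (n + 1)"
    by (intro mult_left_mono source_const_nonneg)
  then show ?thesis using source_bound[OF n, of "u t" "ux t" x] by linarith
qed

lemma power_n_lipschitz:
  assumes t: "t \<in> {0..T}"
  shows "\<bar>u t x ^ n - u t y ^ n\<bar> \<le> real n * M ^ n * \<bar>x - y\<bar>"
proof -
  have d: "((\<lambda>x. u t x ^ n) has_real_derivative real n * u t x ^ (n - 1) * ux t x) (at x)" for x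
    by (rule derivative_eq_intros deriv_x[OF t] refl)+ simp
  have b: "\<bar>real n * u t x ^ (n - 1) * ux t x\<bar> \<le> real n * M ^ n" for x
  proof -
    have "\<bar>u t x\<bar> \<le> M" "\<bar>ux t x\<bar> \<le> M" using bound[OF t, of x] by linarith+
    then have "\<bar>u t x\<bar> ^ (n - 1) * \<bar>ux t x\<bar> \<le> M ^ (n - 1) * M"
      by (intro mult_mono power_mono) (use M_nonneg in auto)
    also have "\<dots> = M ^ n" using n by (simp add: power_eq_if)
    finally have "real n * (\<bar>u t x\<bar> ^ (n - 1) * \<bar>ux t x\<bar>) \<le> real n * M ^ n" by (intro mult_left_mono) auto
    then show ?thesis by (simp add: abs_mult power_abs mult.assoc)
  qed
  show ?thesis
    using field_differentiable_bound[of UNIV "\<lambda>x. u t x ^ n" "\<lambda>x. real n * u t x ^ (n - 1) * ux t x" "real n * M ^ n" x y] d b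
    by auto
qed

text \<open>The derivative is the difference of a nonlocal term and F, each at most the supremum
  bound of F (take the weight 1 with \<eta> = 0). The estimate dominates the difference quotients in
  \<open>duhamel_ux\<close>.\<close>

lemma helmholtz_deriv_lipschitz:
  assumes t: "t \<in> {0..T}"
  shows "\<bar>helmholtz_deriv (F t) x - helmholtz_deriv (F t) y\<bar> \<le> 2 * source_const n * M ^ (n + 1) * \<bar>x - y\<bar>"
proof -
  define B where "B = source_const n * M ^ (n + 1)"
  have B: "B \<ge> 0" unfolding B_def by (intro mult_nonneg_nonneg source_const_nonneg zero_le_power M_nonneg)
  have F: "\<bar>F t x\<bar> \<le> B" for x unfolding B_def by (rule F_bound[OF t])
  have b: "\<bar>inv_helmholtz (F t) x - F t x\<bar> \<le> 2 * B" for x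
  proof -
    have "\<bar>inv_helmholtz (F t) x\<bar> \<le> B * 1 / (1 - 0)"
      by (rule helmholtz_weight_bound(1)[where w="\<lambda>_. 1"]) (use F B in auto)
    then have "\<bar>inv_helmholtz (F t) x\<bar> \<le> B" by simp
    then show ?thesis using F[of x] by linarith
  qed
  have "\<bar>helmholtz_deriv (F t) x - helmholtz_deriv (F t) y\<bar> \<le> 2 * B * \<bar>x - y\<bar>"
    using field_differentiable_bound[of UNIV "helmholtz_deriv (F t)" "\<lambda>x. inv_helmholtz (F t) x - F t x" "2 * B" x y]
      inv_helmholtz_deriv(2)[OF cont_x(3)[OF t] F] b by auto
  then show ?thesis by (simp add: B_def mult_ac)
qed

lemma characteristic:
  assumes t0: "t0 \<in> {0..T}"
  obtains q where "q t0 = x0"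
    "\<And>t. t \<in> {0..t0} \<Longrightarrow> (q has_real_derivative u t (q t) ^ n) (at t within {0..t0})"
proof (rule picard_backward[of t0 "\<lambda>t x. u t x ^ n" "M ^ n" "real n * M ^ n" x0])
  have "continuous_on ({0..T} \<times> UNIV) (\<lambda>z. (case z of (t, x) \<Rightarrow> u t x) ^ n)"
    by (intro continuous_intros cont_u)
  then have "continuous_on ({0..T} \<times> UNIV) (\<lambda>(t, x). u t x ^ n)" by (simp add: case_prod_unfold)
  then show "continuous_on ({0..t0} \<times> UNIV) (\<lambda>(t, x). u t x ^ n)"
    by (rule continuous_on_subset) (use t0 in auto)
  show "\<bar>u t x ^ n\<bar> \<le> M ^ n" if "t \<in> {0..t0}" for t x
  proof -
    have "\<bar>u t x\<bar> \<le> M" using bound[of t x] that t0 by auto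
    then show ?thesis unfolding power_abs by (intro power_mono) auto
  qed
  show "\<bar>u t x ^ n - u t y ^ n\<bar> \<le> real n * M ^ n * \<bar>x - y\<bar>" if "t \<in> {0..t0}" for t x y
    by (rule power_n_lipschitz) (use that t0 in auto)
qed (use t0 that in auto)

section \<open>Integrated equations along a characteristic\<close>

context
  fixes t0 :: real and q :: "real \<Rightarrow> real"
  assumes t0: "t0 \<in> {0..T}"
    and q: "\<And>t. t \<in> {0..t0} \<Longrightarrow> (q has_real_derivative u t (q t) ^ n) (at t within {0..t0})"
begin

lemma in_T: "t \<in> {0..t0} \<Longrightarrow> t \<in> {0..T}"
  using t0 by auto

lemma u_along_path:
  assumes "t \<in> {0..t0}" "(p has_real_derivative p') (at t within {0..t0})"
  shows "((\<lambda>r. u r (p r)) has_real_derivative ut t (p t) + ux t (p t) * p') (at t within {0..t0})"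
  using in_T by (intro has_real_derivative_along_path[where I="{0..T}", OF deriv_x deriv_t cont_ux _ assms]) auto

lemma duhamel_u:
  "((\<lambda>t. helmholtz_deriv (F t) (q t)) has_integral (u 0 (q 0) - u t0 (q t0))) {0..t0}"
proof -
  have "((\<lambda>t. helmholtz_deriv (F t) (q t)) has_integral (- u t0 (q t0) - - u 0 (q 0))) {0..t0}"
  proof (rule fundamental_theorem_of_calculus)
    fix t assume t: "t \<in> {0..t0}"
    have "((\<lambda>t. - u t (q t)) has_real_derivative - (ut t (q t) + ux t (q t) * u t (q t) ^ n)) (at t within {0..t0})"
      by (intro DERIV_minus u_along_path t q)
    also have "- (ut t (q t) + ux t (q t) * u t (q t) ^ n) = helmholtz_deriv (F t) (q t)"
      using eqn[OF in_T[OF t], of "q t"] by (simp add: mult.commute)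
    finally show "((\<lambda>t. - u t (q t)) has_vector_derivative helmholtz_deriv (F t) (q t)) (at t within {0..t0})"
      by (simp add: has_real_derivative_iff_has_vector_derivative)
  qed (use t0 in auto)
  then show ?thesis by simp
qed

text \<open>Since \<open>u\<^sub>x\<^sub>x\<close> need not exist, the equation for \<open>u\<^sub>x\<close> is obtained from the difference quotient
  of \<open>u\<close> in \<open>x\<close>, transported along the one characteristic \<open>q\<close>: the terms that would need \<open>u\<^sub>x\<^sub>x\<close>
  cancel before the limit is taken.\<close>

lemma duhamel_ux:
  "((\<lambda>t. R t (q t)) has_integral (ux 0 (q 0) - ux t0 (q t0))) {0..t0}"
proof -
  define h where "h = (\<lambda>k. inverse (real (Suc k)))"
  have h: "h k > 0" for k by (simp add: h_def)
  have h0: "h \<longlonglongrightarrow> 0" unfolding h_def by (rule LIMSEQ_inverse_real_of_nat)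
  have ha: "filterlim h (at 0) sequentially"
    using h0 h by (auto simp: filterlim_at less_imp_neq[symmetric])
  define W where "W = (\<lambda>k t. (u t (q t + h k) - u t (q t)) / h k)"
  define D where "D = (\<lambda>k t. (ux t (q t + h k) * (u t (q t + h k) ^ n - u t (q t) ^ n)
     + (helmholtz_deriv (F t) (q t + h k) - helmholtz_deriv (F t) (q t))) / h k)"
  have D: "(D k has_integral (- W k t0 - - W k 0)) {0..t0}" for k
  proof (rule fundamental_theorem_of_calculus)
    fix t assume t: "t \<in> {0..t0}"
    \<comment> \<open>The shifted curve is not a characteristic: it moves with the speed at q, not
      at q + h. Hence the difference of \<open>u ^ n\<close> at the two points survives in
      \<open>D\<close>, multiplied by u_x, and its quotient by h has the limit n u^(n-1)
      u_x.\<close>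
    have qh: "((\<lambda>t. q t + h k) has_real_derivative u t (q t) ^ n) (at t within {0..t0})"
      using q[OF t] by (auto intro!: derivative_eq_intros)
    have "((\<lambda>t. - W k t) has_real_derivative
      - (((ut t (q t + h k) + ux t (q t + h k) * u t (q t) ^ n) - (ut t (q t) + ux t (q t) * u t (q t) ^ n)) / h k)) (at t within {0..t0})"
      unfolding W_def by (intro DERIV_minus DERIV_cdivide DERIV_diff u_along_path t q qh)
    also have "- (((ut t (q t + h k) + ux t (q t + h k) * u t (q t) ^ n) - (ut t (q t) + ux t (q t) * u t (q t) ^ n)) / h k) = D k t"
    proof -
      have "ut t (q t + h k) = - (u t (q t + h k) ^ n * ux t (q t + h k)) - helmholtz_deriv (F t) (q t + h k)"
        "ut t (q t) = - (u t (q t) ^ n * ux t (q t)) - helmholtz_deriv (F t) (q t)"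
        using eqn[OF in_T[OF t], of "q t"] eqn[OF in_T[OF t], of "q t + h k"] by linarith+
      then have "- ((ut t (q t + h k) + ux t (q t + h k) * u t (q t) ^ n) - (ut t (q t) + ux t (q t) * u t (q t) ^ n))
        = ux t (q t + h k) * (u t (q t + h k) ^ n - u t (q t) ^ n) + (helmholtz_deriv (F t) (q t + h k) - helmholtz_deriv (F t) (q t))"
        by (simp add: algebra_simps)
      then show ?thesis unfolding D_def by (simp only: minus_divide_left)
    qed
    finally show "((\<lambda>t. - W k t) has_vector_derivative D k t) (at t within {0..t0})"
      by (simp add: has_real_derivative_iff_has_vector_derivative)
  qed (use t0 in auto)
  have quot: "(\<lambda>k. (f (x + h k) - f x) / h k) \<longlonglongrightarrow> f'" if "(f has_real_derivative f') (at x)" for f f' x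
    using filterlim_compose[OF that[unfolded DERIV_def] ha] .
  define B where "B = real n * M ^ (n + 1) + 2 * source_const n * M ^ (n + 1)"
  have Db: "norm (D k t) \<le> B" if t: "t \<in> {0..t0}" for k t
  proof -
    note t' = in_T[OF t]
    have "\<bar>ux t (q t + h k)\<bar> \<le> M" using bound[OF t', of "q t + h k"] by linarith
    then have "\<bar>ux t (q t + h k) * (u t (q t + h k) ^ n - u t (q t) ^ n)\<bar> \<le> M * (real n * M ^ n * \<bar>q t + h k - q t\<bar>)"
      unfolding abs_mult by (intro mult_mono power_n_lipschitz t' M_nonneg) auto
    moreover have "\<bar>helmholtz_deriv (F t) (q t + h k) - helmholtz_deriv (F t) (q t)\<bar> \<le> 2 * source_const n * M ^ (n + 1) * \<bar>q t + h k - q t\<bar>"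
      by (rule helmholtz_deriv_lipschitz[OF t'])
    ultimately have "\<bar>ux t (q t + h k) * (u t (q t + h k) ^ n - u t (q t) ^ n)
     + (helmholtz_deriv (F t) (q t + h k) - helmholtz_deriv (F t) (q t))\<bar> \<le> B * h k"
      using h[of k] by (simp add: B_def algebra_simps)
    then show ?thesis using h[of k] by (simp add: D_def pos_divide_le_eq)
  qed
  have Dl: "(\<lambda>k. D k t) \<longlonglongrightarrow> R t (q t)" if t: "t \<in> {0..t0}" for t
  proof -
    note t' = in_T[OF t]
    have "(\<lambda>k. q t + h k) \<longlonglongrightarrow> q t" using tendsto_add[OF tendsto_const h0, of "q t"] by simp
    then have 1: "(\<lambda>k. ux t (q t + h k)) \<longlonglongrightarrow> ux t (q t)"
      by (rule continuous_on_tendsto_compose[OF cont_x(2)[OF t']]) auto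
    have 2: "(\<lambda>k. (u t (q t + h k) ^ n - u t (q t) ^ n) / h k) \<longlonglongrightarrow> real n * u t (q t) ^ (n - 1) * ux t (q t)"
      by (rule quot) (rule derivative_eq_intros deriv_x[OF t'] refl | simp)+
    have 3: "(\<lambda>k. (helmholtz_deriv (F t) (q t + h k) - helmholtz_deriv (F t) (q t)) / h k)
        \<longlonglongrightarrow> inv_helmholtz (F t) (q t) - F t (q t)"
      by (rule quot) (rule inv_helmholtz_deriv(2)[OF cont_x(3)[OF t'] F_bound[OF t']])
    have "(\<lambda>k. ux t (q t + h k) * ((u t (q t + h k) ^ n - u t (q t) ^ n) / h k)
        + (helmholtz_deriv (F t) (q t + h k) - helmholtz_deriv (F t) (q t)) / h k)
      \<longlonglongrightarrow> ux t (q t) * (real n * u t (q t) ^ (n - 1) * ux t (q t)) + (inv_helmholtz (F t) (q t) - F t (q t))"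
      by (intro tendsto_intros 1 2 3)
    then show ?thesis by (simp add: D_def R_def add_divide_distrib power2_eq_square mult_ac)
  qed
  have Di: "D k integrable_on {0..t0}" for k using D by (rule has_integral_integrable)
  have Bi: "(\<lambda>_. B) integrable_on {0..t0}" by (rule integrable_const_ivl)
  note i = dominated_convergence(1)[where f=D and g="\<lambda>t. R t (q t)", OF Di Bi Db Dl]
    and lim = dominated_convergence(2)[where f=D and g="\<lambda>t. R t (q t)", OF Di Bi Db Dl]
  have "(\<lambda>k. integral {0..t0} (D k)) \<longlonglongrightarrow> ux 0 (q 0) - ux t0 (q t0)"
  proof -
    have W: "(\<lambda>k. W k t) \<longlonglongrightarrow> ux t (q t)" if "t \<in> {0..T}" for t
      unfolding W_def by (rule quot[OF deriv_x[OF that]])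
    have "(\<lambda>k. - W k t0 - - W k 0) \<longlonglongrightarrow> - ux t0 (q t0) - - ux 0 (q 0)"
      by (intro tendsto_intros W) (use t0 in auto)
    moreover have "integral {0..t0} (D k) = - W k t0 - - W k 0" for k
      using D by (rule integral_unique)
    ultimately show ?thesis by simp
  qed
  with lim have "integral {0..t0} (\<lambda>t. R t (q t)) = ux 0 (q 0) - ux t0 (q t0)"
    by (rule LIMSEQ_unique)
  then show ?thesis using integrable_integral[OF i] by simp
qed

text \<open>The speed bound is asked only along the path itself, so that it can be used twice: with
  the crude bound \<open>M ^ n\<close>, and in \<open>asymptotics\<close> with one that decays like
  exp(-\<theta> x).\<close>

lemma path_displacement:
  assumes "\<And>t. t \<in> {0..t0} \<Longrightarrow> \<bar>u t (q t) ^ n\<bar> \<le> B" "t \<in> {0..t0}"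
  shows "\<bar>q t - q t0\<bar> \<le> B * T"
proof -
  have B: "B \<ge> 0" using assms abs_ge_zero order_trans by blast
  have "\<bar>q t - q t0\<bar> \<le> B * \<bar>t - t0\<bar>"
    using field_differentiable_bound[of "{0..t0}" q "\<lambda>t. u t (q t) ^ n" B t t0] q assms t0 by auto
  also have "\<dots> \<le> B * T" using assms(2) t0 B by (intro mult_left_mono) auto
  finally show ?thesis .
qed

end

section \<open>Weighted estimates and decay\<close>

text \<open>Every term is homogeneous of degree n + 1 in (u, u_x), so a weighted bound on the single
  quantity \<open>s t y ^ (n + 1)\<close> controls all of them. In \<open>C\<close> the bracket
  collects the local terms, and the quotient by 1 - \<eta> comes from the kernel.\<close>

lemma source_terms_bound:
  assumes t: "t \<in> {0..T}" and eta: "0 \<le> \<eta>" "\<eta> < 1" and K: "K \<ge> 0"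
    and sw: "\<And>y. s t y ^ (n + 1) \<le> K * w y" and w: "\<And>x y. w y \<le> exp (\<eta> * \<bar>x - y\<bar>) * w x"
  defines "C \<equiv> (source_const n + real n) + source_const n / (1 - \<eta>)"
  shows "\<bar>helmholtz_deriv (F t) x\<bar> \<le> C * K * w x" "\<bar>R t x\<bar> \<le> C * K * w x"
proof -
  have c: "source_const n \<ge> 0" by (rule source_const_nonneg)
  have Kw: "K * w y \<ge> 0" for y using order_trans[OF _ sw[of y]] by simp
  have F: "\<bar>F t y\<bar> \<le> source_const n * K * w y" for y
    using source_bound[OF n, of "u t" "ux t" y] mult_left_mono[OF sw[of y] c] by (simp add: mult.assoc)
  have H: "\<bar>inv_helmholtz (F t) x\<bar> \<le> source_const n * K * w x / (1 - \<eta>)"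
    "\<bar>helmholtz_deriv (F t) x\<bar> \<le> source_const n * K * w x / (1 - \<eta>)"
    by (rule helmholtz_weight_bound[OF eta(2) F w]; use c K in auto)+
  have C: "C * K * w x = (source_const n * K * w x + real n * (K * w x)) + source_const n * K * w x / (1 - \<eta>)"
    by (simp add: C_def field_simps)
  have p: "source_const n * K * w x \<ge> 0" "real n * (K * w x) \<ge> 0"
    using c Kw[of x] by (simp_all add: mult.assoc)
  show "\<bar>helmholtz_deriv (F t) x\<bar> \<le> C * K * w x" unfolding C using H(2) p by linarith
  have "\<bar>u t x ^ (n - 1) * (ux t x)\<^sup>2\<bar> \<le> K * w x"
    using power_product_le[OF n] sw[of x] by (rule order_trans)
  then have "real n * \<bar>u t x ^ (n - 1) * (ux t x)\<^sup>2\<bar> \<le> real n * (K * w x)" by (intro mult_left_mono) auto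
  then have "\<bar>real n * u t x ^ (n - 1) * (ux t x)\<^sup>2\<bar> \<le> real n * (K * w x)"
    by (simp add: abs_mult mult.assoc)
  then show "\<bar>R t x\<bar> \<le> C * K * w x" unfolding C R_def using H(1) F[of x] by linarith
qed

text \<open>The factor 1/\<mu> is the point: it is the gain from integrating exp(\<mu> t), and
  \<open>persistence\<close> makes it small while \<open>asymptotics\<close> simply takes \<mu> = 1.
  The exponential in \<open>C\<close> compares the weight along the path with the weight at its end
  point, as speeds are at most \<open>M ^ n\<close>.\<close>

lemma duhamel_bound:
  assumes t0: "t0 \<in> {0..T}" and eta: "0 \<le> \<eta>" "\<eta> < 1" and k: "k \<ge> 0" and lam: "\<mu> > 0"
    and sw: "\<And>t y. t \<in> {0..T} \<Longrightarrow> s t y ^ (n + 1) \<le> k * exp (\<mu> * t) * w y"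
    and w: "\<And>x y. w y \<le> exp (\<eta> * \<bar>x - y\<bar>) * w x" and w0: "\<And>x. w x > 0"
  defines "C \<equiv> ((source_const n + real n) + source_const n / (1 - \<eta>)) * exp (\<eta> * (M ^ n * T))"
  obtains q where "q t0 = x0"
    "\<And>t. t \<in> {0..t0} \<Longrightarrow> (q has_real_derivative u t (q t) ^ n) (at t within {0..t0})"
    "\<And>t. t \<in> {0..t0} \<Longrightarrow> \<bar>q t - x0\<bar> \<le> M ^ n * T"
    "\<bar>u t0 x0 - u 0 (q 0)\<bar> \<le> C * k * w x0 * (exp (\<mu> * t0) / \<mu>)"
    "\<bar>ux t0 x0 - ux 0 (q 0)\<bar> \<le> C * k * w x0 * (exp (\<mu> * t0) / \<mu>)"
proof -
  obtain q where q0: "q t0 = x0"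
    and q: "\<And>t. t \<in> {0..t0} \<Longrightarrow> (q has_real_derivative u t (q t) ^ n) (at t within {0..t0})"
    using characteristic[OF t0] by blast
  have disp: "\<bar>q t - x0\<bar> \<le> M ^ n * T" if t: "t \<in> {0..t0}" for t
    unfolding q0[symmetric]
  proof (rule path_displacement[OF t0 q _ t])
    fix r assume "r \<in> {0..t0}"
    then have "r \<in> {0..T}" using t0 by auto
    then have "\<bar>u r (q r)\<bar> \<le> M" using bound[of r "q r"] by linarith
    then show "\<bar>u r (q r) ^ n\<bar> \<le> M ^ n" unfolding power_abs by (intro power_mono) auto
  qed
  define C0 where "C0 = (source_const n + real n) + source_const n / (1 - \<eta>)"
  have C0: "C0 \<ge> 0" unfolding C0_def using source_const_nonneg[of n] eta by (intro add_nonneg_nonneg divide_nonneg_nonneg) auto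
  have CC: "C = C0 * exp (\<eta> * (M ^ n * T))" by (simp add: C_def C0_def)
  define B where "B = C * k * w x0"
  have wq: "w (q t) \<le> exp (\<eta> * (M ^ n * T)) * w x0" if t: "t \<in> {0..t0}" for t
  proof -
    have "w (q t) \<le> exp (\<eta> * \<bar>x0 - q t\<bar>) * w x0" by (rule w)
    also have "\<dots> \<le> exp (\<eta> * (M ^ n * T)) * w x0"
      using disp[OF t] eta w0[of x0] by (intro mult_right_mono) (auto intro: mult_left_mono simp: abs_minus_commute)
    finally show ?thesis .
  qed
  have src: "\<bar>helmholtz_deriv (F t) (q t)\<bar> \<le> B * exp (\<mu> * t)" "\<bar>R t (q t)\<bar> \<le> B * exp (\<mu> * t)"
    if t: "t \<in> {0..t0}" for t
  proof -
    have t': "t \<in> {0..T}" using t t0 by auto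
    have "C0 * (k * exp (\<mu> * t)) * w (q t) \<le> C0 * (k * exp (\<mu> * t)) * (exp (\<eta> * (M ^ n * T)) * w x0)"
      using C0 k by (intro mult_left_mono wq[OF t]) auto
    also have "\<dots> = B * exp (\<mu> * t)" by (simp add: B_def CC)
    finally have le: "C0 * (k * exp (\<mu> * t)) * w (q t) \<le> B * exp (\<mu> * t)" .
    have ke: "k * exp (\<mu> * t) \<ge> 0" using k by simp
    show "\<bar>helmholtz_deriv (F t) (q t)\<bar> \<le> B * exp (\<mu> * t)"
      using source_terms_bound(1)[where w=w, OF t' eta ke sw[OF t'] w, of "q t", folded C0_def] le by linarith
    show "\<bar>R t (q t)\<bar> \<le> B * exp (\<mu> * t)"
      using source_terms_bound(2)[where w=w, OF t' eta ke sw[OF t'] w, of "q t", folded C0_def] le by linarith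
  qed
  have B: "B \<ge> 0" unfolding B_def CC using C0 k w0[of x0] by (intro mult_nonneg_nonneg) auto
  have ei: "((\<lambda>t. B * exp (\<mu> * t)) has_integral (B * exp (\<mu> * t0) / \<mu> - B * exp (\<mu> * 0) / \<mu>)) {0..t0}"
  proof (rule fundamental_theorem_of_calculus)
    fix t
    have "((\<lambda>t. B * exp (\<mu> * t) / \<mu>) has_real_derivative B * exp (\<mu> * t)) (at t within {0..t0})"
      using lam by (auto intro!: derivative_eq_intros)
    then show "((\<lambda>t. B * exp (\<mu> * t) / \<mu>) has_vector_derivative B * exp (\<mu> * t)) (at t within {0..t0})"
      by (simp add: has_real_derivative_iff_has_vector_derivative)
  qed (use t0 in auto)
  have Ib: "\<bar>I\<bar> \<le> C * k * w x0 * (exp (\<mu> * t0) / \<mu>)"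
    if I: "(g has_integral I) {0..t0}" and g: "\<And>t. t \<in> {0..t0} \<Longrightarrow> \<bar>g t\<bar> \<le> B * exp (\<mu> * t)" for g I
  proof -
    have "norm (integral {0..t0} g) \<le> integral {0..t0} (\<lambda>t. B * exp (\<mu> * t))"
      by (rule integral_norm_bound_integral) (use I ei g in \<open>auto intro: has_integral_integrable\<close>)
    also have "\<dots> \<le> B * exp (\<mu> * t0) / \<mu>"
      using integral_unique[OF ei] B lam by simp
    finally show ?thesis using integral_unique[OF I] by (simp add: B_def)
  qed
  have "\<bar>u 0 (q 0) - u t0 (q t0)\<bar> \<le> C * k * w x0 * (exp (\<mu> * t0) / \<mu>)"
    by (rule Ib[OF duhamel_u[OF t0 q]]) (use src in auto)
  moreover have "\<bar>ux 0 (q 0) - ux t0 (q t0)\<bar> \<le> C * k * w x0 * (exp (\<mu> * t0) / \<mu>)"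
    by (rule Ib[OF duhamel_ux[OF t0 q]]) (use src in auto)
  ultimately show thesis
    by (intro that[of q] q0 q disp) (simp_all add: q0 abs_minus_commute)
qed

text \<open>Since min x N is 1-Lipschitz in x, truncation keeps the growth condition with the same
  rate, uniformly in N.\<close>

lemma truncated_weight:
  fixes \<theta> :: real
  assumes "\<theta> \<ge> 0"
  shows "exp (- \<theta> * min y N) \<le> exp (\<theta> * \<bar>x - y\<bar>) * exp (- \<theta> * min x N)"
proof -
  have "\<theta> * (min x N - min y N) \<le> \<theta> * \<bar>x - y\<bar>" using assms by (intro mult_left_mono) auto
  then show ?thesis by (simp add: algebra_simps flip: exp_add)
qed

text \<open>The weight is truncated at \<open>N\<close> so that the weighted supremum \<open>Z\<close> is finite a priori; the
  factor \<open>e\<^sup>-\<^sup>\<mu>\<^sup>t\<close> with \<open>\<mu>\<close> large turns the Duhamel estimate into \<open>Z \<le> A \<kappa> + Z / 2\<close>, which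
  replaces Gronwall's inequality.\<close>

lemma persistence:
  fixes \<theta> A :: real
  assumes theta: "0 < \<theta>" "\<theta> < 1" and init: "\<And>y. s 0 y \<le> A * exp (- \<theta> * y)"
  obtains K where "K \<ge> 0" "\<And>t x. t \<in> {0..T} \<Longrightarrow> s t x \<le> K * exp (- \<theta> * x)"
proof -
  define \<kappa> where "\<kappa> = exp (\<theta> * (M ^ n * T))"
  define C where "C = ((source_const n + real n) + source_const n / (1 - \<theta>)) * \<kappa>"
  \<comment> \<open>Chosen so that 2 C M^n / \<mu> \<le> 1/2, the factor 2 coming from adding the
    estimates for u and u_x; the 1 keeps \<mu> positive.\<close>
  define \<mu> where "\<mu> = 4 * C * M ^ n + 1"
  have A: "A \<ge> 0" using init[of 0] by simp
  have C: "C \<ge> 0" unfolding C_def \<kappa>_def using source_const_nonneg[of n] theta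
    by (intro mult_nonneg_nonneg add_nonneg_nonneg divide_nonneg_nonneg) auto
  have Mn: "M ^ n \<ge> 0" using M_nonneg by simp
  have "0 \<le> C * M ^ n" using C Mn by simp
  then have lam: "\<mu> > 0" "2 * C * M ^ n / \<mu> \<le> 1 / 2" by (auto simp: \<mu>_def pos_divide_le_eq)
  have main: "s t x \<le> 2 * A * \<kappa> * exp (\<mu> * T) * exp (- \<theta> * min x N)" if t: "t \<in> {0..T}" for t x N
  proof -
    define w where "w = (\<lambda>x. exp (- \<theta> * min x N))"
    define S where "S = (\<lambda>p. s (fst p) (snd p) * exp (- \<mu> * fst p) / w (snd p)) ` ({0..T} \<times> UNIV)"
    define Z where "Z = Sup S"
    have w0: "w x > 0" for x by (simp add: w_def)
    have w: "w y \<le> exp (\<theta> * \<bar>x - y\<bar>) * w x" for x y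
      unfolding w_def by (rule truncated_weight) (use theta in simp)
    \<comment> \<open>Here the truncation is used: the weight is bounded below by its value at
      N.\<close>
    have bdd: "bdd_above S"
    proof (rule bdd_aboveI)
      fix z assume "z \<in> S"
      then obtain t x where t: "t \<in> {0..T}" and z: "z = s t x * exp (- \<mu> * t) / w x" by (auto simp: S_def)
      have "w x \<ge> exp (- \<theta> * N)" using theta by (simp add: w_def)
      have "s t x * exp (- \<mu> * t) \<le> M * 1"
        using bound[OF t, of x] lam t by (intro mult_mono) (auto simp: M_nonneg)
      then have "z \<le> M / exp (- \<theta> * N)"
        unfolding z using \<open>w x \<ge> exp (- \<theta> * N)\<close> by (intro frac_le) (auto simp: M_nonneg)
      then show "z \<le> M / exp (- \<theta> * N)" .
    qed
    have ZS: "s t x \<le> Z * exp (\<mu> * t) * w x" if "t \<in> {0..T}" for t x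
    proof -
      have "s t x * exp (- \<mu> * t) / w x \<le> Z"
        unfolding Z_def by (rule cSup_upper[OF _ bdd]) (use that in \<open>force simp: S_def\<close>)
      then have "s t x * exp (- \<mu> * t) \<le> Z * w x" using w0[of x] by (simp add: pos_divide_le_eq)
      then have "s t x * exp (- \<mu> * t) * exp (\<mu> * t) \<le> Z * w x * exp (\<mu> * t)" by (intro mult_right_mono) auto
      then show ?thesis by (simp add: mult.assoc mult.commute[of _ "w x"] flip: exp_add)
    qed
    have Z: "Z \<ge> 0"
    proof -
      have "0 \<le> s 0 0" by simp
      also have "\<dots> \<le> Z * exp (\<mu> * 0) * w 0" using T by (intro ZS) auto
      finally show ?thesis using w0[of 0] by (simp add: zero_le_mult_iff)
    qed
    \<comment> \<open>Of the n + 1 factors, n are spent on the bound M and one carries the weight,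
      so the estimate is linear in \<open>Z\<close>.\<close>
    have sw: "s t y ^ (n + 1) \<le> M ^ n * Z * exp (\<mu> * t) * w y" if t: "t \<in> {0..T}" for t y
    proof -
      have "s t y ^ n * s t y \<le> M ^ n * (Z * exp (\<mu> * t) * w y)"
        by (intro mult_mono power_mono bound[OF t] ZS[OF t]) (use M_nonneg in auto)
      then show ?thesis by (simp add: mult_ac)
    qed
    have "z \<le> A * \<kappa> + Z / 2" if zS: "z \<in> S" for z
    proof -
      obtain t0 x0 where t0: "t0 \<in> {0..T}" and z: "z = s t0 x0 * exp (- \<mu> * t0) / w x0"
        using zS by (auto simp: S_def)
      have k: "M ^ n * Z \<ge> 0" using Mn Z by simp
      obtain q where q: "q t0 = x0" "\<And>t. t \<in> {0..t0} \<Longrightarrow> \<bar>q t - x0\<bar> \<le> M ^ n * T"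
        and D: "\<bar>u t0 x0 - u 0 (q 0)\<bar> \<le> C * (M ^ n * Z) * w x0 * (exp (\<mu> * t0) / \<mu>)"
          "\<bar>ux t0 x0 - ux 0 (q 0)\<bar> \<le> C * (M ^ n * Z) * w x0 * (exp (\<mu> * t0) / \<mu>)"
        by (rule duhamel_bound[where w=w and k="M ^ n * Z" and \<mu>=\<mu> and \<eta>=\<theta> and ?x0.0=x0,
            OF t0 less_imp_le[OF theta(1)] theta(2) k lam(1) sw w w0, folded \<kappa>_def, folded C_def]) (assumption | rule that; (assumption | blast))+
      have "w (q 0) \<le> exp (\<theta> * \<bar>x0 - q 0\<bar>) * w x0" by (rule w)
      also have "\<dots> \<le> \<kappa> * w x0"
        unfolding \<kappa>_def using q(2)[of 0] t0 theta w0[of x0]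
        by (intro mult_right_mono) (auto intro: mult_left_mono simp: abs_minus_commute)
      finally have wq: "w (q 0) \<le> \<kappa> * w x0" .
      have "s 0 (q 0) \<le> A * exp (- \<theta> * q 0)" by (rule init)
      also have "\<dots> \<le> A * w (q 0)" unfolding w_def using theta A by (intro mult_left_mono) auto
      also have "\<dots> \<le> A * (\<kappa> * w x0)" using wq A by (intro mult_left_mono)
      finally have i: "s 0 (q 0) \<le> A * (\<kappa> * w x0)" .
      have e1: "1 \<le> exp (\<mu> * t0)" using lam t0 by simp
      have "s t0 x0 \<le> s 0 (q 0) + 2 * (C * (M ^ n * Z) * w x0 * (exp (\<mu> * t0) / \<mu>))"
        using D by linarith
      also have "\<dots> \<le> A * (\<kappa> * w x0) * exp (\<mu> * t0) + (2 * C * M ^ n / \<mu>) * (Z * w x0 * exp (\<mu> * t0))"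
      proof (rule add_mono)
        have "A * (\<kappa> * w x0) * 1 \<le> A * (\<kappa> * w x0) * exp (\<mu> * t0)"
          using e1 A w0[of x0] by (intro mult_left_mono) (auto simp: \<kappa>_def)
        with i show "s 0 (q 0) \<le> A * (\<kappa> * w x0) * exp (\<mu> * t0)" by simp
      qed (simp add: mult_ac)
      also have "\<dots> \<le> A * (\<kappa> * w x0) * exp (\<mu> * t0) + (1 / 2) * (Z * w x0 * exp (\<mu> * t0))"
        using lam(2) Z w0[of x0] by (intro add_left_mono mult_right_mono) auto
      also have "\<dots> = (A * \<kappa> + Z / 2) * (w x0 * exp (\<mu> * t0))" by (simp add: algebra_simps)
      finally have "s t0 x0 * exp (- \<mu> * t0) \<le> (A * \<kappa> + Z / 2) * (w x0 * exp (\<mu> * t0)) * exp (- \<mu> * t0)"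
        by (intro mult_right_mono) auto
      also have "\<dots> = (A * \<kappa> + Z / 2) * w x0" by (simp add: mult.assoc flip: exp_add)
      finally show ?thesis unfolding z using w0[of x0] by (simp add: pos_divide_le_eq)
    qed
    then have "Z \<le> A * \<kappa> + Z / 2"
      unfolding Z_def[of] by (intro cSup_least) (use T in \<open>auto simp: S_def\<close>)
    then have Z2: "Z \<le> 2 * A * \<kappa>" by simp
    have "s t x \<le> Z * exp (\<mu> * t) * w x" by (rule ZS[OF t])
    also have "\<dots> \<le> 2 * A * \<kappa> * exp (\<mu> * T) * w x"
      using Z2 Z t lam A w0[of x] by (intro mult_right_mono mult_mono) (auto simp: \<kappa>_def)
    finally show ?thesis by (simp add: w_def)
  qed
  show thesis
  proof (rule that)
    show "2 * A * \<kappa> * exp (\<mu> * T) \<ge> 0" using A by (simp add: \<kappa>_def)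
    \<comment> \<open>The bound does not depend on N, so N may be the point x itself, where the
      truncation is invisible.\<close>
    show "s t x \<le> 2 * A * \<kappa> * exp (\<mu> * T) * exp (- \<theta> * x)" if "t \<in> {0..T}" for t x
      using main[OF that, of x x] by simp
  qed
qed

text \<open>The witness y is the foot at time 0 of the characteristic through (t, x): its distance
  from x is the displacement, and the two remaining estimates are Duhamel's formula with sources of
  the faster rate \<theta> + \<rho>.\<close>

lemma asymptotics:
  fixes \<theta> A :: real
  assumes theta: "0 < \<theta>" "\<theta> < 1" and init: "\<And>y. s 0 y \<le> A * exp (- \<theta> * y)"
  obtains \<rho> K where "\<rho> > 0"
    "\<And>t x. t \<in> {0..T} \<Longrightarrow> \<exists>y. \<bar>y - x\<bar> \<le> K * exp (- \<theta> * x) \<and>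
      \<bar>u t x - u 0 y\<bar> \<le> K * exp (- (\<theta> + \<rho>) * x) \<and> \<bar>ux t x - ux 0 y\<bar> \<le> K * exp (- (\<theta> + \<rho>) * x)"
proof -
  obtain K where K: "K \<ge> 0" "\<And>t x. t \<in> {0..T} \<Longrightarrow> s t x \<le> K * exp (- \<theta> * x)"
    using persistence[OF theta init] by blast
  define \<rho> where "\<rho> = min \<theta> (1 - \<theta>) / 2"
  have "2 * \<rho> \<le> \<theta>" "2 * \<rho> \<le> 1 - \<theta>" "\<rho> > 0" using theta by (simp_all add: \<rho>_def)
  then have rho: "\<rho> > 0" "\<rho> \<le> \<theta>" "\<theta> + \<rho> < 1" using theta by linarith+
  define B where "B = max M K"
  have B: "B \<ge> 0" "B \<ge> M" "B \<ge> K" using K(1) by (auto simp: B_def)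
  define w where "w = (\<lambda>x::real. exp (- (\<theta> + \<rho>) * x))"
  \<comment> \<open>On the right the rate \<theta> is lowered to \<rho>; on the left exp(-\<rho> x)
    is at least 1 and the bound M suffices.\<close>
  have sB: "s t x \<le> B * exp (- \<rho> * x)" if t: "t \<in> {0..T}" for t x
  proof (cases "x \<ge> 0")
    case True
    have "s t x \<le> K * exp (- \<theta> * x)" by (rule K(2)[OF t])
    also have "\<dots> \<le> B * exp (- \<rho> * x)"
      using True rho B by (intro mult_mono) (auto intro: mult_right_mono)
    finally show ?thesis .
  next
    case False
    have "s t x \<le> M * 1" using bound[OF t] by simp
    also have "\<dots> \<le> B * exp (- \<rho> * x)"
      using False rho B by (intro mult_mono) (auto simp: mult_le_0_iff)
    finally show ?thesis .
  qed
  define k where "k = M ^ (n - 1) * (B * K)"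
  have k: "k \<ge> 0" using M_nonneg B K by (simp add: k_def)
  have sn: "s t y ^ n \<le> M ^ (n - 1) * s t y" if t: "t \<in> {0..T}" for t y
  proof -
    have "s t y ^ n = s t y ^ (n - 1) * s t y" using n by (simp add: power_eq_if)
    also have "\<dots> \<le> M ^ (n - 1) * s t y" by (intro mult_right_mono power_mono bound[OF t]) auto
    finally show ?thesis .
  qed
  \<comment> \<open>One factor contributes the rate \<theta>, a second one the rate \<rho>, and the
    remaining n - 1 are bounded by M.\<close>
  have sw: "s t y ^ (n + 1) \<le> k * exp (1 * t) * w y" if t: "t \<in> {0..T}" for t y
  proof -
    have "s t y ^ (n + 1) \<le> M ^ (n - 1) * s t y * s t y"
      using mult_right_mono[OF sn[OF t], of "s t y" y] by (simp add: mult.commute)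
    also have "\<dots> = M ^ (n - 1) * (s t y * s t y)" by simp
    also have "\<dots> \<le> M ^ (n - 1) * ((B * exp (- \<rho> * y)) * (K * exp (- \<theta> * y)))"
      using B K by (intro mult_left_mono mult_mono sB[OF t] K(2)[OF t]) (auto simp: M_nonneg)
    also have "\<dots> = k * (exp (- \<rho> * y) * exp (- \<theta> * y))" by (simp add: k_def)
    also have "exp (- \<rho> * y) * exp (- \<theta> * y) = w y" by (simp add: w_def algebra_simps flip: exp_add)
    also have "k * w y \<le> k * exp (1 * t) * w y"
      using t k by (intro mult_right_mono mult_le_cancel_left1[THEN iffD2]) (auto simp: w_def)
    finally show ?thesis .
  qed
  have w: "w y \<le> exp ((\<theta> + \<rho>) * \<bar>x - y\<bar>) * w x" for x y
  proof -
    have "(\<theta> + \<rho>) * (x - y) \<le> (\<theta> + \<rho>) * \<bar>x - y\<bar>" using theta rho by (intro mult_left_mono) auto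
    then show ?thesis by (simp add: w_def algebra_simps flip: exp_add)
  qed
  have w0: "w x > 0" for x by (simp add: w_def)
  have eta: "0 \<le> \<theta> + \<rho>" using theta rho by simp
  define C where "C = ((source_const n + real n) + source_const n / (1 - (\<theta> + \<rho>))) * exp ((\<theta> + \<rho>) * (M ^ n * T))"
  have C: "C \<ge> 0" unfolding C_def using source_const_nonneg[of n] rho
    by (intro mult_nonneg_nonneg add_nonneg_nonneg divide_nonneg_nonneg) auto
  \<comment> \<open>\<open>K2\<close> belongs to the displacement of the characteristic,
    \<open>K3\<close> to the two Duhamel estimates.\<close>
  define K2 where "K2 = M ^ (n - 1) * (K * exp (\<theta> * (M ^ n * T))) * T"
  define K3 where "K3 = C * k * exp T"
  define K' where "K' = max K2 K3"
  show thesis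
  proof (rule that[OF rho(1)])
    fix t0 x0 assume t0: "t0 \<in> {0..T}"
    obtain q where q0: "q t0 = x0"
      and q: "\<And>t. t \<in> {0..t0} \<Longrightarrow> (q has_real_derivative u t (q t) ^ n) (at t within {0..t0})"
      and d: "\<And>t. t \<in> {0..t0} \<Longrightarrow> \<bar>q t - x0\<bar> \<le> M ^ n * T"
      and D: "\<bar>u t0 x0 - u 0 (q 0)\<bar> \<le> C * k * w x0 * (exp (1 * t0) / 1)"
        "\<bar>ux t0 x0 - ux 0 (q 0)\<bar> \<le> C * k * w x0 * (exp (1 * t0) / 1)"
      by (rule duhamel_bound[where w=w and k=k and \<mu>=1 and \<eta>="\<theta> + \<rho>" and ?x0.0=x0,
          OF t0 eta rho(3) k zero_less_one sw w w0, folded C_def]) (assumption | rule that; (assumption | blast))+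
    have "C * k * w x0 * (exp (1 * t0) / 1) = C * k * exp t0 * w x0" by simp
    also have "\<dots> \<le> K3 * w x0"
      unfolding K3_def using t0 C k w0[of x0] by (intro mult_right_mono mult_left_mono) auto
    also have "\<dots> \<le> K' * w x0" unfolding K'_def using w0[of x0] by (intro mult_right_mono) auto
    finally have le: "C * k * w x0 * (exp (1 * t0) / 1) \<le> K' * exp (- (\<theta> + \<rho>) * x0)" by (simp add: w_def)
    \<comment> \<open>A bootstrap: the crude displacement bound allows \<open>q t\<close> to be
      replaced by \<open>x0\<close> in the exponent, and then the speed, of size at most M^(n-1)
      times \<open>s t (q t)\<close>, is seen to decay.\<close>
    have "\<bar>q 0 - q t0\<bar> \<le> (M ^ (n - 1) * (K * exp (\<theta> * (M ^ n * T)) * exp (- \<theta> * x0))) * T"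
    proof (rule path_displacement[OF t0 q])
      fix t assume t: "t \<in> {0..t0}"
      then have t': "t \<in> {0..T}" using t0 by auto
      have "\<bar>u t (q t) ^ n\<bar> \<le> s t (q t) ^ n" unfolding power_abs by (intro power_mono) auto
      also have "\<dots> \<le> M ^ (n - 1) * s t (q t)" by (rule sn[OF t'])
      also have "\<dots> \<le> M ^ (n - 1) * (K * exp (- \<theta> * q t))"
        by (intro mult_left_mono K(2)[OF t']) (simp add: M_nonneg)
      also have "\<dots> \<le> M ^ (n - 1) * (K * exp (\<theta> * (M ^ n * T) - \<theta> * x0))"
      proof -
        have "\<theta> * (x0 - q t) \<le> \<theta> * (M ^ n * T)" using d[OF t] theta by (intro mult_left_mono) auto
        then show ?thesis using K(1) M_nonneg by (intro mult_left_mono) (auto simp: algebra_simps)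
      qed
      also have "\<dots> = M ^ (n - 1) * (K * exp (\<theta> * (M ^ n * T)) * exp (- \<theta> * x0))"
        by (simp add: exp_diff exp_minus divide_inverse)
      finally show "\<bar>u t (q t) ^ n\<bar> \<le> M ^ (n - 1) * (K * exp (\<theta> * (M ^ n * T)) * exp (- \<theta> * x0))" .
    qed (use t0 in auto)
    also have "\<dots> = K2 * exp (- \<theta> * x0)" by (simp add: K2_def)
    also have "\<dots> \<le> K' * exp (- \<theta> * x0)" unfolding K'_def by (intro mult_right_mono) auto
    finally have "\<bar>q 0 - x0\<bar> \<le> K' * exp (- \<theta> * x0)" by (simp add: q0)
    then show "\<exists>y. \<bar>y - x0\<bar> \<le> K' * exp (- \<theta> * x0) \<and>
      \<bar>u t0 x0 - u 0 y\<bar> \<le> K' * exp (- (\<theta> + \<rho>) * x0) \<and> \<bar>ux t0 x0 - ux 0 y\<bar> \<le> K' * exp (- (\<theta> + \<rho>) * x0)"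
      using D le by (intro exI[of _ "q 0"]) linarith
  qed
qed

end

section \<open>Asymptotics at infinity\<close>

text \<open>The limit controls the quotient to the right of some X; to the left the weight is at
  least exp(-\<theta> X), so boundedness of f is enough.\<close>

lemma exp_order_bounded:
  assumes f: "exp_order (- \<theta>) f" and b: "\<And>x. \<bar>f x\<bar> \<le> M" and theta: "\<theta> > 0"
  obtains A where "\<And>x. \<bar>f x\<bar> \<le> A * exp (- \<theta> * x)"
proof -
  obtain L where "((\<lambda>x. \<bar>f x\<bar> / exp (- \<theta> * x)) \<longlongrightarrow> L) at_top"
    using f by (auto simp: exp_order_def)
  then have "\<forall>\<^sub>F x in at_top. \<bar>f x\<bar> / exp (- \<theta> * x) < L + 1" by (rule order_tendstoD) simp
  then obtain X where X: "\<And>x. x \<ge> X \<Longrightarrow> \<bar>f x\<bar> / exp (- \<theta> * x) < L + 1"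
    unfolding eventually_at_top_linorder by blast
  have M: "M \<ge> 0" using b[of 0] by linarith
  show thesis
  proof (rule that[of "max (L + 1) (M * exp (\<theta> * X))"])
    fix x
    show "\<bar>f x\<bar> \<le> max (L + 1) (M * exp (\<theta> * X)) * exp (- \<theta> * x)"
    proof (cases "x \<ge> X")
      case True
      have "\<bar>f x\<bar> \<le> (L + 1) * exp (- \<theta> * x)" using X[OF True] by (simp add: pos_divide_less_eq)
      also have "\<dots> \<le> max (L + 1) (M * exp (\<theta> * X)) * exp (- \<theta> * x)" by (intro mult_right_mono) auto
      finally show ?thesis .
    next
      case False
      have "\<theta> * x \<le> \<theta> * X" using False theta by (intro mult_left_mono) auto
      then have "1 \<le> exp (\<theta> * X) * exp (- \<theta> * x)" by (simp flip: exp_add)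
      then have "M * 1 \<le> M * (exp (\<theta> * X) * exp (- \<theta> * x))" using M by (intro mult_left_mono)
      then have "\<bar>f x\<bar> \<le> M * exp (\<theta> * X) * exp (- \<theta> * x)" using b[of x] by (simp add: mult.assoc)
      also have "\<dots> \<le> max (L + 1) (M * exp (\<theta> * X)) * exp (- \<theta> * x)" by (intro mult_right_mono) auto
      finally show ?thesis .
    qed
  qed
qed

text \<open>A shift of size exp(-\<theta> x) changes the weight by a factor tending to 1, and the
  error of rate \<theta> + \<rho> is still small after division by the weight. Neither depends on t,
  so all times share the limit L of g.\<close>

lemma exp_order_uniform_shift:
  assumes g: "exp_order (- \<theta>) g" and theta: "\<theta> > 0" and rho: "\<rho> > 0"
    and sh: "\<And>t x. t \<in> I \<Longrightarrow> \<exists>y. \<bar>y - x\<bar> \<le> K * exp (- \<theta> * x) \<and> \<bar>f t x - g y\<bar> \<le> K * exp (- (\<theta> + \<rho>) * x)"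
  shows "exp_order_uniform (- \<theta>) I f"
proof -
  obtain L where L: "((\<lambda>x. \<bar>g x\<bar> / exp (- \<theta> * x)) \<longlongrightarrow> L) at_top"
    using g by (auto simp: exp_order_def)
  have decay: "((\<lambda>x. K * exp (- c * x)) \<longlongrightarrow> 0) at_top" if "c > 0" for c :: real
    using that by real_asymp
  have "uniform_limit I (\<lambda>x t. \<bar>f t x\<bar> / exp (- \<theta> * x)) (\<lambda>_. L) at_top"
  proof (rule uniform_limitI)
    fix e :: real assume e: "e > 0"
    \<comment> \<open>At (x - y, |g y| / exp(-\<theta> y)) the value of \<open>p\<close> is |g y| /
      exp(-\<theta> x); continuity at (0, L) handles the change of weight and the limit of g
      together.\<close>
    define p where "p = (\<lambda>z. exp (\<theta> * fst z) * snd z)"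
    have "isCont p (0, L)" unfolding p_def by (intro continuous_intros)
    then obtain d where d: "d > 0" "\<And>z. dist z (0, L) < d \<Longrightarrow> dist (p z) (p (0, L)) < e / 2"
      using e unfolding continuous_at_eps_delta by (metis half_gt_zero)
    obtain X where X: "\<And>y. y \<ge> X \<Longrightarrow> dist (\<bar>g y\<bar> / exp (- \<theta> * y)) L < d / 2"
      using tendstoD[OF L half_gt_zero[OF d(1)]] unfolding eventually_at_top_linorder by blast
    \<comment> \<open>The bound 1 on the shift matches the threshold X + 1 below and keeps y to the
      right of X.\<close>
    have "\<forall>\<^sub>F x in at_top. K * exp (- \<theta> * x) < min 1 (d / 2)"
      using d(1) by (intro order_tendstoD(2)[OF decay[OF theta]]) auto
    moreover have "\<forall>\<^sub>F x in at_top. K * exp (- \<rho> * x) < e / 2"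
      using e by (intro order_tendstoD(2)[OF decay[OF rho]]) auto
    moreover have "\<forall>\<^sub>F x in at_top. x \<ge> X + 1" by (rule eventually_ge_at_top)
    ultimately show "\<forall>\<^sub>F x in at_top. \<forall>t\<in>I. dist (\<bar>f t x\<bar> / exp (- \<theta> * x)) L < e"
    proof eventually_elim
      case (elim x)
      show ?case
      proof
        fix t assume "t \<in> I"
        then obtain y where y: "\<bar>y - x\<bar> \<le> K * exp (- \<theta> * x)" "\<bar>f t x - g y\<bar> \<le> K * exp (- (\<theta> + \<rho>) * x)"
          using sh by blast
        have "K * exp (- \<theta> * x) < 1" "K * exp (- \<theta> * x) < d / 2" using elim(1) by auto
        then have yx: "\<bar>y - x\<bar> < 1" "\<bar>x - y\<bar> < d / 2" using y(1) by linarith+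
        have yX: "y \<ge> X" using yx elim(3) by linarith
        define z where "z = (x - y, \<bar>g y\<bar> / exp (- \<theta> * y))"
        have "dist z (0, L) \<le> dist (x - y) 0 + dist (\<bar>g y\<bar> / exp (- \<theta> * y)) L"
          unfolding z_def dist_Pair_Pair by (rule order_trans[OF sqrt_sum_squares_le_sum]) auto
        also have "\<dots> < d" using yx(2) X[OF yX] by (simp add: dist_real_def)
        finally have "dist (p z) (p (0, L)) < e / 2" by (rule d(2))
        moreover have "p z = \<bar>g y\<bar> / exp (- \<theta> * x)"
          by (simp add: p_def z_def exp_minus field_simps flip: exp_add)
        ultimately have 1: "\<bar>\<bar>g y\<bar> / exp (- \<theta> * x) - L\<bar> < e / 2" by (simp add: p_def dist_real_def)
        have "\<bar>f t x - g y\<bar> / exp (- \<theta> * x) \<le> K * exp (- (\<theta> + \<rho>) * x) / exp (- \<theta> * x)"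
          by (intro divide_right_mono y) auto
        also have "exp (- (\<theta> + \<rho>) * x) = exp (- \<rho> * x) * exp (- \<theta> * x)"
          by (simp add: algebra_simps flip: exp_add)
        also have "K * (exp (- \<rho> * x) * exp (- \<theta> * x)) / exp (- \<theta> * x) = K * exp (- \<rho> * x)" by simp
        finally have 2: "\<bar>f t x - g y\<bar> / exp (- \<theta> * x) < e / 2" using elim(2) by linarith
        have "\<bar>\<bar>f t x\<bar> / exp (- \<theta> * x) - \<bar>g y\<bar> / exp (- \<theta> * x)\<bar> = \<bar>\<bar>f t x\<bar> - \<bar>g y\<bar>\<bar> / exp (- \<theta> * x)"
          by (simp flip: diff_divide_distrib)
        also have "\<dots> \<le> \<bar>f t x - g y\<bar> / exp (- \<theta> * x)" by (intro divide_right_mono) auto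
        finally show "dist (\<bar>f t x\<bar> / exp (- \<theta> * x)) L < e" using 1 2 unfolding dist_real_def by linarith
      qed
    qed
  qed
  then show ?thesis unfolding exp_order_uniform_def by blast
qed

section \<open>Passage from the Sobolev solution to its classical form\<close>

theorem theorem2p3:
  fixes n :: nat and T0 s \<theta> :: real
    and u :: "real \<Rightarrow> real \<Rightarrow> real" and u0 :: "real \<Rightarrow> real"
  assumes "n \<ge> 1" and "T0 > 0" and "s > 3 / 2"
    and "solution_on n s {0..T0} u"
    and "u 0 = u0"
    and "0 < \<theta>" and "\<theta> < 1"
    and "exp_order (- \<theta>) u0"
    and "exp_order (- \<theta>) (deriv u0)"
  shows "exp_order_uniform (- \<theta>) {0..T0} u
    \<and> exp_order_uniform (- \<theta>) {0..T0} (\<lambda>t. deriv (u t))"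
proof -
  define I where "I = {0..T0}"
  have s: "s > 1 / 2" "s - 1 > 1 / 2" using \<open>s > 3 / 2\<close> by auto
  have c: "\<And>t. t \<in> I \<Longrightarrow> continuous_on UNIV (u t)" and C0: "sobolev_C0 s I u"
    using assms(4) by (auto simp: solution_on_def I_def)
  obtain v where v: "sobolev_C1_deriv (s - 1) I u v"
    and eq: "\<And>t. t \<in> I \<Longrightarrow> AE x in lborel. v t x + u t x ^ n * deriv (u t) x
      + deriv (inv_helmholtz (source n (u t) (deriv (u t)))) x = 0"
    using assms(4) unfolding solution_on_def I_def source_def[abs_def] by blast
  have S: "u t \<in> sobolev s" "v t \<in> sobolev (s - 1)" if "t \<in> I" for t
    using C0 v that by (auto simp: sobolev_C0_def sobolev_C1_deriv_def)
  have d: "(u t has_real_derivative deriv (u t) x) (at x)" "continuous_on UNIV (deriv (u t))"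
    if "t \<in> I" for t x
    using sobolev_deriv[OF \<open>s > 3 / 2\<close> S(1)[OF that] c[OF that]] by auto
  have un_u: "\<forall>\<^sub>F r in at t within I. \<forall>x. \<bar>u r x - u t x\<bar> < e" if "t \<in> I" "e > 0" for t e
    by (rule sobolev_C0_uniform[OF s(1) C0 that c]) auto
  have un_d: "\<forall>\<^sub>F r in at t within I. \<forall>x. \<bar>deriv (u r) x - deriv (u t) x\<bar> < e" if "t \<in> I" "e > 0" for t e
    by (rule sobolev_C0_deriv_uniform[OF \<open>s > 3 / 2\<close> C0 that c])
  have I: "compact I" by (simp add: I_def)
  have "\<exists>B. \<forall>x. \<bar>u t x\<bar> \<le> B" if "t \<in> I" for t
    using sobolev_sup_bound[OF s(1) S(1)[OF that] _ c[OF that]] by auto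
  then obtain M1 where M1: "\<And>t x. t \<in> I \<Longrightarrow> \<bar>u t x\<bar> \<le> M1"
    using uniform_bounded[OF un_u _ I] by blast
  have "\<exists>B. \<forall>x. \<bar>deriv (u t) x\<bar> \<le> B" if "t \<in> I" for t
    using sobolev_deriv(3)[OF \<open>s > 3 / 2\<close> S(1)[OF that] c[OF that]] by auto
  then obtain M2 where M2: "\<And>t x. t \<in> I \<Longrightarrow> \<bar>deriv (u t) x\<bar> \<le> M2"
    using uniform_bounded[OF un_d _ I] by blast
  have bound: "\<bar>u t x\<bar> + \<bar>deriv (u t) x\<bar> \<le> M1 + M2" if "t \<in> I" for t x
    using M1[OF that] M2[OF that] by (rule add_mono)
  \<comment> \<open>\<open>v t\<close> is only a class modulo null sets; its continuous
    representative serves as the classical time derivative.\<close>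
  define w where "w = (\<lambda>t. cont_rep (v t))"
  have w: "continuous_on UNIV (w t)" "AE x in lborel. v t x = w t x" if "t \<in> I" for t
    unfolding w_def by (rule sobolev_cont_rep[OF s(2) S(2)[OF that]])+
  have wd: "((\<lambda>r. u r x) has_real_derivative w t x) (at t within I)" if "t \<in> I" for t x
    by (rule sobolev_C1_has_derivative[OF s(2) v that c w[OF that]])
  have eqn: "w t x + u t x ^ n * deriv (u t) x + helmholtz_deriv (source n (u t) (deriv (u t))) x = 0"
    if t: "t \<in> I" for t x
  proof -
    define F where "F = source n (u t) (deriv (u t))"
    have Fc: "continuous_on UNIV F"
      unfolding F_def source_def[abs_def] by (intro continuous_intros c d t)
    have Fb: "\<bar>F y\<bar> \<le> source_const n * (M1 + M2) ^ (n + 1)" for y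
      unfolding F_def by (rule order_trans[OF source_bound[OF \<open>n \<ge> 1\<close>]])
        (intro mult_left_mono power_mono bound t source_const_nonneg add_nonneg_nonneg abs_ge_zero)
    note Fd = inv_helmholtz_deriv[OF Fc Fb]
    have D: "deriv (inv_helmholtz F) = helmholtz_deriv F" using DERIV_imp_deriv[OF Fd(1)] by auto
    \<comment> \<open>The equation holds almost everywhere by definition of a solution; with
      \<open>w\<close> in place of \<open>v\<close> every term is continuous, so it holds at every
      x.\<close>
    have "AE x in lborel. w t x + u t x ^ n * deriv (u t) x + helmholtz_deriv F x = 0"
      using eq[OF t] w(2)[OF t] unfolding F_def[symmetric] by eventually_elim (simp add: D)
    moreover have "continuous_on UNIV (helmholtz_deriv F)"
      by (rule DERIV_continuous_on[OF Fd(2)])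
    then have "continuous_on UNIV (\<lambda>x. w t x + u t x ^ n * deriv (u t) x + helmholtz_deriv F x)"
      by (intro continuous_intros c d w t)
    ultimately have "(\<lambda>x. w t x + u t x ^ n * deriv (u t) x + helmholtz_deriv F x) = (\<lambda>_. 0)"
      by (rule AE_eq_continuous) simp
    then show ?thesis unfolding F_def by (rule fun_cong)
  qed
  interpret transport_solution n T0 "M1 + M2" u "\<lambda>t. deriv (u t)" w
  proof
    show "continuous_on ({0..T0} \<times> UNIV) (\<lambda>(t, x). u t x)"
      using uniform_joint_continuous[OF un_u c] by (simp add: I_def)
    show "continuous_on ({0..T0} \<times> UNIV) (\<lambda>(t, x). deriv (u t) x)"
      using uniform_joint_continuous[OF un_d d(2)] by (simp add: I_def)
  qed (use assms(1,2) d wd bound eqn in \<open>auto simp: I_def\<close>)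
  have 0: "0 \<in> I" using \<open>T0 > 0\<close> by (simp add: I_def)
  have init: "exp_order (- \<theta>) (u 0)" "exp_order (- \<theta>) (deriv (u 0))"
    using assms(5,8,9) by simp_all
  obtain A1 where A1: "\<And>x. \<bar>u 0 x\<bar> \<le> A1 * exp (- \<theta> * x)"
    using exp_order_bounded[OF init(1) M1[OF 0] \<open>0 < \<theta>\<close>] by blast
  obtain A2 where A2: "\<And>x. \<bar>deriv (u 0) x\<bar> \<le> A2 * exp (- \<theta> * x)"
    using exp_order_bounded[OF init(2) M2[OF 0] \<open>0 < \<theta>\<close>] by blast
  have "\<bar>u 0 x\<bar> + \<bar>deriv (u 0) x\<bar> \<le> (A1 + A2) * exp (- \<theta> * x)" for x
    using A1[of x] A2[of x] by (simp add: distrib_right)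
  then obtain \<rho> K where rho: "\<rho> > 0"
    and K: "\<And>t x. t \<in> {0..T0} \<Longrightarrow> \<exists>y. \<bar>y - x\<bar> \<le> K * exp (- \<theta> * x) \<and>
      \<bar>u t x - u 0 y\<bar> \<le> K * exp (- (\<theta> + \<rho>) * x) \<and> \<bar>deriv (u t) x - deriv (u 0) y\<bar> \<le> K * exp (- (\<theta> + \<rho>) * x)"
    using asymptotics[OF \<open>0 < \<theta>\<close> \<open>\<theta> < 1\<close>] by blast
  show ?thesis
  proof
    show "exp_order_uniform (- \<theta>) {0..T0} u"
      by (rule exp_order_uniform_shift[where g="u 0", OF init(1) \<open>0 < \<theta>\<close> rho]) (use K in blast)
    show "exp_order_uniform (- \<theta>) {0..T0} (\<lambda>t. deriv (u t))"
      by (rule exp_order_uniform_shift[where g="deriv (u 0)", OF init(2) \<open>0 < \<theta>\<close> rho]) (use K in blast)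
  qed
qed

end
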